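(* Let $1<q<\infty$, and let $1<p<t<r<\infty$ or $1<p\le t<r=\infty$. Then $M_{p,q}^{t,r}(\mathbb R^n)=\left(\mathcal H_{p',q'}^{t',r'}(\mathbb R^n)\right)^*$ in the following sense. (i) Let $f\in M_{p,q}^{t,r}(\mathbb R^n)$. Then for any $g\in\mathcal H_{p',q'}^{t',r'}(\mathbb R^n)$ we have $fg\in L^1(\mathbb R^n)$, and the mapping $g\mapsto\int_{\mathbb R^n}f(x)g(x)\,dx\in\mathbb C$ defines a continuous linear functional $L_f$ on $\mathcal H_{p',q'}^{t',r'}(\mathbb R^n)$. (ii) Conversely, any continuous linear functional $L$ on $\mathcal H_{p',q'}^{t',r'}(\mathbb R^n)$ can be realized as $L=L_f$ with a certain $f\in M_{p,q}^{t,r}(\mathbb R^n)$. (iii) The correspondence $\tau: M_{p,q}^{t,r}(\mathbb R^n)\ni f\mapsto L_f\in\left(\mathcal H_{p',q'}^{t',r'}(\mathbb R^n)\right)^*$ is an isomorphism. Furthermore, $$\|f\|_{M_{p,q}^{t,r}(\mathbb R^n)}\approx\sup_{\|k\|_{\mathcal H_{p',q'}^{t',r'}(\mathbb R^n)}=1}\left|\int_{\mathbb R^n}f(x)k(x)\,dx\right|$$ for $f\in M_{p,q}^{t,r}(\mathbb R^n)$, and $$\|g\|_{\mathcal H_{p',q'}^{t',r'}(\mathbb R^n)}\approx\sup_{\|k\|_{M_{p,q}^{t,r}(\mathbb R^n)}=1}\left|\int_{\mathbb R^n}g(x)k(x)\,dx\right|$$ for $g\in\mathcal H_{p',q'}^{t',r'}(\mathbb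 R^n)$, where the implicit constants are independent of $f$ and $g$.
   Context: Functions are complex-valued and measurable on $\mathbb R^n$; $p'$ denotes the conjugate exponent of $p\in[1,\infty]$. $A\approx B$ means $A\le cB$ and $B\le cA$ for a constant $c>0$. Lorentz norm: with $d_f(s)=|\{x:|f(x)|>s\}|$ and $f^*(u)=\inf\{s>0:d_f(s)\le u\}$, $\|f\|_{L^{p,q}}=\left(\int_0^\infty(u^{1/p}f^*(u))^q\frac{du}{u}\right)^{1/q}$ for $q<\infty$ and $\|f\|_{L^{p,\infty}}=\sup_{u>0}u^{1/p}f^*(u)$. For a cube $Q$, $\|f\|_{L^{p,q}(Q)}=\|f\chi_Q\|_{L^{p,q}}$. Dyadic cubes: $Q_{j,m}=\prod_{i=1}^n[2^{-j}m_i,2^{-j}(m_i+1))$, $j\in\mathbb Z$, $m\in\mathbb Z^n$; $\mathcal D$ is the set of all of them. Bourgain-Morrey-Lorentz space: $M_{p,q}^{t,r}(\mathbb R^n)$ is the set of measurable $f$ with $\|f\|_{M_{p,q}^{t,r}(\mathbb R^n)}=\left(\sum_{Q\in\mathcal D}|Q|^{r/t-r/p}\|f\|_{L^{p,q}(Q)}^r\right)^{1/r}<\infty$ (supremum over $Q\in\mathcal D$ of $|Q|^{1/t-1/p}\|f\|_{L^{p,q}(Q)}$ if $r=\infty$). Block space: a function $b$ is a $(p',q',t')$-block supported on a cube $Q$ if $b$ is supported on $Q$ and $\|b\|_{L^{p',q'}}\le|Q|^{1/p'-1/t'}$. $\mathcal H_{p',q'}^{t',r'}(\mathbb R^n)$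 is the set of measurable $f$ that can be written as $f=\sum_{(j,k)\in\mathbb Z^{1+n}}\lambda_{j,k}b_{j,k}$ (convergence in $L^1_{\mathrm{loc}}$) with $\lambda\in\ell^{r'}(\mathbb Z^{1+n})$ and each $b_{j,k}$ a $(p',q',t')$-block supported on $Q_{j,k}$; $\|f\|_{\mathcal H_{p',q'}^{t',r'}(\mathbb R^n)}=\inf\|\lambda\|_{\ell^{r'}}$ over all such representations. $Y^*$ denotes the space of continuous linear functionals on $Y$ with the operator norm. *)

theory Defs
  imports "HOL-Analysis.Analysis"
begin

text \<open>
  Exponents live in \<open>[1,\<infinity>]\<close> and are elements of \<^typ>\<open>ennreal\<close>. In real arithmetic they occur
  as \<open>enn2real p\<close>; since \<open>enn2real \<infinity> = 0\<close> and \<open>x / 0 = 0\<close>, a quotient \<open>x / enn2real p\<close> has the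
  intended value \<open>0\<close> also for \<open>p = \<infinity>\<close>.
  Functions are not quotiented by equality almost everywhere. All norms below are
  \<^typ>\<open>ennreal\<close>-valued and depend only on the a.e. class of their argument.
\<close>

definition conj_exponent :: "ennreal \<Rightarrow> ennreal" where
  "conj_exponent p = inverse (1 - inverse p)"

text \<open>Only meant for exponents \<open>a > 0\<close>.\<close>
definition ennpowr :: "ennreal \<Rightarrow> real \<Rightarrow> ennreal"  (infixr \<open>ennpowr\<close> 80) where
  "x ennpowr a = (if x = \<infinity> then \<infinity> else ennreal (enn2real x powr a))"

subsection \<open>Lorentz norms\<close>

definition distribution_fun :: "(real^'n \<Rightarrow> complex) \<Rightarrow> real \<Rightarrow> ennreal" where
  "distribution_fun f s = emeasure lebesgue {x. norm (f x) > s}"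

text \<open>The infimum is taken in \<open>[0,\<infinity>]\<close>, so that it is \<open>\<infinity>\<close> for the empty set.\<close>
definition rearrangement :: "(real^'n \<Rightarrow> complex) \<Rightarrow> real \<Rightarrow> ennreal" where
  "rearrangement f u = Inf {ennreal s | s. 0 < s \<and> distribution_fun f s \<le> ennreal u}"

definition lorentz_norm :: "ennreal \<Rightarrow> ennreal \<Rightarrow> (real^'n \<Rightarrow> complex) \<Rightarrow> ennreal" where
  "lorentz_norm p q f =
     (if q = \<infinity> then (SUP u\<in>{0<..}. ennreal (u powr (1 / enn2real p)) * rearrangement f u)
      else (\<integral>\<^sup>+u\<in>{0<..}. (ennreal (u powr (1 / enn2real p)) * rearrangement f u) ennpowr enn2real q
              * ennreal (1 / u) \<partial>lborel) ennpowr (1 / enn2real q))"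

definition lorentz_norm_on ::
    "ennreal \<Rightarrow> ennreal \<Rightarrow> (real^'n) set \<Rightarrow> (real^'n \<Rightarrow> complex) \<Rightarrow> ennreal" where
  "lorentz_norm_on p q Q f = lorentz_norm p q (\<lambda>x. f x * indicator Q x)"

subsection \<open>Bourgain-Morrey-Lorentz spaces\<close>

definition dyadic_cube :: "int \<times> (int^'n) \<Rightarrow> (real^'n) set" where
  "dyadic_cube = (\<lambda>(j, m). {x. \<forall>i. 2 powi (-j) * real_of_int (m $ i) \<le> x $ i \<and>
                                   x $ i < 2 powi (-j) * (real_of_int (m $ i) + 1)})"

definition dyadic_cubes :: "(real^'n) set set" where
  "dyadic_cubes = range dyadic_cube"

definition bml_norm ::
    "ennreal \<Rightarrow> ennreal \<Rightarrow> ennreal \<Rightarrow> ennreal \<Rightarrow> (real^'n \<Rightarrow> complex) \<Rightarrow> ennreal" where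
  "bml_norm p q t r f =
     (if r = \<infinity>
      then (SUP Q\<in>dyadic_cubes.
              ennreal (measure lebesgue Q powr (1 / enn2real t - 1 / enn2real p))
              * lorentz_norm_on p q Q f)
      else (\<Sum>\<^sub>\<infinity>Q\<in>dyadic_cubes.
              ennreal (measure lebesgue Q powr (enn2real r / enn2real t - enn2real r / enn2real p))
              * lorentz_norm_on p q Q f ennpowr enn2real r) ennpowr (1 / enn2real r))"

definition bml_space ::
    "ennreal \<Rightarrow> ennreal \<Rightarrow> ennreal \<Rightarrow> ennreal \<Rightarrow> (real^'n \<Rightarrow> complex) set" where
  "bml_space p q t r = {f \<in> borel_measurable lebesgue. bml_norm p q t r f < \<infinity>}"

subsection \<open>Block spaces\<close>

text \<open>All four exponents in this subsection are literal: the block space that is paired with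
  \<open>bml_space p q t r\<close> is obtained by passing the conjugate exponents.\<close>

definition is_block ::
    "ennreal \<Rightarrow> ennreal \<Rightarrow> ennreal \<Rightarrow> (real^'n) set \<Rightarrow> (real^'n \<Rightarrow> complex) \<Rightarrow> bool" where
  "is_block p q t Q b \<longleftrightarrow>
     b \<in> borel_measurable lebesgue \<and> (\<forall>x. x \<notin> Q \<longrightarrow> b x = 0) \<and>
     lorentz_norm p q b \<le> ennreal (measure lebesgue Q powr (1 / enn2real p - 1 / enn2real t))"

definition lseq_norm :: "ennreal \<Rightarrow> ('i \<Rightarrow> complex) \<Rightarrow> ennreal" where
  "lseq_norm r c =
     (if r = \<infinity> then (SUP i. ennreal (norm (c i)))
      else (\<Sum>\<^sub>\<infinity>i. ennreal (norm (c i) powr enn2real r)) ennpowr (1 / enn2real r))"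

text \<open>Convergence of the net of finite partial sums.\<close>
definition has_sum_L1_loc ::
    "('i \<Rightarrow> real^'n \<Rightarrow> complex) \<Rightarrow> (real^'n \<Rightarrow> complex) \<Rightarrow> bool" where
  "has_sum_L1_loc u f \<longleftrightarrow>
     (\<forall>K. compact K \<longrightarrow>
        ((\<lambda>F. \<integral>\<^sup>+x\<in>K. ennreal (norm (f x - (\<Sum>i\<in>F. u i x))) \<partial>lebesgue) \<longlongrightarrow> 0)
          (finite_subsets_at_top UNIV))"

definition block_representation ::
    "ennreal \<Rightarrow> ennreal \<Rightarrow> ennreal \<Rightarrow> ennreal \<Rightarrow> (real^'n \<Rightarrow> complex) \<Rightarrow>
     (int \<times> (int^'n) \<Rightarrow> complex) \<Rightarrow> (int \<times> (int^'n) \<Rightarrow> real^'n \<Rightarrow> complex) \<Rightarrow> bool" where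
  "block_representation p q t r f c b \<longleftrightarrow>
     lseq_norm r c < \<infinity> \<and>
     (\<forall>i. is_block p q t (dyadic_cube i) (b i)) \<and>
     has_sum_L1_loc (\<lambda>i x. c i * b i x) f"

definition block_space ::
    "ennreal \<Rightarrow> ennreal \<Rightarrow> ennreal \<Rightarrow> ennreal \<Rightarrow> (real^'n \<Rightarrow> complex) set" where
  "block_space p q t r =
     {f \<in> borel_measurable lebesgue. \<exists>c b. block_representation p q t r f c b}"

definition block_norm ::
    "ennreal \<Rightarrow> ennreal \<Rightarrow> ennreal \<Rightarrow> ennreal \<Rightarrow> (real^'n \<Rightarrow> complex) \<Rightarrow> ennreal" where
  "block_norm p q t r f = Inf {lseq_norm r c | c. \<exists>b. block_representation p q t r f c b}"

subsection \<open>Duality\<close>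

definition complex_function_space :: "('a \<Rightarrow> complex) set \<Rightarrow> bool" where
  "complex_function_space Y \<longleftrightarrow>
     (\<lambda>x. 0) \<in> Y \<and> (\<forall>g\<in>Y. \<forall>h\<in>Y. (\<lambda>x. g x + h x) \<in> Y) \<and> (\<forall>a. \<forall>g\<in>Y. (\<lambda>x. a * g x) \<in> Y)"

text \<open>The dual \<open>Y\<^sup>*\<close> of a function space \<open>Y\<close> with (quasi-)norm \<open>N\<close>. Functionals are
  \<^const>\<open>extensional\<close>, so that two of them are equal iff they agree on \<open>Y\<close>.\<close>
definition dual_space ::
    "('a \<Rightarrow> complex) set \<Rightarrow> (('a \<Rightarrow> complex) \<Rightarrow> ennreal) \<Rightarrow> (('a \<Rightarrow> complex) \<Rightarrow> complex) set" where
  "dual_space Y N =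
     {L \<in> extensional Y.
        (\<forall>g\<in>Y. \<forall>h\<in>Y. L (\<lambda>x. g x + h x) = L g + L h) \<and>
        (\<forall>a. \<forall>g\<in>Y. L (\<lambda>x. a * g x) = a * L g) \<and>
        (\<forall>g\<in>Y. \<forall>\<epsilon>>0. \<exists>\<delta>>0. \<forall>h\<in>Y. N (\<lambda>x. h x - g x) < ennreal \<delta> \<longrightarrow> norm (L h - L g) < \<epsilon>)}"

definition dual_norm ::
    "('a \<Rightarrow> complex) set \<Rightarrow> (('a \<Rightarrow> complex) \<Rightarrow> ennreal) \<Rightarrow> (('a \<Rightarrow> complex) \<Rightarrow> complex) \<Rightarrow> ennreal" where
  "dual_norm Y N L = (SUP g\<in>{g \<in> Y. N g \<le> 1}. ennreal (norm (L g)))"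

definition integral_functional ::
    "(real^'n \<Rightarrow> complex) set \<Rightarrow> (real^'n \<Rightarrow> complex) \<Rightarrow> (real^'n \<Rightarrow> complex) \<Rightarrow> complex" where
  "integral_functional Y f = (\<lambda>g\<in>Y. LINT x|lebesgue. f x * g x)"

definition equivalent_on :: "'a set \<Rightarrow> ('a \<Rightarrow> ennreal) \<Rightarrow> ('a \<Rightarrow> ennreal) \<Rightarrow> bool" where
  "equivalent_on S A B \<longleftrightarrow>
     (\<exists>c::real. c > 0 \<and> (\<forall>f\<in>S. A f \<le> ennreal c * B f \<and> B f \<le> ennreal c * A f))"

text \<open>\<open>T\<close> induces, on the a.e. classes of functions in \<open>X\<close>, a linear bijection onto the dual
  of \<open>Y\<close> that is bounded and has a bounded inverse.\<close>
definition isomorphism_onto_dual ::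
    "(real^'n \<Rightarrow> complex) set \<Rightarrow> ((real^'n \<Rightarrow> complex) \<Rightarrow> ennreal) \<Rightarrow>
     (real^'n \<Rightarrow> complex) set \<Rightarrow> ((real^'n \<Rightarrow> complex) \<Rightarrow> ennreal) \<Rightarrow>
     ((real^'n \<Rightarrow> complex) \<Rightarrow> (real^'n \<Rightarrow> complex) \<Rightarrow> complex) \<Rightarrow> bool" where
  "isomorphism_onto_dual X NX Y NY T \<longleftrightarrow>
     complex_function_space X \<and> complex_function_space Y \<and>
     T ` X = dual_space Y NY \<and>
     (\<forall>f\<in>X. \<forall>g\<in>X. T f = T g \<longleftrightarrow> (AE x in lebesgue. f x = g x)) \<and>
     (\<forall>f\<in>X. \<forall>g\<in>X. \<forall>k\<in>Y. T (\<lambda>x. f x + g x) k = T f k + T g k) \<and>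
     (\<forall>a. \<forall>f\<in>X. \<forall>k\<in>Y. T (\<lambda>x. a * f x) k = a * T f k) \<and>
     equivalent_on X NX (\<lambda>f. dual_norm Y NY (T f))"

end

theory Submission
  imports Defs
begin

text \<open>
  Sampling the rearrangement at \<open>u = 2\<^sup>k\<close> turns a Lorentz norm into a weighted \<open>\<ell>\<^sup>q\<close> norm over the
  integers, so that Hoelder's inequality, its converse and the quasi-triangle inequality all
  reduce to sequences; in the converse, the extremal function is built from sets of measure
  about \<open>2\<^sup>k\<close> on which \<open>\<bar>f\<bar> \<ge> f\<^sup>*(2\<^sup>k) / 2\<close>. Combined with the duality of \<open>\<ell>\<^sup>r\<close> and
  \<open>\<ell>\<^sup>r\<^sup>'\<close> over the cubes, this bounds the pairing of the two spaces and shows that the functionals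
  norm the Bourgain-Morrey-Lorentz space.

  A functional on the block space restricts to an additive set function on each unit cube, which is
  absolutely continuous and has a density by Radon--Nikodym; the densities glue to the representing
  function because bounded functions supported in cubes span a dense subspace (\<open>r' < \<infinity>\<close>).

  For the norm of the block space, Lorentz quasi-norms are replaced by the equivalent associate
  norms. The resulting gauge is sublinear, so Hahn--Banach yields a norming functional, which is
  represented by an element of the Bourgain-Morrey-Lorentz space.
\<close>

subsection \<open>Powers of extended nonnegative reals\<close>

text \<open>Two obstacles shape the development. First, \<open>lorentz_norm\<close> is only a
  quasi-norm (triangle constant 32), hence so is the block norm, and Hahn-Banach does not apply to
  it directly. The associate norm is a supremum of integrals of absolute values, so its triangle
  constant is 1; blocks are therefore set up for an arbitrary gauge, and both block norms share one
  theory. Second, when a functional is represented, its density f is not yet known to lie in M, so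
  its integral against a general element of H has no meaning. Every bound on f is extracted from
  bounded test functions supported in one cube (\<open>bump\<close>), and the converse of Hoelder's
  inequality is stated for such test functions b only, with f b nonnegative, so that the pairing is
  the integral of |f b|. Absolute continuity of A -> L(1_A) on a cube is the estimate |L(1_A)| <= C
  |A|^(1/p') with 1/p' > 0. The numerical constants come from a factor 4 for each passage between a
  Lorentz norm and its dyadic form.\<close>

lemma ennpowr_top [simp]: "top ennpowr a = top"
  by (simp add: ennpowr_def)

lemma ennpowr_0 [simp]: "0 ennpowr a = 0"
  by (simp add: ennpowr_def)

lemma ennpowr_ennreal: "0 \<le> x \<Longrightarrow> ennreal x ennpowr a = ennreal (x powr a)"
  by (simp add: ennpowr_def)

lemma ennpowr_one [simp]: "x ennpowr 1 = x"
  by (cases x) (auto simp: ennpowr_def)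

lemma ennpowr_eq_0_iff [simp]: "x ennpowr a = 0 \<longleftrightarrow> x = 0"
  by (cases x) (auto simp: ennpowr_ennreal ennreal_eq_0_iff)

lemma ennpowr_eq_top_iff [simp]: "x ennpowr a = top \<longleftrightarrow> x = top"
  by (cases x) (auto simp: ennpowr_ennreal)

lemma ennpowr_mono: "x \<le> y \<Longrightarrow> 0 \<le> a \<Longrightarrow> x ennpowr a \<le> y ennpowr a"
  by (cases x; cases y) (auto simp: ennpowr_ennreal intro!: ennreal_leI powr_mono2 simp: top_unique)

lemma ennpowr_mult: "(x * y) ennpowr a = x ennpowr a * y ennpowr a"
proof -
  consider "x = 0" | "y = 0" | "x \<noteq> 0" "y \<noteq> 0" "x = top \<or> y = top" | "x \<noteq> top" "y \<noteq> top" by blast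
  then show ?thesis
  proof cases
    case 3
    then show ?thesis by (auto simp: ennreal_mult_top ennreal_top_mult)
  next
    case 4
    then obtain u v where "x = ennreal u" "y = ennreal v" "0 \<le> u" "0 \<le> v"
      by (metis ennreal_cases infinity_ennreal_def)
    then show ?thesis by (simp add: ennpowr_ennreal powr_mult flip: ennreal_mult)
  qed auto
qed

lemma ennpowr_ennpowr: "(x ennpowr a) ennpowr b = x ennpowr (a * b)"
  by (cases x) (auto simp: ennpowr_ennreal powr_powr)

lemma ennpowr_inverse [simp]: "a \<noteq> 0 \<Longrightarrow> (x ennpowr a) ennpowr (1 / a) = x"
  "a \<noteq> 0 \<Longrightarrow> (x ennpowr (1 / a)) ennpowr a = x"
  by (simp_all add: ennpowr_ennpowr)

lemma ennpowr_le_iff: "0 < a \<Longrightarrow> x ennpowr a \<le> y \<longleftrightarrow> x \<le> y ennpowr (1 / a)"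
  using ennpowr_mono[of "x ennpowr a" y "1 / a"] ennpowr_mono[of x "y ennpowr (1 / a)" a]
  by (auto simp del: ennpowr_eq_top_iff)

lemma borel_measurable_ennpowr [measurable]:
  assumes [measurable]: "f \<in> borel_measurable M"
  shows "(\<lambda>x. f x ennpowr a) \<in> borel_measurable M"
  unfolding ennpowr_def by measurable

lemma ennpowr_less_top [simp]: "x ennpowr a < top \<longleftrightarrow> x < top"
  by (simp add: less_top[symmetric])

subsection \<open>Sequence norms\<close>

text \<open>Written as integrals over \<open>count_space\<close>, sums over cubes and over scales
  become accessible to Tonelli and to monotone and dominated convergence.\<close>

lemma infsum_eq_nn_integral_count_space:
  fixes f :: "'i::countable \<Rightarrow> ennreal"
  shows "infsum f UNIV = (\<integral>\<^sup>+i. f i \<partial>count_space UNIV)"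
proof -
  have inf: "infsum f UNIV = (SUP F\<in>{F. finite F \<and> F \<subseteq> UNIV}. sum f F)"
    by (rule nonneg_infsum_complete) simp
  have sum: "(\<integral>\<^sup>+i. f i * indicator F i \<partial>count_space UNIV) = sum f F" if "finite F" for F
  proof -
    have "(\<integral>\<^sup>+i. f i * indicator F i \<partial>count_space UNIV) = (\<Sum>i\<in>F. f i * indicator F i)"
      by (rule nn_integral_count_space') (use that in auto)
    then show ?thesis by simp
  qed
  \<comment> \<open>Finite sets that exhaust the countable index type along a sequence, as monotone
    convergence requires.\<close>
  define F where "F n = {i::'i. to_nat i < n}" for n
  have fin: "finite (F n)" for n
    unfolding F_def using finite_vimageI[of "{..<n}" to_nat] by (simp add: vimage_def lessThan_def)
  have "(SUP n. f i * indicator (F n) i) = f i" for i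
  proof (rule antisym)
    have "f i = f i * indicator (F (Suc (to_nat i))) i" by (simp add: F_def)
    also have "\<dots> \<le> (SUP n. f i * indicator (F n) i)" by (rule SUP_upper) simp
    finally show "f i \<le> (SUP n. f i * indicator (F n) i)" .
  qed (auto intro!: SUP_least split: split_indicator)
  then have "(\<integral>\<^sup>+i. f i \<partial>count_space UNIV) = (\<integral>\<^sup>+i. (SUP n. f i * indicator (F n) i) \<partial>count_space UNIV)"
    by simp
  also have "\<dots> = (SUP n. \<integral>\<^sup>+i. f i * indicator (F n) i \<partial>count_space UNIV)"
    by (rule nn_integral_monotone_convergence_SUP)
       (auto simp: incseq_def le_fun_def F_def split: split_indicator)
  also have "\<dots> = (SUP n. sum f (F n))" using sum[OF fin] by simp
  also have "\<dots> \<le> infsum f UNIV" unfolding inf by (rule SUP_mono) (use fin in auto)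
  finally have "(\<integral>\<^sup>+i. f i \<partial>count_space UNIV) \<le> infsum f UNIV" .
  moreover have "infsum f UNIV \<le> (\<integral>\<^sup>+i. f i \<partial>count_space UNIV)"
    unfolding inf
  proof (rule SUP_least, clarsimp)
    fix F :: "'i set" assume "finite F"
    then show "sum f F \<le> (\<integral>\<^sup>+i. f i \<partial>count_space UNIV)"
      unfolding sum[OF \<open>finite F\<close>, symmetric] by (intro nn_integral_mono) (auto split: split_indicator)
  qed
  ultimately show ?thesis by simp
qed

text \<open>Entries are extended reals because rearrangements and local norms may be infinite before
  any bound is known; \<open>lseq_norm\<close> accepts complex coefficients only.\<close>

definition seq_norm :: "ennreal \<Rightarrow> ('i \<Rightarrow> ennreal) \<Rightarrow> ennreal" where
  "seq_norm r x = (if r = \<infinity> then (SUP i. x i)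
     else (\<integral>\<^sup>+i. x i ennpowr enn2real r \<partial>count_space UNIV) ennpowr (1 / enn2real r))"

lemma seq_norm_one: "seq_norm 1 x = (\<integral>\<^sup>+i. x i \<partial>count_space UNIV)"
  by (simp add: seq_norm_def)

lemma seq_norm_powr:
  "0 < r \<Longrightarrow> r < top \<Longrightarrow>
    seq_norm r x ennpowr enn2real r = (\<integral>\<^sup>+i. x i ennpowr enn2real r \<partial>count_space UNIV)"
  by (cases r) (auto simp: seq_norm_def)

lemma lseq_norm_eq: "lseq_norm r (c :: 'i::countable \<Rightarrow> complex) = seq_norm r (\<lambda>i. ennreal (norm (c i)))"
  by (simp add: lseq_norm_def seq_norm_def infsum_eq_nn_integral_count_space ennpowr_ennreal)

lemma seq_norm_mono: "(\<And>i. x i \<le> y i) \<Longrightarrow> seq_norm r x \<le> seq_norm r y"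
  unfolding seq_norm_def
  by (auto intro!: SUP_mono' ennpowr_mono nn_integral_mono)

lemma seq_norm_cmult:
  assumes "r > 0" shows "seq_norm r (\<lambda>i. a * x i) = a * seq_norm r x"
proof (cases "r = \<infinity>")
  case True
  then show ?thesis by (simp add: seq_norm_def SUP_mult_left_ennreal)
next
  case False
  then have "enn2real r > 0" using assms by (simp add: enn2real_positive_iff less_top)
  then show ?thesis using False
    by (simp add: seq_norm_def ennpowr_mult nn_integral_cmult)
qed

lemma le_seq_norm:
  assumes "r > 0" shows "x i \<le> seq_norm r x"
proof (cases "r = \<infinity>")
  case True
  then show ?thesis by (auto simp: seq_norm_def intro: SUP_upper)
next
  case False
  then have r: "enn2real r > 0" using assms by (simp add: enn2real_positive_iff less_top)
  have "x i ennpowr enn2real r = (\<integral>\<^sup>+j. x j ennpowr enn2real r * indicator {i} j \<partial>count_space UNIV)"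
    by (subst nn_integral_count_space'[of "{i}"]) auto
  also have "\<dots> \<le> (\<integral>\<^sup>+j. x j ennpowr enn2real r \<partial>count_space UNIV)"
    by (intro nn_integral_mono) (auto split: split_indicator)
  finally show ?thesis using r False by (simp add: seq_norm_def ennpowr_le_iff)
qed

lemma seq_norm_zero [simp]: "seq_norm r (\<lambda>i. 0) = 0"
  by (simp add: seq_norm_def)

lemma seq_norm_bij: "bij g \<Longrightarrow> seq_norm r (\<lambda>i. x (g i)) = seq_norm r x"
proof -
  assume g: "bij g"
  have "(SUP i. x (g i)) = (SUP i\<in>g ` UNIV. x i)" by (simp add: image_image)
  then show ?thesis
    unfolding seq_norm_def
    using nn_integral_bij_count_space[OF g, of "\<lambda>i. x i ennpowr enn2real r"]
    by (simp add: bij_is_surj[OF g])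
qed

lemma seq_norm_single:
  assumes "r > 0" shows "seq_norm r (\<lambda>i. if i = j then a else 0) = a"
proof (rule antisym)
  show "a \<le> seq_norm r (\<lambda>i. if i = j then a else 0)"
    using le_seq_norm[OF assms, of "\<lambda>i. if i = j then a else 0" j] by simp
  show "seq_norm r (\<lambda>i. if i = j then a else 0) \<le> a"
  proof (cases "r = \<infinity>")
    case True
    then show ?thesis by (auto simp: seq_norm_def intro!: SUP_least)
  next
    case False
    then have r: "enn2real r > 0" using assms by (simp add: enn2real_positive_iff less_top)
    have "(\<integral>\<^sup>+i. (if i = j then a else 0) ennpowr enn2real r \<partial>count_space UNIV) = a ennpowr enn2real r"
      by (subst nn_integral_count_space'[of "{j}"]) auto
    then show ?thesis using r False by (simp add: seq_norm_def)
  qed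
qed

text \<open>A symmetric, relational form of \<open>conj_exponent\<close>. The endpoint pairs are
  listed explicitly because the sequence inequalities treat them by separate arguments.\<close>

definition conj_pair :: "ennreal \<Rightarrow> ennreal \<Rightarrow> bool" where
  "conj_pair a b \<longleftrightarrow> a = 1 \<and> b = top \<or> a = top \<and> b = 1 \<or>
     1 < a \<and> a < top \<and> 1 < b \<and> b < top \<and> 1 / enn2real a + 1 / enn2real b = 1"

lemma conj_pair_sym: "conj_pair a b \<Longrightarrow> conj_pair b a"
  by (auto simp: conj_pair_def)

lemma conj_pair_pos: "conj_pair a b \<Longrightarrow> 0 < a"
  by (auto simp: conj_pair_def intro: less_trans[of 0 1])

lemma enn2real_gt_one: "1 < a \<Longrightarrow> a < top \<Longrightarrow> 1 < enn2real a"
  by (cases a) auto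

lemma conj_pair_conj_exponent:
  assumes "1 < a" shows "conj_pair a (conj_exponent a)"
proof (cases a)
  case top
  then show ?thesis by (simp add: conj_pair_def conj_exponent_def)
next
  case (real x)
  then have x: "1 < x" using assms by simp
  then have "conj_exponent a = ennreal (x / (x - 1))"
    proof -
    have "1 - inverse a = ennreal (1 - 1 / x)"
      using real x ennreal_minus[of "1 / x" 1] by (simp add: inverse_ennreal divide_inverse)
    then have "conj_exponent a = ennreal (inverse (1 - 1 / x))"
      using x by (simp add: conj_exponent_def inverse_ennreal)
    also have "inverse (1 - 1 / x) = x / (x - 1)" using x by (simp add: field_simps)
    finally show ?thesis .
  qed
  moreover have "1 < x / (x - 1)" using x by simp
  moreover have "1 / x + 1 / (x / (x - 1)) = 1" using x by (simp add: field_simps)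
  ultimately show ?thesis using real x by (simp add: conj_pair_def)
qed

text \<open>Young's inequality for x i / S and y i / T, summed over i, where S and T are the two
  norms; the degenerate values of S and T are split off first.\<close>

lemma seq_norm_Holder:
  assumes "conj_pair a b"
  shows "(\<integral>\<^sup>+i. x i * y i \<partial>count_space UNIV) \<le> seq_norm a x * seq_norm b y"
proof -
  have top: "(\<integral>\<^sup>+i. x i * y i \<partial>count_space UNIV) \<le> seq_norm 1 x * seq_norm top y" for x y :: "'a \<Rightarrow> ennreal"
  proof -
    have "(\<integral>\<^sup>+i. x i * y i \<partial>count_space UNIV) \<le> (\<integral>\<^sup>+i. x i * seq_norm top y \<partial>count_space UNIV)"
      by (intro nn_integral_mono mult_left_mono le_seq_norm) auto
    then show ?thesis by (simp add: nn_integral_multc seq_norm_one)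
  qed
  consider "a = 1" "b = top" | "a = top" "b = 1"
    | "1 < a" "a < top" "1 < b" "b < top" "1 / enn2real a + 1 / enn2real b = 1"
    using assms by (auto simp: conj_pair_def)
  then show ?thesis
  proof cases
    case 1
    then show ?thesis using top by simp
  next
    case 2
    then show ?thesis using top[of y x] by (simp add: mult.commute)
  next
    case 3
    define A B where "A = enn2real a" and "B = enn2real b"
    have AB: "1 < A" "1 < B" "1 / A + 1 / B = 1"
      using 3 enn2real_gt_one unfolding A_def B_def by auto
    have ab0: "0 < a" "0 < b" using conj_pair_pos assms conj_pair_sym by blast+
    define S T where "S = seq_norm a x" and "T = seq_norm b y"
    have S: "S ennpowr A = (\<integral>\<^sup>+i. x i ennpowr A \<partial>count_space UNIV)"
      and T: "T ennpowr B = (\<integral>\<^sup>+i. y i ennpowr B \<partial>count_space UNIV)"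
      using 3 unfolding S_def T_def A_def B_def by (intro seq_norm_powr ab0; simp)+
    have xS: "x i \<le> S" and yT: "y i \<le> T" for i
      unfolding S_def T_def by (intro le_seq_norm ab0)+
    consider "S = 0 \<or> T = 0" | "S \<noteq> 0" "T \<noteq> 0" "S = top \<or> T = top" | "S \<noteq> 0" "T \<noteq> 0" "S \<noteq> top" "T \<noteq> top"
      by blast
    then have "(\<integral>\<^sup>+i. x i * y i \<partial>count_space UNIV) \<le> S * T"
    proof cases
      case 1
      \<comment> \<open>If one norm is 0, that sequence vanishes identically, so the bound survives
        even when the other norm is infinite.\<close>
      have "(\<lambda>i. x i * y i) = (\<lambda>i. 0)" using 1 xS yT by fastforce
      then show ?thesis by simp
    next
      case 2
      then show ?thesis by (auto simp: ennreal_mult_top ennreal_top_mult)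
    next
      case 3
      obtain s t where st: "S = ennreal s" "T = ennreal t" "0 < s" "0 < t"
        using 3 by (metis ennreal_cases infinity_ennreal_def ennreal_0 less_eq_real_def)
      \<comment> \<open>The factor s t is moved to the right-hand side, so that after summation each
        of the two sums is normalised to 1.\<close>
      have young: "x i * y i \<le> ennreal (s * t / A) * (ennreal (s powr (-A)) * x i ennpowr A)
           + ennreal (s * t / B) * (ennreal (t powr (-B)) * y i ennpowr B)" for i
      proof -
        obtain u v where uv: "x i = ennreal u" "y i = ennreal v" "0 \<le> u" "0 \<le> v"
          using xS[of i] yT[of i] st
          by (metis ennreal_cases infinity_ennreal_def top_unique ennreal_neq_top)
        have "(u / s) * (v / t) \<le> (u / s) powr A / A + (v / t) powr B / B"
          using AB st uv by (intro Youngs_inequality) auto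
        also have "\<dots> = s powr (-A) * u powr A / A + t powr (-B) * v powr B / B"
          using st uv by (simp add: powr_divide powr_minus field_simps)
        finally have "u * v \<le> s * t * (s powr (-A) * u powr A / A + t powr (-B) * v powr B / B)"
          using st by (simp add: field_simps)
        also have "\<dots> = s * t / A * (s powr (-A) * u powr A) + s * t / B * (t powr (-B) * v powr B)"
          by (simp add: field_simps)
        finally show ?thesis using uv AB st
          by (simp add: ennpowr_ennreal flip: ennreal_mult ennreal_plus)
      qed
      have one: "ennreal (s powr (-A)) * S ennpowr A = 1" "ennreal (t powr (-B)) * T ennpowr B = 1"
        using st by (simp_all add: ennpowr_ennreal flip: ennreal_mult powr_add)
      have "(\<integral>\<^sup>+i. x i * y i \<partial>count_space UNIV) \<le>
        (\<integral>\<^sup>+i. ennreal (s * t / A) * (ennreal (s powr (-A)) * x i ennpowr A)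
           + ennreal (s * t / B) * (ennreal (t powr (-B)) * y i ennpowr B) \<partial>count_space UNIV)"
        by (intro nn_integral_mono young)
      also have "\<dots> = ennreal (s * t / A) * (ennreal (s powr (-A)) * S ennpowr A)
           + ennreal (s * t / B) * (ennreal (t powr (-B)) * T ennpowr B)"
        by (simp add: nn_integral_add nn_integral_cmult S T)
      also have "\<dots> = ennreal (s * t / A + s * t / B)"
        unfolding one using st AB by simp
      also have "s * t / A + s * t / B = s * t * (1 / A + 1 / B)" by (simp add: field_simps)
      also have "ennreal \<dots> = S * T" using st AB by (simp add: ennreal_mult)
      finally show ?thesis .
    qed
    then show ?thesis by (simp add: S_def T_def)
  qed
qed

lemma seq_norm_finite_support:
  fixes y :: "'i \<Rightarrow> real"
  assumes "0 < r" "r < top" "finite I" "\<And>i. i \<notin> I \<Longrightarrow> y i = 0" "\<And>i. 0 \<le> y i"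
  shows "seq_norm r (\<lambda>i. ennreal (y i)) = ennreal ((\<Sum>i\<in>I. y i powr enn2real r) powr (1 / enn2real r))"
proof -
  have "(\<integral>\<^sup>+i. ennreal (y i) ennpowr enn2real r \<partial>count_space UNIV)
      = (\<Sum>i\<in>I. ennreal (y i) ennpowr enn2real r)"
    by (rule nn_integral_count_space') (use assms in auto)
  also have "\<dots> = ennreal (\<Sum>i\<in>I. y i powr enn2real r)"
    using assms by (simp add: ennpowr_ennreal)
  finally show ?thesis using assms by (simp add: seq_norm_def ennpowr_ennreal sum_nonneg)
qed

lemma nn_integral_count_space_SUP_finite:
  fixes f :: "'i::countable \<Rightarrow> ennreal"
  assumes "\<And>F. finite F \<Longrightarrow> sum f F \<le> K"
  shows "(\<integral>\<^sup>+i. f i \<partial>count_space UNIV) \<le> K"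
  unfolding infsum_eq_nn_integral_count_space[symmetric]
  by (subst nonneg_infsum_complete) (use assms in \<open>auto intro!: SUP_least\<close>)

text \<open>The sequence equal to x^(A-1) on a finite set F is the equality case of Hoelder's
  inequality. Testing with finitely supported real y keeps the hypothesis checkable by finite sums,
  and finiteness of K makes every entry of x finite.\<close>

lemma seq_norm_converse_Holder:
  fixes x :: "'i::countable \<Rightarrow> ennreal"
  assumes ab: "conj_pair a b" and K: "K < top"
    and le: "\<And>y I. finite I \<Longrightarrow> (\<And>i. 0 \<le> y i) \<Longrightarrow> (\<And>i. i \<notin> I \<Longrightarrow> y i = 0) \<Longrightarrow>
       (\<Sum>i\<in>I. ennreal (y i) * x i) \<le> K * seq_norm b (\<lambda>i. ennreal (y i))"
  shows "seq_norm a x \<le> K"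
proof -
  have b: "0 < b" using conj_pair_pos[OF conj_pair_sym[OF ab]] .
  have xK: "x i \<le> K" for i
  proof -
    have "(\<lambda>j. ennreal (if j = i then 1 else 0)) = (\<lambda>j. if j = i then 1 else 0)" by auto
    then show ?thesis using le[of "{i}" "\<lambda>j. if j = i then 1 else 0"] seq_norm_single[OF b, of i 1] by simp
  qed
  consider "a = 1" "b = top" | "a = top" "b = 1"
    | "1 < a" "a < top" "1 < b" "b < top" "1 / enn2real a + 1 / enn2real b = 1"
    using ab by (auto simp: conj_pair_def)
  then show ?thesis
  proof cases
    case 1
    show ?thesis unfolding 1 seq_norm_one
    proof (rule nn_integral_count_space_SUP_finite)
      fix F :: "'i set" assume "finite F"
      then have "sum x F \<le> K * seq_norm b (\<lambda>i. ennreal (indicator F i))"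
        using le[of F "indicator F"] by simp
      also have "\<dots> \<le> K * 1"
        unfolding 1 seq_norm_def by (intro mult_left_mono) (auto intro!: SUP_least split: split_indicator)
      finally show "sum x F \<le> K" by simp
    qed
  next
    case 2
    then show ?thesis using xK by (auto simp: seq_norm_def intro!: SUP_least)
  next
    case 3
    define A B where "A = enn2real a" and "B = enn2real b"
    have AB: "1 < A" "1 < B" "1 / A + 1 / B = 1"
      using 3 enn2real_gt_one unfolding A_def B_def by auto
    then have B: "B = A / (A - 1)" by (simp add: field_simps)
    have "(\<integral>\<^sup>+i. x i ennpowr A \<partial>count_space UNIV) \<le> K ennpowr A"
    proof (rule nn_integral_count_space_SUP_finite)
      fix F :: "'i set" assume F: "finite F"
      define u where "u i = enn2real (x i)" for i
      have u: "x i = ennreal (u i)" "0 \<le> u i" for i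
        using xK[of i] K unfolding u_def by (auto simp: ennreal_enn2real_if top_unique)
      \<comment> \<open>Here y i x i = (u i)^A and (y i)^B = (u i)^A, because B = A / (A - 1); both
        sums equal S.\<close>
      define y where "y i = (if i \<in> F then u i powr (A - 1) else 0)" for i
      obtain k where k: "K = ennreal k" "0 \<le> k" using K by (cases K) auto
      define S where "S = (\<Sum>i\<in>F. u i powr A)"
      have S0: "0 \<le> S" unfolding S_def by (intro sum_nonneg) auto
      have "(\<Sum>i\<in>F. ennreal (y i) * x i) = (\<Sum>i\<in>F. ennreal (u i powr A))"
      proof (intro sum.cong refl)
        fix i assume i: "i \<in> F"
        have "u i powr (A - 1) * u i = u i powr A"
          using u(2)[of i] by (cases "u i = 0") (simp_all add: powr_diff)
        then show "ennreal (y i) * x i = ennreal (u i powr A)"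
          using i u by (simp add: y_def flip: ennreal_mult)
      qed
      also have "\<dots> = ennreal S" unfolding S_def by simp
      finally have 1: "(\<Sum>i\<in>F. ennreal (y i) * x i) = ennreal S" .
      have "(\<Sum>i\<in>F. y i powr B) = S"
        unfolding S_def using AB by (intro sum.cong) (simp_all add: y_def powr_powr B)
      then have "seq_norm b (\<lambda>i. ennreal (y i)) = ennreal (S powr (1 / B))"
        using 3 F AB by (subst seq_norm_finite_support[of _ F]) (auto simp: y_def B_def intro: less_trans[of 0 1])
      moreover have "(\<Sum>i\<in>F. ennreal (y i) * x i) \<le> K * seq_norm b (\<lambda>i. ennreal (y i))"
        by (rule le) (use F in \<open>auto simp: y_def\<close>)
      ultimately have "ennreal S \<le> ennreal (k * S powr (1 / B))" using 1 k by (simp add: ennreal_mult)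
      then have "S \<le> k * S powr (1 / B)" using k S0 by simp
      have "S \<le> k powr A"
      \<comment> \<open>Dividing S <= k S^(1/B) by S^(1/B) leaves S^(1/A) <= k; finiteness of S,
        which is a finite sum, makes the division legitimate.\<close>
      proof (cases "S = 0")
        case False
        then have "S > 0" using S0 by simp
        have "S powr (1 / A) * S powr (1 / B) = S" using AB \<open>S > 0\<close> by (simp flip: powr_add)
        then have "S powr (1 / A) * S powr (1 / B) \<le> k * S powr (1 / B)" using \<open>S \<le> k * S powr (1 / B)\<close> by simp
        then have "S powr (1 / A) \<le> k" using \<open>S > 0\<close> by simp
        then have "(S powr (1 / A)) powr A \<le> k powr A" using AB by (intro powr_mono2) auto
        then show ?thesis using AB \<open>S > 0\<close> by (simp add: powr_powr)
      qed simp
      moreover have "(\<Sum>i\<in>F. x i ennpowr A) = ennreal S" unfolding S_def by (simp add: u ennpowr_ennreal)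
      ultimately show "(\<Sum>i\<in>F. x i ennpowr A) \<le> K ennpowr A" using k by (simp add: ennpowr_ennreal ennreal_leI)
    qed
    then have "(\<integral>\<^sup>+i. x i ennpowr A \<partial>count_space UNIV) ennpowr (1 / A) \<le> K"
      using AB by (simp add: ennpowr_le_iff)
    then show ?thesis using 3 by (simp add: seq_norm_def A_def less_top[symmetric])
  qed
qed

lemma nn_integral_count_space_finite_support:
  assumes "finite I" "\<And>i. i \<notin> I \<Longrightarrow> f i = 0"
  shows "(\<integral>\<^sup>+i. f i \<partial>count_space UNIV) = sum f I"
  by (rule nn_integral_count_space') (use assms in auto)

text \<open>Minkowski's inequality by duality: a pairing with a test sequence is additive, and each
  summand is bounded by Hoelder's inequality.\<close>

lemma seq_norm_triangle:
  fixes x y :: "'i::countable \<Rightarrow> ennreal"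
  assumes ab: "conj_pair a b"
  shows "seq_norm a (\<lambda>i. x i + y i) \<le> seq_norm a x + seq_norm a y"
proof (cases "seq_norm a x + seq_norm a y < top")
  case True
  show ?thesis
  proof (rule seq_norm_converse_Holder[OF ab True])
    fix z :: "'i \<Rightarrow> real" and I :: "'i set"
    assume I: "finite I" and z: "\<And>i. i \<notin> I \<Longrightarrow> z i = 0"
    have "(\<Sum>i\<in>I. ennreal (z i) * (x i + y i))
        = (\<integral>\<^sup>+i. x i * ennreal (z i) \<partial>count_space UNIV) + (\<integral>\<^sup>+i. y i * ennreal (z i) \<partial>count_space UNIV)"
      using I z by (subst (1 2) nn_integral_count_space_finite_support[of I])
        (auto simp: sum.distrib algebra_simps)
    also have "\<dots> \<le> seq_norm a x * seq_norm b (\<lambda>i. ennreal (z i)) + seq_norm a y * seq_norm b (\<lambda>i. ennreal (z i))"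
      by (intro add_mono seq_norm_Holder ab)
    finally show "(\<Sum>i\<in>I. ennreal (z i) * (x i + y i)) \<le>
        (seq_norm a x + seq_norm a y) * seq_norm b (\<lambda>i. ennreal (z i))"
      by (simp add: algebra_simps)
  qed
qed (auto simp: less_top[symmetric])

subsection \<open>Decreasing rearrangements\<close>

context
  fixes f :: "real^'n \<Rightarrow> complex"
  assumes f [measurable]: "f \<in> borel_measurable lebesgue"
begin

lemma sets_superlevel: "{x. s < norm (f x)} \<in> sets lebesgue"
proof -
  have "{x \<in> space lebesgue. s < norm (f x)} \<in> sets lebesgue" by measurable
  then show ?thesis by simp
qed

lemma distribution_fun_antimono: "s \<le> t \<Longrightarrow> distribution_fun f t \<le> distribution_fun f s"
  unfolding distribution_fun_def by (intro emeasure_mono sets_superlevel) auto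

lemma rearrangement_le:
  assumes "0 \<le> s" "distribution_fun f s \<le> ennreal u"
  shows "rearrangement f u \<le> ennreal s"
proof (rule ennreal_le_epsilon)
  \<comment> \<open>The infimum in \<open>rearrangement\<close> runs over strictly positive heights,
    so s = 0 has to be approached through s + e.\<close>
  fix e :: real assume e: "0 < e"
  have "distribution_fun f (s + e) \<le> ennreal u"
    using distribution_fun_antimono[of s "s + e"] e assms by (intro order.trans[OF _ assms(2)]) auto
  then have "rearrangement f u \<le> ennreal (s + e)"
    unfolding rearrangement_def using assms e
    by (intro Inf_lower CollectI exI[of _ "s + e"] conjI refl) auto
  then show "rearrangement f u \<le> ennreal s + ennreal e" using assms e by simp
qed

text \<open>Right continuity of the distribution function: the sets where |f| > s + 1/(n+1) increase
  to the set where |f| > s.\<close>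

lemma distribution_fun_le:
  assumes "rearrangement f u \<le> ennreal s" "0 \<le> s"
  shows "distribution_fun f s \<le> ennreal u"
proof -
  have step: "distribution_fun f (s + inverse (real (Suc n))) \<le> ennreal u" for n
  proof -
    have "rearrangement f u < ennreal (s + inverse (real (Suc n)))"
      using assms by (intro le_less_trans[OF assms(1)] ennreal_lessI add_nonneg_pos) auto
    then obtain v where "0 < v" "distribution_fun f v \<le> ennreal u" "ennreal v < ennreal (s + inverse (real (Suc n)))"
      unfolding rearrangement_def Inf_less_iff by auto
    then show ?thesis
      using distribution_fun_antimono[of v "s + inverse (real (Suc n))"] by (auto simp: ennreal_less_iff)
  qed
  have "{x. s < norm (f x)} = (\<Union>n. {x. s + inverse (real (Suc n)) < norm (f x)})"
  proof (intro equalityI subsetI)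
    fix x assume "x \<in> {x. s < norm (f x)}"
    then obtain n where "inverse (real (Suc n)) < norm (f x) - s"
      using reals_Archimedean[of "norm (f x) - s"] by auto
    then show "x \<in> (\<Union>n. {x. s + inverse (real (Suc n)) < norm (f x)})" by (auto simp: algebra_simps)
  next
    fix x assume "x \<in> (\<Union>n. {x. s + inverse (real (Suc n)) < norm (f x)})"
    then obtain n where n: "s + inverse (real (Suc n)) < norm (f x)" by auto
    have "0 < inverse (real (Suc n))" by simp
    then have "s < norm (f x)" using n by linarith
    then show "x \<in> {x. s < norm (f x)}" by simp
  qed
  moreover have "(SUP n. emeasure lebesgue {x. s + inverse (real (Suc n)) < norm (f x)})
      = emeasure lebesgue (\<Union>n. {x. s + inverse (real (Suc n)) < norm (f x)})"
  proof (rule SUP_emeasure_incseq)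
    show "incseq (\<lambda>n. {x. s + inverse (real (Suc n)) < norm (f x)})"
    proof (rule incseq_SucI, clarify)
      fix n x assume *: "s + inverse (real (Suc n)) < norm (f x)"
      have "inverse (real (Suc (Suc n))) \<le> inverse (real (Suc n))" by (simp add: divide_simps)
      then show "s + inverse (real (Suc (Suc n))) < norm (f x)" using * by linarith
    qed
  qed (use sets_superlevel in blast)
  ultimately have "distribution_fun f s = (SUP n. distribution_fun f (s + inverse (real (Suc n))))"
    unfolding distribution_fun_def by simp
  also have "\<dots> \<le> ennreal u" by (intro SUP_least step)
  finally show ?thesis .
qed

lemma rearrangement_le_iff: "0 \<le> s \<Longrightarrow> rearrangement f u \<le> ennreal s \<longleftrightarrow> distribution_fun f s \<le> ennreal u"
  using rearrangement_le distribution_fun_le by blast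

end

lemma rearrangement_antimono: "u \<le> v \<Longrightarrow> rearrangement f v \<le> rearrangement f u"
  unfolding rearrangement_def by (intro Inf_superset_mono) (blast intro: order.trans ennreal_leI)

lemma rearrangement_mono:
  assumes "g \<in> borel_measurable lebesgue" "\<And>x. norm (f x) \<le> norm (g x)"
  shows "rearrangement f u \<le> rearrangement g u"
proof -
  have "distribution_fun f s \<le> distribution_fun g s" for s
    unfolding distribution_fun_def
    by (intro emeasure_mono sets_superlevel assms(1)) (use assms(2) in \<open>auto intro: less_le_trans\<close>)
  then show ?thesis
    unfolding rearrangement_def by (intro Inf_superset_mono) (auto intro: order.trans)
qed

text \<open>One inequality suffices for nonzero a: the reverse one is the same inequality for the
  factor \<open>inverse a\<close> and the function a f.\<close>

lemma rearrangement_cmult: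
  fixes f :: "real^'n \<Rightarrow> complex"
  assumes f [measurable]: "f \<in> borel_measurable lebesgue" and u: "0 \<le> u"
  shows "rearrangement (\<lambda>x. a * f x) u = ennreal (norm a) * rearrangement f u"
proof -
  have zero: "rearrangement (\<lambda>x::real^'n. 0) u = 0" if "0 \<le> u" for u
    using rearrangement_le[of "\<lambda>x::real^'n. 0" 0 u] that by (simp add: distribution_fun_def)
  have le: "rearrangement (\<lambda>x. a * f x) u \<le> ennreal (norm a) * rearrangement f u"
    if f [measurable]: "f \<in> borel_measurable lebesgue" and "a \<noteq> 0"
    for a and f :: "real^'n \<Rightarrow> complex"
  proof (cases "rearrangement f u")
    case (real s)
    have "distribution_fun (\<lambda>x. a * f x) (norm a * s) = distribution_fun f s"
      using \<open>a \<noteq> 0\<close> by (simp add: distribution_fun_def norm_mult)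
    also have "\<dots> \<le> ennreal u" using distribution_fun_le[of f u s] real f by simp
    finally have "rearrangement (\<lambda>x. a * f x) u \<le> ennreal (norm a * s)"
      using real by (intro rearrangement_le) auto
    then show ?thesis using real by (simp add: ennreal_mult)
  qed (use that in \<open>simp add: ennreal_mult_top\<close>)
  show ?thesis
  proof (cases "a = 0")
    case True
    then show ?thesis using zero[OF u] by simp
  next
    case False
    have "rearrangement f u \<le> ennreal (norm (inverse a)) * rearrangement (\<lambda>x. a * f x) u"
      using le[of "\<lambda>x. a * f x" "inverse a"] False by (simp flip: mult.assoc)
    then have "ennreal (norm a) * rearrangement f u
        \<le> ennreal (norm a) * (ennreal (norm (inverse a)) * rearrangement (\<lambda>x. a * f x) u)"
      by (rule mult_left_mono) simp
    also have "\<dots> = rearrangement (\<lambda>x. a * f x) u"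
      using False by (simp add: norm_inverse flip: mult.assoc ennreal_mult)
    finally show ?thesis using le[OF f False] by simp
  qed
qed

text \<open>Where |f + g| > s + t, either |f| > s or |g| > t; the measures of the two superlevel
  sets add up to at most u + v.\<close>

lemma rearrangement_add_le:
  fixes f g :: "real^'n \<Rightarrow> complex"
  assumes [measurable]: "f \<in> borel_measurable lebesgue" "g \<in> borel_measurable lebesgue"
    and "0 \<le> u" "0 \<le> v"
  shows "rearrangement (\<lambda>x. f x + g x) (u + v) \<le> rearrangement f u + rearrangement g v"
proof (cases "rearrangement f u = top \<or> rearrangement g v = top")
  case False
  then obtain s t where st: "rearrangement f u = ennreal s" "rearrangement g v = ennreal t" "0 \<le> s" "0 \<le> t"
    by (metis ennreal_cases infinity_ennreal_def)
  have "distribution_fun (\<lambda>x. f x + g x) (s + t)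
      \<le> emeasure lebesgue ({x. s < norm (f x)} \<union> {x. t < norm (g x)})"
    unfolding distribution_fun_def
  proof (rule emeasure_mono)
    show "{x. s + t < norm (f x + g x)} \<subseteq> {x. s < norm (f x)} \<union> {x. t < norm (g x)}"
    proof (clarsimp simp: not_less)
      fix x assume "s + t < norm (f x + g x)" "norm (g x) \<le> t"
      then show "s < norm (f x)" using norm_triangle_ineq[of "f x" "g x"] by linarith
    qed
  qed (intro sets.Un sets_superlevel; measurable)
  also have "\<dots> \<le> distribution_fun f s + distribution_fun g t"
    unfolding distribution_fun_def by (intro emeasure_subadditive sets_superlevel) measurable
  also have "\<dots> \<le> ennreal u + ennreal v"
    using st by (intro add_mono distribution_fun_le) auto
  finally have "distribution_fun (\<lambda>x. f x + g x) (s + t) \<le> ennreal (u + v)"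
    using assms by simp
  then have "rearrangement (\<lambda>x. f x + g x) (u + v) \<le> ennreal (s + t)"
    using st by (intro rearrangement_le) auto
  then show ?thesis using st by simp
qed auto

subsection \<open>Dyadic discretization of Lorentz norms\<close>

text \<open>P stands for 1/p. A real parameter lets the conjugate norm be written with 1 - P,
  without reference to p'.\<close>

definition dyadic_norm :: "real \<Rightarrow> ennreal \<Rightarrow> (real^'n \<Rightarrow> complex) \<Rightarrow> ennreal" where
  "dyadic_norm P q f = seq_norm q (\<lambda>k::int. ennreal (2 powr (P * k)) * rearrangement f (2 powr k))"

lemma dyadic_scale:
  assumes "0 < u"
  shows "2 powr real_of_int \<lfloor>log 2 u\<rfloor> \<le> u" "u < 2 * 2 powr real_of_int \<lfloor>log 2 u\<rfloor>"
proof -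
  have "2 powr real_of_int \<lfloor>log 2 u\<rfloor> \<le> 2 powr (log 2 u)" by (intro powr_mono) auto
  then show "2 powr real_of_int \<lfloor>log 2 u\<rfloor> \<le> u" using assms by simp
  have "2 powr (log 2 u) < 2 powr (1 + real_of_int \<lfloor>log 2 u\<rfloor>)" by (intro powr_less_mono) linarith+
  then show "u < 2 * 2 powr real_of_int \<lfloor>log 2 u\<rfloor>" using assms by (simp add: powr_add)
qed

lemma dyadic_scale_unique:
  assumes "2 powr real_of_int j \<le> u" "u < 2 * 2 powr real_of_int j"
    "2 powr real_of_int k \<le> u" "u < 2 * 2 powr real_of_int k"
  shows "j = k"
proof -
  have "2 powr real_of_int j < 2 powr (1 + real_of_int k)" "2 powr real_of_int k < 2 powr (1 + real_of_int j)"
    using assms by (simp_all add: powr_add)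
  then show ?thesis by simp
qed

text \<open>The weight 1 / 2^k cancels the length 2^k of the interval from 2^k to 2^(k+1); this is
  how integrals against du/u turn into sums over k.\<close>

lemma nn_integral_dyadic_steps:
  fixes c :: "int \<Rightarrow> ennreal"
  shows "(\<integral>\<^sup>+u. (\<integral>\<^sup>+k. c k * ennreal (1 / 2 powr real_of_int k)
        * indicator {2 powr real_of_int k..<2 * 2 powr real_of_int k} u \<partial>count_space UNIV) \<partial>lborel)
     = (\<integral>\<^sup>+k. c k \<partial>count_space UNIV)"
proof -
  have "(\<integral>\<^sup>+u. (\<integral>\<^sup>+k. c k * ennreal (1 / 2 powr real_of_int k)
        * indicator {2 powr real_of_int k..<2 * 2 powr real_of_int k} u \<partial>count_space UNIV) \<partial>lborel)
     = (\<integral>\<^sup>+k. (\<integral>\<^sup>+u. c k * ennreal (1 / 2 powr real_of_int k)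
        * indicator {2 powr real_of_int k..<2 * 2 powr real_of_int k} u \<partial>lborel) \<partial>count_space UNIV)"
    by (intro nn_integral_count_space_nn_integral) auto
  also have "\<dots> = (\<integral>\<^sup>+k. c k \<partial>count_space UNIV)"
  proof (intro nn_integral_cong)
    fix k :: int
    have "(\<integral>\<^sup>+u. c k * ennreal (1 / 2 powr real_of_int k)
        * indicator {2 powr real_of_int k..<2 * 2 powr real_of_int k} u \<partial>lborel)
        = c k * (ennreal (1 / 2 powr real_of_int k) * ennreal (2 powr real_of_int k))"
      by (subst nn_integral_cmult_indicator) (simp_all add: mult.assoc)
    also have "\<dots> = c k" by (simp flip: ennreal_mult)
    finally show "(\<integral>\<^sup>+u. c k * ennreal (1 / 2 powr real_of_int k)
        * indicator {2 powr real_of_int k..<2 * 2 powr real_of_int k} u \<partial>lborel) = c k" .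
  qed
  finally show ?thesis .
qed

lemma count_space_single_term:
  fixes a :: "int \<Rightarrow> ennreal"
  assumes "0 < u"
  shows "(\<integral>\<^sup>+k. a k * indicator {2 powr real_of_int k..<2 * 2 powr real_of_int k} u \<partial>count_space UNIV)
    = a \<lfloor>log 2 u\<rfloor>"
proof -
  obtain j where j: "j = \<lfloor>log 2 u\<rfloor>" "2 powr real_of_int j \<le> u" "u < 2 * 2 powr real_of_int j"
    using dyadic_scale[OF assms] by blast
  have "indicator {2 powr real_of_int k..<2 * 2 powr real_of_int k} u = (0 :: ennreal)" if "k \<noteq> j" for k
    using that j dyadic_scale_unique[of k u j] by (auto simp: indicator_def)
  then show ?thesis
    unfolding j(1)[symmetric] using j(2,3)
    by (subst nn_integral_count_space_finite_support[of "{j}"]) auto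
qed

locale lorentz_exponent =
  fixes p q :: ennreal
  assumes p: "1 < p" "p < top" and q: "1 < q" "q < top"
begin

abbreviation "P \<equiv> 1 / enn2real p"
abbreviation "Q \<equiv> enn2real q"

lemma P: "0 < P" "P < 1" and Q: "1 < Q"
  using enn2real_gt_one[OF p] enn2real_gt_one[OF q] by auto

lemma q_pos [simp]: "0 < q"
  using q by (auto intro: less_trans[of 0 1])

lemma lorentz_norm_powr:
  "lorentz_norm p q f ennpowr Q = (\<integral>\<^sup>+u\<in>{0<..}. (ennreal (u powr P) * rearrangement f u) ennpowr Q
              * ennreal (1 / u) \<partial>lborel)"
  using q Q by (simp add: lorentz_norm_def less_top[symmetric])

text \<open>For 2^k <= u < 2^(k+1), monotonicity replaces the rearrangement at u by its value at
  2^k, 1/u by 1/2^k, and u^P by at most 2 * 2^(P k).\<close>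

lemma lorentz_norm_le_dyadic: "lorentz_norm p q f \<le> 4 * dyadic_norm P q f"
proof -
  let ?x = "\<lambda>k::int. ennreal (2 powr (P * k)) * rearrangement f (2 powr k)"
  have "lorentz_norm p q f ennpowr Q \<le> (\<integral>\<^sup>+u. (\<integral>\<^sup>+k. (2 * ?x k) ennpowr Q * ennreal (1 / 2 powr real_of_int k)
        * indicator {2 powr real_of_int k..<2 * 2 powr real_of_int k} u \<partial>count_space UNIV) \<partial>lborel)"
    unfolding lorentz_norm_powr
  proof (intro nn_integral_mono)
    fix u :: real
    show "(ennreal (u powr P) * rearrangement f u) ennpowr Q * ennreal (1 / u) * indicator {0<..} u \<le>
       (\<integral>\<^sup>+k. (2 * ?x k) ennpowr Q * ennreal (1 / 2 powr real_of_int k)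
        * indicator {2 powr real_of_int k..<2 * 2 powr real_of_int k} u \<partial>count_space UNIV)"
    proof (cases "0 < u")
      case True
      define k where "k = \<lfloor>log 2 u\<rfloor>"
      have k: "2 powr real_of_int k \<le> u" "u < 2 * 2 powr real_of_int k"
        using dyadic_scale[OF True] by (simp_all add: k_def)
      have "u powr P \<le> (2 * 2 powr real_of_int k) powr P" using k True P by (intro powr_mono2) auto
      also have "\<dots> = 2 powr P * 2 powr (P * k)" by (simp add: powr_mult powr_powr mult.commute)
      also have "\<dots> \<le> 2 * 2 powr (P * k)"
        using powr_mono[of P 1 2] P by (intro mult_right_mono) auto
      finally have "ennreal (u powr P) \<le> 2 * ennreal (2 powr (P * k))"
        using ennreal_leI[of "u powr P" "2 * 2 powr (P * k)"] by (simp add: ennreal_mult)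
      then have "ennreal (u powr P) * rearrangement f u \<le> (2 * ennreal (2 powr (P * k))) * rearrangement f (2 powr k)"
        by (intro mult_mono rearrangement_antimono k) auto
      moreover have "1 / u \<le> 1 / 2 powr real_of_int k" using k True by (intro divide_left_mono) auto
      ultimately have "(ennreal (u powr P) * rearrangement f u) ennpowr Q * ennreal (1 / u)
          \<le> (2 * ?x k) ennpowr Q * ennreal (1 / 2 powr real_of_int k)"
        using Q by (intro mult_mono[OF ennpowr_mono ennreal_leI]) (auto simp: mult.assoc)
      then show ?thesis using True by (simp add: count_space_single_term k_def)
    qed simp
  qed
  also have "\<dots> = (\<integral>\<^sup>+k. (2 * ?x k) ennpowr Q \<partial>count_space UNIV)" by (rule nn_integral_dyadic_steps)
  also have "\<dots> = (2 * dyadic_norm P q f) ennpowr Q"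
    using q unfolding dyadic_norm_def seq_norm_cmult[OF q_pos, symmetric] by (subst seq_norm_powr) auto
  finally have "lorentz_norm p q f \<le> 2 * dyadic_norm P q f"
    using Q by (simp add: ennpowr_le_iff)
  \<comment> \<open>The argument gives 2; it is weakened to 4 to match the constant of the reverse
    comparison.\<close>
  also have "\<dots> \<le> 4 * dyadic_norm P q f" by (intro mult_right_mono) auto
  finally show ?thesis .
qed

text \<open>On a dyadic interval the rearrangement is bounded below only by its value at the right
  endpoint. Hence the auxiliary sequence y is sampled at 2^(k+1), and x is recovered as a shift of
  y. Each of the two moves costs a factor 2.\<close>

lemma dyadic_norm_le_lorentz: "dyadic_norm P q f \<le> 4 * lorentz_norm p q f"
proof -
  define x where "x k = ennreal (2 powr (P * k)) * rearrangement f (2 powr k)" for k :: int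
  define y where "y k = ennreal (2 powr (P * k)) * rearrangement f (2 * 2 powr k)" for k :: int
  have "(\<integral>\<^sup>+k. y k ennpowr Q * ennreal (1 / 2) \<partial>count_space UNIV) =
     (\<integral>\<^sup>+u. (\<integral>\<^sup>+k. (y k ennpowr Q * ennreal (1 / 2)) * ennreal (1 / 2 powr real_of_int k)
        * indicator {2 powr real_of_int k..<2 * 2 powr real_of_int k} u \<partial>count_space UNIV) \<partial>lborel)"
    by (rule nn_integral_dyadic_steps[symmetric])
  also have "\<dots> \<le> lorentz_norm p q f ennpowr Q"
    unfolding lorentz_norm_powr
  proof (intro nn_integral_mono)
    fix u :: real
    show "(\<integral>\<^sup>+k. (y k ennpowr Q * ennreal (1 / 2)) * ennreal (1 / 2 powr real_of_int k)
        * indicator {2 powr real_of_int k..<2 * 2 powr real_of_int k} u \<partial>count_space UNIV)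
      \<le> (ennreal (u powr P) * rearrangement f u) ennpowr Q * ennreal (1 / u) * indicator {0<..} u"
    proof (cases "0 < u")
      case True
      define k where "k = \<lfloor>log 2 u\<rfloor>"
      have k: "2 powr real_of_int k \<le> u" "u < 2 * 2 powr real_of_int k"
        using dyadic_scale[OF True] by (simp_all add: k_def)
      have "(2 powr real_of_int k) powr P \<le> u powr P" using k True P by (intro powr_mono2) auto
      then have "2 powr (P * k) \<le> u powr P" by (simp add: powr_powr mult.commute)
      then have "y k \<le> ennreal (u powr P) * rearrangement f u"
        unfolding y_def using k by (intro mult_mono rearrangement_antimono ennreal_leI) auto
      \<comment> \<open>Since u < 2 * 2^k, the density 1/u loses a factor 1/2 against the weight 1 /
        2^k.\<close>
      moreover have "ennreal (1 / 2) * ennreal (1 / 2 powr real_of_int k) \<le> ennreal (1 / u)"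
        unfolding ennreal_mult'[symmetric] using k True by (subst ennreal_mult[symmetric]) (auto intro!: ennreal_leI simp: divide_simps)
      ultimately have "y k ennpowr Q * (ennreal (1 / 2) * ennreal (1 / 2 powr real_of_int k))
          \<le> (ennreal (u powr P) * rearrangement f u) ennpowr Q * ennreal (1 / u)"
        using Q by (intro mult_mono ennpowr_mono) auto
      then show ?thesis
        unfolding count_space_single_term[OF True] k_def[symmetric] using True by (simp add: mult.assoc)
    next
      case False
      have "u < 2 powr real_of_int k" for k :: int using False by (intro le_less_trans[of u 0]) auto
      then have "indicator {2 powr real_of_int k..<2 * 2 powr real_of_int k} u = (0 :: ennreal)" for k :: int
        by (simp add: indicator_def not_le)
      then show ?thesis by simp
    qed
  qed
  finally have le: "(\<integral>\<^sup>+k. y k ennpowr Q \<partial>count_space UNIV) * ennreal (1 / 2) \<le> lorentz_norm p q f ennpowr Q"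
    by (simp add: nn_integral_multc)
  have half: "ennreal (1 / 2) * 2 = 1"
    using ennreal_mult[of "1/2" 2] by simp
  have "(\<integral>\<^sup>+k. y k ennpowr Q \<partial>count_space UNIV) = (\<integral>\<^sup>+k. y k ennpowr Q \<partial>count_space UNIV) * ennreal (1 / 2) * 2"
    unfolding mult.assoc half by simp
  also have "\<dots> \<le> 2 * lorentz_norm p q f ennpowr Q" using mult_right_mono[OF le, of 2] by (simp add: mult.commute)
  also have "\<dots> \<le> (2 * lorentz_norm p q f) ennpowr Q"
  proof -
    \<comment> \<open>As Q > 1, the factor 2 can be absorbed inside the power.\<close>
    have "2 \<le> 2 ennpowr Q" using powr_mono[of 1 Q 2] Q ennpowr_ennreal[of 2 Q] ennreal_leI[of 2 "2 powr Q"] by simp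
    then show ?thesis unfolding ennpowr_mult by (rule mult_right_mono) simp
  qed
  finally have y: "seq_norm q y \<le> 2 * lorentz_norm p q f"
    using Q q by (auto simp: seq_norm_def ennpowr_le_iff)
  \<comment> \<open>Shifting the index does not change the sequence norm, so only the factor 2^P <=
    2 is paid.\<close>
  have "x (k + 1) = ennreal (2 powr P) * y k" for k
  proof -
    have "2 powr (P * real_of_int (k + 1)) = 2 powr P * 2 powr (P * k)"
      by (simp add: algebra_simps add_divide_distrib flip: powr_add)
    moreover have "2 powr real_of_int (k + 1) = 2 * 2 powr k" by (simp add: powr_add)
    ultimately show ?thesis by (simp add: x_def y_def ennreal_mult mult.assoc)
  qed
  moreover have "bij (\<lambda>k::int. k + 1)" by (rule bij_betwI[where g="\<lambda>k. k - 1"]) auto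
  ultimately have "seq_norm q x = ennreal (2 powr P) * seq_norm q y"
    using seq_norm_bij[of "\<lambda>k. k + 1" q x] by (simp add: seq_norm_cmult)
  also have "\<dots> \<le> ennreal 2 * (2 * lorentz_norm p q f)"
    using y powr_mono[of P 1 2] P by (intro mult_mono ennreal_leI) auto
  finally show ?thesis by (simp add: dyadic_norm_def x_def[abs_def] flip: mult.assoc)
qed

end

subsection \<open>Dyadic cubes\<close>

lemma dyadic_cube_eq:
  "dyadic_cube (j, m) = {x. \<forall>i. 2 powi (-j) * real_of_int (m $ i) \<le> x $ i \<and>
      x $ i < 2 powi (-j) * real_of_int (m $ i) + 2 powi (-j)}"
  by (simp add: dyadic_cube_def algebra_simps)

text \<open>The half-open cube lies between an open and a closed box of equal volume, which gives
  its measure; the closed box also gives boundedness.\<close>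

lemma dyadic_cube_between_boxes:
  fixes j :: int and m :: "int^'n"
  defines "a \<equiv> (\<chi> i. 2 powi (-j) * real_of_int (m $ i)) :: real^'n"
  shows "box a (a + 2 powi (-j) *\<^sub>R One) \<subseteq> dyadic_cube (j, m)"
    "dyadic_cube (j, m) \<subseteq> cbox a (a + 2 powi (-j) *\<^sub>R One)"
proof -
  have "(One :: real^'n) $ i = 1" for i
    using inner_sum_Basis[of "axis i 1 :: real^'n"] by (simp add: cart_eq_inner_axis axis_in_Basis_iff)
  then show "box a (a + 2 powi (-j) *\<^sub>R One) \<subseteq> dyadic_cube (j, m)"
    "dyadic_cube (j, m) \<subseteq> cbox a (a + 2 powi (-j) *\<^sub>R One)"
    by (auto simp: dyadic_cube_eq mem_box_cart a_def less_imp_le)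
qed

lemma sets_dyadic_cube_borel: "dyadic_cube i \<in> sets borel"
proof (cases i)
  case (Pair j m)
  have "{x \<in> space borel. \<forall>i. 2 powi (-j) * real_of_int (m $ i) \<le> x $ i \<and>
      x $ i < 2 powi (-j) * real_of_int (m $ i) + 2 powi (-j)} \<in> sets borel"
    by measurable
  then show ?thesis by (simp add: Pair dyadic_cube_eq)
qed

lemma sets_dyadic_cube [measurable, simp]: "dyadic_cube i \<in> sets lebesgue"
  using sets_dyadic_cube_borel[of i] by (metis lebesgue_on_UNIV_eq sets_completionI_sets sets_lborel)

lemma emeasure_dyadic_cube:
  "emeasure lebesgue (dyadic_cube (j, m :: int^'n)) = ennreal ((2 powi (-j)) ^ CARD('n))"
proof -
  let ?a = "(\<chi> i. 2 powi (-j) * real_of_int (m $ i)) :: real^'n"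
  let ?b = "?a + 2 powi (-j) *\<^sub>R One"
  have prod: "(\<Prod>k\<in>Basis. (?b - ?a) \<bullet> k) = (2 powi (-j)) ^ CARD('n)"
    by (simp add: inner_sum_left_Basis)
  have le: "?a \<bullet> k \<le> ?b \<bullet> k" if "k \<in> Basis" for k
    using that by (simp add: inner_add_left inner_sum_left_Basis)
  have "emeasure lborel (dyadic_cube (j, m)) \<le> emeasure lborel (cbox ?a ?b)"
    by (intro emeasure_mono dyadic_cube_between_boxes) auto
  moreover have "emeasure lborel (box ?a ?b) \<le> emeasure lborel (dyadic_cube (j, m))"
    by (intro emeasure_mono dyadic_cube_between_boxes) (simp add: sets_dyadic_cube_borel)
  moreover have "emeasure lborel (cbox ?a ?b) = ennreal ((2 powi (-j)) ^ CARD('n))"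
    "emeasure lborel (box ?a ?b) = ennreal ((2 powi (-j)) ^ CARD('n))"
    by (metis emeasure_lborel_cbox le prod, metis emeasure_lborel_box le prod)
  ultimately have "emeasure lborel (dyadic_cube (j, m)) = ennreal ((2 powi (-j)) ^ CARD('n))"
    by simp
  then show ?thesis by (simp add: sets_dyadic_cube_borel)
qed

lemma emeasure_dyadic_cube_finite: "emeasure lebesgue (dyadic_cube i) < top"
  by (cases i) (simp add: emeasure_dyadic_cube)

lemma measure_dyadic_cube_pos: "0 < measure lebesgue (dyadic_cube i)"
  by (cases i) (simp add: emeasure_dyadic_cube measure_def)

lemma dyadic_cube_cover: "x \<in> dyadic_cube (j, \<chi> i. \<lfloor>x $ i * 2 powi j\<rfloor>)"
proof -
  have "2 powi (-j) * real_of_int \<lfloor>x $ i * 2 powi j\<rfloor> \<le> x $ i \<and>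
      x $ i < 2 powi (-j) * (real_of_int \<lfloor>x $ i * 2 powi j\<rfloor> + 1)" for i
  proof -
    have "(2::real) powi (-j) * 2 powi j = 1" by (simp add: power_int_minus)
    then have "x $ i = 2 powi (-j) * (x $ i * 2 powi j)" by (simp add: algebra_simps)
    moreover have "2 powi (-j) * real_of_int \<lfloor>x $ i * 2 powi j\<rfloor> \<le> 2 powi (-j) * (x $ i * 2 powi j)"
      by (intro mult_left_mono) auto
    moreover have "2 powi (-j) * (x $ i * 2 powi j) < 2 powi (-j) * (real_of_int \<lfloor>x $ i * 2 powi j\<rfloor> + 1)"
      by (intro mult_strict_left_mono) auto
    ultimately show ?thesis by linarith
  qed
  then show ?thesis by (simp add: dyadic_cube_def)
qed

lemma dyadic_cube_unique:
  assumes "x \<in> dyadic_cube (0, m)" shows "m = (\<chi> i. \<lfloor>x $ i\<rfloor>)"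
proof -
  have "m $ i = \<lfloor>x $ i\<rfloor>" for i
    using assms by (intro floor_unique[symmetric]) (auto simp: dyadic_cube_def)
  then show ?thesis by (simp add: vec_eq_iff)
qed

text \<open>The space norm sums over the set of cubes, whereas blocks are indexed by pairs (j, m);
  injectivity identifies the two sums. The volume determines j, and the lower corner, which belongs
  to the half-open cube, determines m.\<close>

lemma inj_dyadic_cube: "inj (dyadic_cube :: int \<times> (int^'n) \<Rightarrow> (real^'n) set)"
proof (rule injI, clarify)
  fix j k :: int and m l :: "int^'n"
  assume eq: "dyadic_cube (j, m) = dyadic_cube (k, l)"
  have corner: "2 powi (-k) * real_of_int (l $ i) \<le> 2 powi (-j) * real_of_int (m $ i)"
    if "dyadic_cube (j, m) \<subseteq> dyadic_cube (k, l)" for j k i and m l :: "int^'n"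
  proof -
    have "(\<chi> i. 2 powi (-j) * real_of_int (m $ i)) \<in> dyadic_cube (j, m)"
      by (simp add: dyadic_cube_eq)
    then have "(\<chi> i. 2 powi (-j) * real_of_int (m $ i)) \<in> dyadic_cube (k, l)" using that by blast
    then show ?thesis by (simp add: dyadic_cube_eq)
  qed
  have "(2::real) powi (- j) = 2 powi (- k)"
    using eq emeasure_dyadic_cube[of j m] emeasure_dyadic_cube[of k l]
    by (simp add: power_eq_iff_eq_base)
  then have "j = k"
    using power_int_strict_increasing[of "-j" "-k" "2::real"] power_int_strict_increasing[of "-k" "-j" "2::real"]
    by (cases j k rule: linorder_cases) auto
  moreover have "2 powi (-j) * real_of_int (m $ i) = 2 powi (-k) * real_of_int (l $ i)" for i
    using corner[of j m k l i] corner[of k l j m i] eq by force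
  then have "m = l" using \<open>j = k\<close> by (simp add: vec_eq_iff)
  ultimately show "j = k \<and> m = l" by simp
qed

lemma bounded_dyadic_cube: "bounded (dyadic_cube i)"
  by (cases i) (metis bounded_cbox bounded_subset dyadic_cube_between_boxes(2))

text \<open>Large cubes meet several unit cubes, but boundedness leaves only finitely many integer
  parts; test functions on any cube can thus be cut into finitely many pieces on unit cubes.\<close>

lemma dyadic_cube_finite_unit_cover:
  "finite {m. dyadic_cube (0, m) \<inter> dyadic_cube (i :: int \<times> (int^'n)) \<noteq> {}}"
proof -
  obtain B where B: "\<And>x. x \<in> dyadic_cube i \<Longrightarrow> norm x \<le> B"
    using bounded_dyadic_cube[of i] by (auto simp: bounded_iff)
  have "{m. dyadic_cube (0, m) \<inter> dyadic_cube i \<noteq> {}} \<subseteq>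
      vec_lambda ` (UNIV \<rightarrow>\<^sub>E {- \<lceil>B\<rceil> - 1..\<lceil>B\<rceil>})"
  proof (rule subsetI)
    fix m assume "m \<in> {m. dyadic_cube (0, m) \<inter> dyadic_cube i \<noteq> {}}"
    then obtain x where x: "x \<in> dyadic_cube (0, m)" "x \<in> dyadic_cube i" by blast
    have "m $ k \<in> {- \<lceil>B\<rceil> - 1..\<lceil>B\<rceil>}" for k
    proof -
      have "\<bar>x $ k\<bar> \<le> B" using B[OF x(2)] component_le_norm_cart[of x k] by linarith
      moreover have "m $ k = \<lfloor>x $ k\<rfloor>" using dyadic_cube_unique[OF x(1)] by (simp add: vec_eq_iff)
      ultimately show ?thesis by simp linarith
    qed
    then show "m \<in> vec_lambda ` (UNIV \<rightarrow>\<^sub>E {- \<lceil>B\<rceil> - 1..\<lceil>B\<rceil>})"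
      by (intro image_eqI[of _ _ "vec_nth m"]) auto
  qed
  then show ?thesis by (rule finite_subset) (auto intro!: finite_imageI finite_PiE)
qed

text \<open>A is swept out by small cubes, each of measure at most c/2. The measures of the partial
  unions grow by steps of at most c/2, so the first one to exceed c/2 is still at most c. The set A
  itself may have infinite measure.\<close>

lemma exists_subset_comparable_measure:
  fixes A :: "(real^'n) set"
  assumes A [measurable]: "A \<in> sets lebesgue" and c: "0 < c" "ennreal c < emeasure lebesgue A"
  shows "\<exists>F\<in>sets lebesgue. F \<subseteq> A \<and> ennreal (c / 2) \<le> emeasure lebesgue F \<and> emeasure lebesgue F \<le> ennreal c"
proof -
  obtain j :: nat where "(1 / 2) ^ j < min 1 (c / 2)"
    using real_arch_pow_inv[of "min 1 (c / 2)" "1/2"] c by auto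
  moreover have "(2::real) powi (- int j) = (1 / 2) ^ j" by (simp add: power_int_minus power_one_over field_simps)
  ultimately have j: "(2::real) powi (- int j) < 1" "(2::real) powi (- int j) < c / 2" by auto
  \<comment> \<open>The side length is below 1, so the volume is at most the side length; no root of
    c is needed.\<close>
  have "((2::real) powi (- int j)) ^ CARD('n) \<le> (2 powi (- int j)) ^ 1"
    by (intro power_decreasing) (use j in auto)
  then have small: "emeasure lebesgue (dyadic_cube (int j, m :: int^'n)) \<le> ennreal (c / 2)" for m
    using j by (auto simp: emeasure_dyadic_cube intro!: ennreal_leI)
  define C where "C n = dyadic_cube (int j, from_nat n :: int^'n)" for n
  have C [measurable]: "C n \<in> sets lebesgue" for n by (simp add: C_def)
  define U where "U n = A \<inter> (\<Union>i<n. C i)" for n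
  have U [measurable]: "U n \<in> sets lebesgue" for n unfolding U_def by measurable
  have "(\<Union>n. C n) = UNIV"
  proof (intro equalityI subsetI UNIV_I)
    fix x :: "real^'n"
    show "x \<in> (\<Union>n. C n)"
      using dyadic_cube_cover[of x "int j"] by (metis C_def UNIV_I UN_I from_nat_to_nat)
  qed
  then have "A = (\<Union>n. U n)" unfolding U_def by blast
  moreover have "(SUP n. emeasure lebesgue (U n)) = emeasure lebesgue (\<Union>n. U n)"
    by (intro SUP_emeasure_incseq incseq_SucI) (auto simp: U_def less_Suc_eq)
  ultimately have "ennreal c < (SUP n. emeasure lebesgue (U n))" using c by simp
  then obtain n where n: "ennreal c < emeasure lebesgue (U n)" by (auto simp: less_SUP_iff)
  define N where "N = (LEAST n. ennreal (c / 2) < emeasure lebesgue (U n))"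
  have half: "ennreal (c / 2) < ennreal c" using c by (intro ennreal_lessI) auto
  have N: "ennreal (c / 2) < emeasure lebesgue (U N)"
    unfolding N_def by (rule LeastI[of _ n]) (use n half in order)
  have "U 0 = {}" by (simp add: U_def)
  then have "N \<noteq> 0" using N by (cases "N = 0") auto
  then obtain M where M: "N = Suc M" by (cases N) auto
  have "emeasure lebesgue (U M) \<le> ennreal (c / 2)"
    using not_less_Least[of M "\<lambda>n. ennreal (c / 2) < emeasure lebesgue (U n)"] M unfolding N_def[symmetric] by simp
  moreover have "emeasure lebesgue (U N) \<le> emeasure lebesgue (U M) + emeasure lebesgue (C M)"
  proof -
    have "emeasure lebesgue (U N) \<le> emeasure lebesgue (U M \<union> C M)"
      by (intro emeasure_mono) (auto simp: U_def M less_Suc_eq)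
    also have "\<dots> \<le> emeasure lebesgue (U M) + emeasure lebesgue (C M)"
      by (intro emeasure_subadditive) auto
    finally show ?thesis .
  qed
  moreover have "emeasure lebesgue (C M) \<le> ennreal (c / 2)" unfolding C_def by (rule small)
  ultimately have "emeasure lebesgue (U N) \<le> ennreal (c / 2) + ennreal (c / 2)"
    by (meson add_mono order.trans)
  also have "\<dots> = ennreal c" using c by (simp flip: ennreal_plus)
  finally show ?thesis using N by (intro bexI[of _ "U N"]) (auto simp: U_def)
qed

subsection \<open>Lorentz norms: algebra and Hoelder's inequality\<close>

text \<open>By monotonicity the sublevel sets are intervals.\<close>

lemma borel_measurable_rearrangement [measurable]: "rearrangement f \<in> borel_measurable borel"
proof (rule borel_measurableI_less)
  fix y
  have "is_interval {u. rearrangement f u < y}"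
    unfolding is_interval_1 using rearrangement_antimono[of _ _ f] by (auto intro: le_less_trans)
  then show "{u \<in> space borel. rearrangement f u < y} \<in> sets borel"
    by (simp add: real_interval_borel_measurable)
qed

text \<open>Splitting 2^(k+1) as 2^k + 2^k bounds the rearrangement of the sum at scale k + 1 by
  those of f and g at scale k; the index shift changes the weight by 2^P <= 2.\<close>

lemma dyadic_norm_add_le:
  fixes f g :: "real^'n \<Rightarrow> complex"
  assumes f: "f \<in> borel_measurable lebesgue" and g: "g \<in> borel_measurable lebesgue"
    and ab: "conj_pair a b" and P: "P \<le> 1"
  shows "dyadic_norm P a (\<lambda>x. f x + g x) \<le> 2 * (dyadic_norm P a f + dyadic_norm P a g)"
proof -
  define x where "x h k = ennreal (2 powr (P * k)) * rearrangement h (2 powr k)"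
    for h :: "real^'n \<Rightarrow> complex" and k :: int
  have "x (\<lambda>x. f x + g x) (k + 1) \<le> 2 * (x f k + x g k)" for k
  proof -
    have "2 powr (P * real_of_int (k + 1)) = 2 powr P * 2 powr (P * k)"
      by (simp add: algebra_simps flip: powr_add)
    also have "\<dots> \<le> 2 * 2 powr (P * k)"
      using powr_mono[of P 1 2] P by (intro mult_right_mono) auto
    finally have "ennreal (2 powr (P * real_of_int (k + 1))) \<le> ennreal (2 * 2 powr (P * k))"
      by (rule ennreal_leI)
    then have "ennreal (2 powr (P * real_of_int (k + 1))) \<le> 2 * ennreal (2 powr (P * k))"
      by (simp add: ennreal_mult)
    moreover have "rearrangement (\<lambda>x. f x + g x) (2 powr real_of_int (k + 1))
        \<le> rearrangement f (2 powr k) + rearrangement g (2 powr k)"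
      using rearrangement_add_le[OF f g, of "2 powr k" "2 powr k"] by (simp add: powr_add mult.commute)
    ultimately have "x (\<lambda>x. f x + g x) (k + 1)
        \<le> (2 * ennreal (2 powr (P * k))) * (rearrangement f (2 powr k) + rearrangement g (2 powr k))"
      unfolding x_def by (rule mult_mono) auto
    then show ?thesis by (simp add: x_def distrib_left mult.assoc)
  qed
  then have "seq_norm a (\<lambda>k. x (\<lambda>x. f x + g x) (k + 1)) \<le> seq_norm a (\<lambda>k. 2 * (x f k + x g k))"
    by (rule seq_norm_mono)
  moreover have "bij (\<lambda>k::int. k + 1)" by (rule bij_betwI[where g="\<lambda>k. k - 1"]) auto
  ultimately have "seq_norm a (x (\<lambda>x. f x + g x)) \<le> seq_norm a (\<lambda>k. 2 * (x f k + x g k))"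
    by (subst (asm) seq_norm_bij)
  also have "\<dots> \<le> 2 * (seq_norm a (x f) + seq_norm a (x g))"
    unfolding seq_norm_cmult[OF conj_pair_pos[OF ab]] by (intro mult_left_mono seq_norm_triangle[OF ab]) auto
  finally show ?thesis by (simp add: dyadic_norm_def x_def[abs_def])
qed

context lorentz_exponent
begin

lemma lorentz_norm_cmult:
  assumes f: "f \<in> borel_measurable lebesgue"
  shows "lorentz_norm p q (\<lambda>x. a * f x) = ennreal (norm a) * lorentz_norm p q f"
proof -
  have "lorentz_norm p q (\<lambda>x. a * f x) ennpowr Q =
     (\<integral>\<^sup>+u. ennreal (norm a) ennpowr Q * ((ennreal (u powr P) * rearrangement f u) ennpowr Q
        * ennreal (1 / u) * indicator {0<..} u) \<partial>lborel)"
    unfolding lorentz_norm_powr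
  proof (intro nn_integral_cong)
    fix u :: real
    show "(ennreal (u powr P) * rearrangement (\<lambda>x. a * f x) u) ennpowr Q * ennreal (1 / u) * indicator {0<..} u
      = ennreal (norm a) ennpowr Q * ((ennreal (u powr P) * rearrangement f u) ennpowr Q
        * ennreal (1 / u) * indicator {0<..} u)"
      by (cases "0 < u") (simp_all add: rearrangement_cmult[OF f] ennpowr_mult mult_ac)
  qed
  also have "\<dots> = ennreal (norm a) ennpowr Q * lorentz_norm p q f ennpowr Q"
    unfolding lorentz_norm_powr by (intro nn_integral_cmult) measurable
  also have "\<dots> = (ennreal (norm a) * lorentz_norm p q f) ennpowr Q" by (simp add: ennpowr_mult)
  finally have "(lorentz_norm p q (\<lambda>x. a * f x) ennpowr Q) ennpowr (1 / Q)
      = ((ennreal (norm a) * lorentz_norm p q f) ennpowr Q) ennpowr (1 / Q)"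
    by simp
  then show ?thesis using Q by (simp del: ennpowr_eq_top_iff)
qed

lemma lorentz_norm_mono:
  assumes "g \<in> borel_measurable lebesgue" "\<And>x. norm (f x) \<le> norm (g x)"
  shows "lorentz_norm p q f \<le> lorentz_norm p q g"
proof -
  have "lorentz_norm p q f ennpowr Q \<le> lorentz_norm p q g ennpowr Q"
    unfolding lorentz_norm_powr
    by (intro nn_integral_mono mult_right_mono ennpowr_mono mult_left_mono rearrangement_mono assms)
       (use Q in auto)
  then have "(lorentz_norm p q f ennpowr Q) ennpowr (1 / Q) \<le> (lorentz_norm p q g ennpowr Q) ennpowr (1 / Q)"
    by (rule ennpowr_mono) (use Q in auto)
  then show ?thesis using Q by simp
qed

lemma conj_pair_q: "conj_pair q (conj_exponent q)"
  using conj_pair_conj_exponent q by blast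

text \<open>The constant is 4 * 2 * 4: to the dyadic norm and back, with the dyadic triangle
  constant 2 in between.\<close>

lemma lorentz_norm_add_le:
  assumes "f \<in> borel_measurable lebesgue" "g \<in> borel_measurable lebesgue"
  shows "lorentz_norm p q (\<lambda>x. f x + g x) \<le> 32 * (lorentz_norm p q f + lorentz_norm p q g)"
proof -
  have "lorentz_norm p q (\<lambda>x. f x + g x) \<le> 4 * dyadic_norm P q (\<lambda>x. f x + g x)"
    by (rule lorentz_norm_le_dyadic)
  also have "\<dots> \<le> 4 * (2 * (dyadic_norm P q f + dyadic_norm P q g))"
    using P by (intro mult_left_mono dyadic_norm_add_le[OF assms conj_pair_q]) auto
  also have "\<dots> \<le> 4 * (2 * (4 * lorentz_norm p q f + 4 * lorentz_norm p q g))"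
    by (intro mult_left_mono add_mono dyadic_norm_le_lorentz) auto
  also have "\<dots> = (4 * (2 * 4)) * (lorentz_norm p q f + lorentz_norm p q g)"
    by (simp only: distrib_left mult.assoc)
  finally show ?thesis by simp
qed

end

text \<open>A vanishing rearrangement at 2^k says that f is nonzero on a set of measure at most 2^k;
  then k tends to minus infinity.\<close>

lemma AE_zero_of_rearrangement:
  fixes f :: "real^'n \<Rightarrow> complex"
  assumes f [measurable]: "f \<in> borel_measurable lebesgue"
    and z: "\<And>k::int. rearrangement f (2 powr k) = 0"
  shows "AE x in lebesgue. f x = 0"
proof -
  have le: "emeasure lebesgue {x. 0 < norm (f x)} \<le> ennreal (2 powr real_of_int k)" for k
    using distribution_fun_le[OF f, of "2 powr k" 0] z[of k] by (simp add: distribution_fun_def)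
  have "emeasure lebesgue {x. 0 < norm (f x)} = 0"
  proof (rule ccontr)
    assume nz: "emeasure lebesgue {x. 0 < norm (f x)} \<noteq> 0"
    obtain c where c: "emeasure lebesgue {x. 0 < norm (f x)} = ennreal c" "0 < c"
      using le[of 0] nz by (cases "emeasure lebesgue {x. 0 < norm (f x)}") (auto simp: top_unique less_eq_real_def)
    have "c \<le> 2 powr real_of_int (\<lfloor>log 2 c\<rfloor> - 1)" using le[of "\<lfloor>log 2 c\<rfloor> - 1"] c by simp
    then show False using dyadic_scale(1)[OF c(2)] c(2) by (simp add: powr_diff)
  qed
  then have "{x. 0 < norm (f x)} \<in> null_sets lebesgue"
    using sets_superlevel[OF f, of 0] by auto
  then show ?thesis by (intro AE_I'[of "{x. 0 < norm (f x)}"]) auto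
qed

lemma int_change_point:
  fixes A :: "int \<Rightarrow> bool"
  assumes "A i" "\<not> A j" "i \<le> j"
  shows "\<exists>k. A k \<and> \<not> A (k + 1)"
proof (rule ccontr)
  assume *: "\<not> ?thesis"
  have "A j" using \<open>i \<le> j\<close> by (induction rule: int_ge_induct) (use assms * in auto)
  then show False using assms by simp
qed

lemma tends_to_zero_bound:
  fixes c K x P :: real
  assumes "0 < P" "\<And>k::int. x \<le> K * 2 powr (- P * k)"
  shows "x \<le> 0"
proof (rule ccontr)
  assume "\<not> x \<le> 0"
  then have x: "0 < x" by simp
  have "x \<le> K" using assms(2)[of 0] by simp
  then have K: "0 < K" using x by simp
  define k where "k = \<lfloor>log 2 (K / x) / P\<rfloor> + 1"
  have "log 2 (K / x) / P < k" unfolding k_def by linarith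
  then have "log 2 (K / x) < P * k" using assms(1) by (simp add: field_simps)
  then have "2 powr log 2 (K / x) < 2 powr (P * k)" by simp
  then have "K / x < 2 powr (P * k)" using K x by simp
  then have "K * 2 powr (- P * k) < x" using x by (simp add: powr_minus field_simps)
  then show False using assms(2)[of k] by simp
qed

text \<open>Splitting \<open>\<real>\<^sup>n\<close> along the superlevel sets at the heights \<open>f\<^sup>*(2\<^sup>k)\<close> and \<open>g\<^sup>*(2\<^sup>k)\<close> reduces
  the inequality to sequences.\<close>

lemma dyadic_norm_Holder:
  fixes f g :: "real^'n \<Rightarrow> complex"
  assumes f [measurable]: "f \<in> borel_measurable lebesgue" and g [measurable]: "g \<in> borel_measurable lebesgue"
    and P: "0 < P" and ab: "conj_pair a b"
  shows "(\<integral>\<^sup>+x. ennreal (norm (f x * g x)) \<partial>lebesgue) \<le> 4 * (dyadic_norm P a f * dyadic_norm (1 - P) b g)"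
proof -
  let ?x = "\<lambda>k::int. ennreal (2 powr (P * k)) * rearrangement f (2 powr k)"
  let ?y = "\<lambda>k::int. ennreal (2 powr ((1 - P) * k)) * rearrangement g (2 powr k)"
  have xle: "?x k \<le> dyadic_norm P a f" for k
    unfolding dyadic_norm_def using conj_pair_pos[OF ab] by (rule le_seq_norm)
  have yle: "?y k \<le> dyadic_norm (1 - P) b g" for k
    unfolding dyadic_norm_def using conj_pair_pos[OF conj_pair_sym[OF ab]] by (rule le_seq_norm)
  have zero: "(\<integral>\<^sup>+x. ennreal (norm (f x * g x)) \<partial>lebesgue) = 0" if "AE x in lebesgue. f x * g x = 0"
    using that by (subst nn_integral_0_iff_AE) auto
  consider "dyadic_norm P a f = 0" | "dyadic_norm (1 - P) b g = 0"
    | "dyadic_norm P a f \<noteq> 0" "dyadic_norm (1 - P) b g \<noteq> 0" "dyadic_norm P a f = top \<or> dyadic_norm (1 - P) b g = top"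
    | "dyadic_norm P a f < top" "dyadic_norm (1 - P) b g < top"
    using less_top by blast
  then show ?thesis
  proof cases
    case 1
    \<comment> \<open>The right-hand side may be 0 times infinity, that is 0, so the integrand
      itself must be shown to vanish almost everywhere.\<close>
    then have "rearrangement f (2 powr k) = 0" for k :: int using xle[of k] by (auto simp: ennreal_eq_0_iff)
    from AE_zero_of_rearrangement[OF f this] show ?thesis by (subst zero) auto
  next
    case 2
    then have "rearrangement g (2 powr k) = 0" for k :: int using yle[of k] by (auto simp: ennreal_eq_0_iff)
    from AE_zero_of_rearrangement[OF g this] show ?thesis by (subst zero) auto
  next
    case 3
    then show ?thesis by (auto simp: ennreal_mult_top ennreal_top_mult)
  next
    case 4
    have ffin: "rearrangement f (2 powr k) \<noteq> top" for k :: int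
      using xle[of k] 4 by (auto simp: ennreal_mult_top ennreal_eq_0_iff top_unique)
    define s where "s k = enn2real (rearrangement f (2 powr real_of_int k))" for k :: int
    then have s: "rearrangement f (2 powr k) = ennreal (s k)" "0 \<le> s k" for k :: int
      using ffin[of k] by (auto simp: ennreal_enn2real_if)
    have gfin: "rearrangement g (2 powr k) \<noteq> top" for k :: int
      using yle[of k] 4 by (auto simp: ennreal_mult_top ennreal_eq_0_iff top_unique)
    define t where "t k = enn2real (rearrangement g (2 powr real_of_int k))" for k :: int
    then have t: "rearrangement g (2 powr k) = ennreal (t k)" "0 \<le> t k" for k :: int
      using gfin[of k] by (auto simp: ennreal_enn2real_if)
    obtain K where K: "dyadic_norm P a f = ennreal K" "0 \<le> K" using 4 by (cases "dyadic_norm P a f") auto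
    have sK: "s k \<le> K * 2 powr (- P * k)" for k
    proof -
      have "2 powr (P * k) * s k \<le> K" using xle[of k] K s[of k] by (simp flip: ennreal_mult)
      then show ?thesis by (simp add: powr_minus field_simps)
    qed
    have anti: "s k \<le> s j" "t k \<le> t j" if "j \<le> k" for j k
    proof -
      have "(2::real) powr real_of_int j \<le> 2 powr real_of_int k" using that by simp
      from rearrangement_antimono[OF this, of f] rearrangement_antimono[OF this, of g]
      show "s k \<le> s j" "t k \<le> t j" using s t by auto
    qed
    \<comment> \<open>One set serves both functions: outside F k, |f| <= s k and |g| <= t k hold
      simultaneously, while the measure of F k is only 2 * 2^k.\<close>
    define F where "F k = {x. s k < norm (f x)} \<union> {x. t k < norm (g x)}" for k
    have F [measurable]: "F k \<in> sets lebesgue" for k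
      unfolding F_def using sets_superlevel[OF f] sets_superlevel[OF g] by blast
    have Fle: "emeasure lebesgue (F k) \<le> ennreal (2 * 2 powr k)" for k
    proof -
      have "emeasure lebesgue (F k) \<le> distribution_fun f (s k) + distribution_fun g (t k)"
        unfolding F_def distribution_fun_def
        by (intro emeasure_subadditive sets_superlevel[OF f] sets_superlevel[OF g])
      also have "\<dots> \<le> ennreal (2 powr k) + ennreal (2 powr k)"
        using s t by (intro add_mono distribution_fun_le[OF f] distribution_fun_le[OF g]) auto
      finally show ?thesis by (simp flip: ennreal_plus)
    qed
    have Fmono: "F j \<subseteq> F k" if "j \<le> k" for j k
      unfolding F_def using anti[OF that] by auto
    have "emeasure lebesgue (\<Inter>k. F k) = 0"
    proof (rule ccontr)
      assume nz: "emeasure lebesgue (\<Inter>k. F k) \<noteq> 0"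
      have le: "emeasure lebesgue (\<Inter>k. F k) \<le> ennreal (2 * 2 powr k)" for k :: int
        using emeasure_mono[of "\<Inter>k. F k" "F k" lebesgue] Fle[of k] by (auto intro: order.trans)
      obtain c where c: "emeasure lebesgue (\<Inter>k. F k) = ennreal c" "0 < c"
        using le[of 0] nz by (cases "emeasure lebesgue (\<Inter>k. F k)") (auto simp: top_unique less_eq_real_def)
      have "c \<le> 2 * 2 powr real_of_int (\<lfloor>log 2 c\<rfloor> - 2)" using le[of "\<lfloor>log 2 c\<rfloor> - 2"] c by simp
      then show False using dyadic_scale(1)[OF c(2)] c(2) by (simp add: powr_diff)
    qed
    moreover have "(\<Inter>k. F k) \<in> sets lebesgue" by (intro sets.countable_INT) auto
    ultimately have null: "AE x in lebesgue. x \<notin> (\<Inter>k. F k)"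
      by (intro AE_not_in) auto
    have pt: "ennreal (norm (f x * g x)) \<le>
        (\<integral>\<^sup>+k. ennreal (s k * t k) * indicator (F (k + 1)) x \<partial>count_space UNIV)" if x: "x \<notin> (\<Inter>k. F k)" for x
    proof -
      obtain i where i: "x \<notin> F i" using x by blast
      show ?thesis
      proof (cases "\<exists>j. x \<in> F j")
        case True
        then obtain j where j: "x \<in> F j" by blast
        then have "i \<le> j" using i Fmono[of j i] by (cases "i \<le> j") auto
        \<comment> \<open>The sets F k increase with k, so x enters them at a unique scale; just
          before entering, the product is at most s k * t k.\<close>
        then obtain k where k: "x \<notin> F k" "x \<in> F (k + 1)"
          using int_change_point[of "\<lambda>k. x \<notin> F k" i j] i j by auto
        have "norm (f x * g x) \<le> s k * t k"
          unfolding norm_mult using k(1) s by (intro mult_mono) (auto simp: F_def)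
        then have "ennreal (norm (f x * g x)) \<le> ennreal (s k * t k) * indicator (F (k + 1)) x"
          using k by (simp add: ennreal_leI)
        also have "\<dots> \<le> (\<integral>\<^sup>+k. ennreal (s k * t k) * indicator (F (k + 1)) x \<partial>count_space UNIV)"
          using le_seq_norm[of 1 "\<lambda>k. ennreal (s k * t k) * indicator (F (k + 1)) x"] by (simp add: seq_norm_one)
        finally show ?thesis .
      next
        case False
        \<comment> \<open>A point that lies in no F k satisfies |f x| <= s k for every k, and s k
          tends to 0 as k grows.\<close>
        then have "norm (f x) \<le> K * 2 powr (- P * k)" for k :: int
        proof -
          have "x \<notin> F k" using False by blast
          then have "norm (f x) \<le> s k" by (simp add: F_def not_less)
          then show ?thesis using sK[of k] by linarith
        qed
        then have "norm (f x) \<le> 0" by (rule tends_to_zero_bound[OF P])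
        then show ?thesis by simp
      qed
    qed
    have "(\<integral>\<^sup>+x. ennreal (norm (f x * g x)) \<partial>lebesgue) \<le>
        (\<integral>\<^sup>+x. (\<integral>\<^sup>+k. ennreal (s k * t k) * indicator (F (k + 1)) x \<partial>count_space UNIV) \<partial>lebesgue)"
      using null pt by (intro nn_integral_mono_AE) auto
    also have "\<dots> = (\<integral>\<^sup>+k. (\<integral>\<^sup>+x. ennreal (s k * t k) * indicator (F (k + 1)) x \<partial>lebesgue) \<partial>count_space UNIV)"
      by (intro nn_integral_count_space_nn_integral) auto
    also have "\<dots> \<le> (\<integral>\<^sup>+k. 4 * (?x k * ?y k) \<partial>count_space UNIV)"
    proof (intro nn_integral_mono)
      fix k :: int
      have "(\<integral>\<^sup>+x. ennreal (s k * t k) * indicator (F (k + 1)) x \<partial>lebesgue) = ennreal (s k * t k) * emeasure lebesgue (F (k + 1))"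
        by (intro nn_integral_cmult_indicator F)
      also have "\<dots> \<le> ennreal (s k * t k) * ennreal (2 * 2 powr real_of_int (k + 1))"
        by (intro mult_left_mono Fle) auto
      also have "\<dots> = ennreal (4 * ((2 powr (P * k) * s k) * (2 powr ((1 - P) * k) * t k)))"
      proof -
        \<comment> \<open>The measure bound 2 * 2^(k+1) is 4 * 2^k, and 2^k splits into the two
          Lorentz weights; this is the constant 4.\<close>
        have "2 powr (P * k) * 2 powr ((1 - P) * k) = 2 powr real_of_int k"
          unfolding powr_add[symmetric] by (simp add: algebra_simps)
        then have "4 * ((2 powr (P * k) * s k) * (2 powr ((1 - P) * k) * t k)) = 4 * 2 powr real_of_int k * (s k * t k)"
          by (metis mult.assoc mult.left_commute)
        then show ?thesis
          by (simp only:) (use s t in \<open>simp add: powr_add mult_ac flip: ennreal_mult\<close>)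
      qed
      also have "\<dots> = 4 * (?x k * ?y k)" using s t by (simp add: ennreal_mult)
      finally show "(\<integral>\<^sup>+x. ennreal (s k * t k) * indicator (F (k + 1)) x \<partial>lebesgue) \<le> 4 * (?x k * ?y k)" .
    qed
    also have "\<dots> = 4 * (\<integral>\<^sup>+k. ?x k * ?y k \<partial>count_space UNIV)" by (simp add: nn_integral_cmult)
    also have "\<dots> \<le> 4 * (dyadic_norm P a f * dyadic_norm (1 - P) b g)"
      unfolding dyadic_norm_def by (intro mult_left_mono seq_norm_Holder ab) auto
    finally show ?thesis .
  qed
qed

subsection \<open>Lorentz norms: the converse of Hoelder's inequality\<close>

text \<open>Induction on the largest element: the smaller exponents contribute at most as much as
  the largest one, and doubling that stays below 2^k.\<close>

lemma sum_dyadic_below: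
  fixes J :: "int set"
  assumes "finite J" "\<And>j. j \<in> J \<Longrightarrow> j < k"
  shows "(\<Sum>j\<in>J. 2 powr real_of_int j) \<le> 2 powr real_of_int k"
  using assms
proof (induction J arbitrary: k rule: finite_linorder_max_induct)
  case (insert b A)
  have "(\<Sum>j\<in>A. 2 powr real_of_int j) \<le> 2 powr real_of_int b" using insert by auto
  moreover have "b \<notin> A" using insert by blast
  moreover have "2 powr real_of_int (b + 1) \<le> 2 powr real_of_int k"
    using insert.prems[of b] by simp
  ultimately show ?case using insert.hyps(1) by (simp add: powr_add)
qed simp

text \<open>The value of the geometric series of 2^(-P i) over i >= 0.\<close>

definition geometric_const :: "real \<Rightarrow> real" where
  "geometric_const P = 1 / (1 - 2 powr (- P))"

lemma geometric_const:
  assumes "0 < P"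
  shows "(\<integral>\<^sup>+i. ennreal (2 powr (- P * real i)) \<partial>count_space UNIV) = ennreal (geometric_const P)"
    "1 \<le> geometric_const P"
proof -
  define th where "th = 2 powr (- P)"
  have th: "0 < th" "th < 1" using assms powr_less_mono[of "-P" 0 2] by (auto simp: th_def)
  have pw: "2 powr (- P * real i) = th ^ i" for i
    unfolding th_def by (simp add: powr_powr flip: powr_realpow)
  have "(\<integral>\<^sup>+i. ennreal (th ^ i) \<partial>count_space UNIV) = (\<Sum>i. ennreal (th ^ i))"
    by (rule nn_integral_count_space_nat)
  also have "\<dots> = ennreal (\<Sum>i. th ^ i)"
    using th by (intro suminf_ennreal2 summable_geometric) auto
  also have "(\<Sum>i. th ^ i) = geometric_const P"
    using th suminf_geometric[of th] by (simp add: geometric_const_def th_def)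
  finally show "(\<integral>\<^sup>+i. ennreal (2 powr (- P * real i)) \<partial>count_space UNIV) = ennreal (geometric_const P)"
    unfolding pw .
  show "1 \<le> geometric_const P" using th by (simp add: geometric_const_def th_def[symmetric])
qed

text \<open>A discrete Young inequality: every shift of y has the same norm, and against a test
  sequence the geometric weights sum to \<open>geometric_const P\<close>. This replaces Minkowski's
  inequality for infinitely many terms.\<close>

lemma seq_norm_geometric_convolution:
  fixes y :: "int \<Rightarrow> ennreal"
  assumes P: "0 < P" and ab: "conj_pair a b"
  shows "seq_norm a (\<lambda>k. \<integral>\<^sup>+i. ennreal (2 powr (- P * real i)) * y (k + int i) \<partial>count_space UNIV)
    \<le> ennreal (geometric_const P) * seq_norm a y"
proof (cases "seq_norm a y = top")
  case True
  then show ?thesis using geometric_const(2)[OF P] by (simp add: ennreal_mult_top)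
next
  case False
  let ?t = "\<lambda>i. ennreal (2 powr (- P * real i))"
  show ?thesis
  proof (rule seq_norm_converse_Holder[OF ab])
    show "ennreal (geometric_const P) * seq_norm a y < top" using False by (simp add: ennreal_mult_less_top less_top)
    fix z :: "int \<Rightarrow> real" and I :: "int set"
    assume I: "finite I" and z: "\<And>i. 0 \<le> z i" "\<And>i. i \<notin> I \<Longrightarrow> z i = 0"
    have "(\<Sum>k\<in>I. ennreal (z k) * (\<integral>\<^sup>+i. ?t i * y (k + int i) \<partial>count_space UNIV))
        = (\<Sum>k\<in>I. (\<integral>\<^sup>+i. ?t i * (ennreal (z k) * y (k + int i)) \<partial>count_space UNIV))"
      by (simp add: mult.left_commute flip: nn_integral_cmult)
    also have "\<dots> = (\<integral>\<^sup>+i. ?t i * (\<Sum>k\<in>I. ennreal (z k) * y (k + int i)) \<partial>count_space UNIV)"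
      by (simp add: sum_distrib_left flip: nn_integral_sum)
    also have "\<dots> \<le> (\<integral>\<^sup>+i. ?t i * (seq_norm a y * seq_norm b (\<lambda>i. ennreal (z i))) \<partial>count_space UNIV)"
    proof (intro nn_integral_mono mult_left_mono)
      fix i :: nat
      have "bij (\<lambda>k::int. k + int i)" by (rule bij_betwI[where g="\<lambda>k. k - int i"]) auto
      then have sh: "seq_norm a (\<lambda>k. y (k + int i)) = seq_norm a y" by (rule seq_norm_bij)
      have "(\<Sum>k\<in>I. ennreal (z k) * y (k + int i)) = (\<integral>\<^sup>+k. y (k + int i) * ennreal (z k) \<partial>count_space UNIV)"
        by (subst nn_integral_count_space_finite_support[of I]) (use I z in \<open>auto simp: mult.commute\<close>)
      also have "\<dots> \<le> seq_norm a y * seq_norm b (\<lambda>i. ennreal (z i))"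
        using seq_norm_Holder[OF ab, of "\<lambda>k. y (k + int i)"] by (simp add: sh)
      finally show "(\<Sum>k\<in>I. ennreal (z k) * y (k + int i)) \<le> seq_norm a y * seq_norm b (\<lambda>i. ennreal (z i))" .
    qed simp
    also have "\<dots> = ennreal (geometric_const P) * (seq_norm a y * seq_norm b (\<lambda>i. ennreal (z i)))"
      unfolding geometric_const(1)[OF P, symmetric] by (rule nn_integral_multc) simp
    finally show "(\<Sum>k\<in>I. ennreal (z k) * (\<integral>\<^sup>+i. ?t i * y (k + int i) \<partial>count_space UNIV))
      \<le> ennreal (geometric_const P) * seq_norm a y * seq_norm b (\<lambda>i. ennreal (z i))"
      by (simp add: mult.assoc)
  qed
qed

text \<open>Outside the union of the \<open>F j\<close> with \<open>j < k\<close>, a set of measure at most \<open>2\<^sup>k\<close>, only the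
  weights \<open>w j\<close> with \<open>j \<ge> k\<close> contribute.\<close>

lemma dyadic_norm_step_function:
  fixes b :: "real^'n \<Rightarrow> complex" and w :: "int \<Rightarrow> real"
  assumes P: "0 < P" and ac: "conj_pair a c" and b: "b \<in> borel_measurable lebesgue"
    and J: "finite J" and w: "\<And>k. 0 \<le> w k" "\<And>k. k \<notin> J \<Longrightarrow> w k = 0"
    and F: "\<And>k. k \<in> J \<Longrightarrow> F k \<in> sets lebesgue"
      "\<And>k. k \<in> J \<Longrightarrow> emeasure lebesgue (F k) \<le> ennreal (2 powr real_of_int k)"
    and le: "\<And>x. norm (b x) \<le> (\<Sum>k\<in>J. w k * indicator (F k) x)"
  shows "dyadic_norm P a b \<le> ennreal (geometric_const P) * seq_norm a (\<lambda>k. ennreal (2 powr (P * k) * w k))"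
proof -
  define y where "y k = ennreal (2 powr (P * k) * w k)" for k :: int
  have "ennreal (2 powr (P * k)) * rearrangement b (2 powr k)
      \<le> (\<integral>\<^sup>+i. ennreal (2 powr (- P * real i)) * y (k + int i) \<partial>count_space UNIV)" for k :: int
  proof -
    define B where "B = (\<Sum>j\<in>{j\<in>J. k \<le> j}. w j)"
    have B0: "0 \<le> B" unfolding B_def by (intro sum_nonneg w)
    have "distribution_fun b B \<le> emeasure lebesgue (\<Union>j\<in>{j\<in>J. j < k}. F j)"
      unfolding distribution_fun_def
    proof (rule emeasure_mono)
      show "(\<Union>j\<in>{j\<in>J. j < k}. F j) \<in> sets lebesgue" using J F by auto
      show "{x. B < norm (b x)} \<subseteq> (\<Union>j\<in>{j\<in>J. j < k}. F j)"
      proof (rule subsetI, rule ccontr)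
        fix x assume x: "x \<in> {x. B < norm (b x)}" "x \<notin> (\<Union>j\<in>{j\<in>J. j < k}. F j)"
        have "norm (b x) \<le> (\<Sum>j\<in>J. w j * indicator (F j) x)" by (rule le)
        also have "\<dots> = (\<Sum>j\<in>{j\<in>J. k \<le> j}. w j * indicator (F j) x)"
          using x(2) J by (intro sum.mono_neutral_right) (auto simp: not_le indicator_def)
        also have "\<dots> \<le> B" unfolding B_def by (intro sum_mono) (auto simp: w indicator_def)
        finally show False using x(1) by simp
      qed
    qed
    also have "\<dots> \<le> (\<Sum>j\<in>{j\<in>J. j < k}. emeasure lebesgue (F j))"
      using J F by (intro emeasure_subadditive_finite) auto
    also have "\<dots> \<le> (\<Sum>j\<in>{j\<in>J. j < k}. ennreal (2 powr real_of_int j))" by (intro sum_mono F) auto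
    also have "\<dots> = ennreal (\<Sum>j\<in>{j\<in>J. j < k}. 2 powr real_of_int j)" by (intro sum_ennreal) auto
    also have "\<dots> \<le> ennreal (2 powr real_of_int k)" using J by (intro ennreal_leI sum_dyadic_below) auto
    finally have "rearrangement b (2 powr k) \<le> ennreal B" using B0 by (intro rearrangement_le[OF b])
    then have "ennreal (2 powr (P * k)) * rearrangement b (2 powr k) \<le> ennreal (2 powr (P * k)) * ennreal B"
      by (intro mult_left_mono) auto
    also have "\<dots> = (\<Sum>j\<in>{j\<in>J. k \<le> j}. ennreal (2 powr (P * k) * w j))"
      using w B0 by (simp add: B_def sum_distrib_left flip: ennreal_mult)
    \<comment> \<open>With i = j - k, the identity 2^(P k) = 2^(-P i) * 2^(P j) exhibits the bound
      as a convolution with a geometric sequence.\<close>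
    also have "\<dots> = (\<Sum>i\<in>(\<lambda>j. nat (j - k)) ` {j\<in>J. k \<le> j}. ennreal (2 powr (- P * real i)) * y (k + int i))"
    proof (subst sum.reindex)
      show "inj_on (\<lambda>j. nat (j - k)) {j\<in>J. k \<le> j}" by (auto simp: inj_on_def)
      show "(\<Sum>j\<in>{j\<in>J. k \<le> j}. ennreal (2 powr (P * k) * w j)) =
        sum ((\<lambda>i. ennreal (2 powr (- P * real i)) * y (k + int i)) \<circ> (\<lambda>j. nat (j - k))) {j\<in>J. k \<le> j}"
      proof (intro sum.cong refl)
        fix j assume "j \<in> {j\<in>J. k \<le> j}"
        then have "k \<le> j" by simp
        have "2 powr (P * k) * w j = 2 powr (- P * (j - k)) * (2 powr (P * j) * w j)"
          unfolding mult.assoc[symmetric] powr_add[symmetric] by (simp add: algebra_simps)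
        then show "ennreal (2 powr (P * k) * w j) =
          ((\<lambda>i. ennreal (2 powr (- P * real i)) * y (k + int i)) \<circ> (\<lambda>j. nat (j - k))) j"
          using \<open>k \<le> j\<close> w by (simp add: y_def flip: ennreal_mult)
      qed
    qed
    also have "\<dots> \<le> (\<integral>\<^sup>+i. ennreal (2 powr (- P * real i)) * y (k + int i) \<partial>count_space UNIV)"
      unfolding infsum_eq_nn_integral_count_space[symmetric]
      by (subst nonneg_infsum_complete) (use J in \<open>auto intro!: SUP_upper\<close>)
    finally show ?thesis .
  qed
  then have "dyadic_norm P a b \<le> seq_norm a (\<lambda>k. \<integral>\<^sup>+i. ennreal (2 powr (- P * real i)) * y (k + int i) \<partial>count_space UNIV)"
    unfolding dyadic_norm_def by (rule seq_norm_mono)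
  also have "\<dots> \<le> ennreal (geometric_const P) * seq_norm a y"
    by (rule seq_norm_geometric_convolution[OF P ac])
  finally show ?thesis by (simp add: y_def[abs_def])
qed

section \<open>Lorentz norms of bounded functions and of truncations\<close>

lemma ennpowr_tendsto_0:
  assumes "(x \<longlongrightarrow> 0) F" "0 < a"
  shows "((\<lambda>n. x n ennpowr a) \<longlongrightarrow> 0) F"
proof (rule order_tendstoI)
  fix e :: ennreal assume "0 < e"
  then have "0 < e ennpowr (1 / a)" by (simp add: zero_less_iff_neq_zero)
  then have "eventually (\<lambda>n. x n < e ennpowr (1 / a)) F" using assms(1) by (rule order_tendstoD(2)[rotated])
  then show "eventually (\<lambda>n. x n ennpowr a < e) F"
  proof eventually_elim
    case (elim n)
    show ?case
    proof (rule ccontr)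
      assume "\<not> ?case"
      then have "e ennpowr (1 / a) \<le> (x n ennpowr a) ennpowr (1 / a)" using assms(2) by (intro ennpowr_mono) auto
      then show False using elim assms(2) by simp
    qed
  qed
qed simp

context lorentz_exponent
begin

text \<open>A step function with a single step. Applied to the conjugate exponents it makes
  functionals absolutely continuous on indicators.\<close>

lemma lorentz_norm_indicator_le:
  assumes E: "E \<in> sets lebesgue" "emeasure lebesgue E \<le> ennreal (2 powr real_of_int m)"
  shows "lorentz_norm p q (indicator E :: real^'n \<Rightarrow> complex) \<le> ennreal (4 * geometric_const P * 2 powr (P * m))"
proof -
  have "dyadic_norm P q (indicator E :: real^'n \<Rightarrow> complex) \<le> ennreal (geometric_const P) * seq_norm q
      (\<lambda>k::int. ennreal (2 powr (P * k) * (if k = m then 1 else 0)))"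
    by (rule dyadic_norm_step_function[OF P(1) conj_pair_q, where J="{m}" and F="\<lambda>_. E"])
       (use E in \<open>auto simp: indicator_def\<close>)
  moreover have "(\<lambda>k::int. ennreal (2 powr (P * k) * (if k = m then 1 else 0))) = (\<lambda>k. if k = m then ennreal (2 powr (P * m)) else 0)"
    by auto
  ultimately have "dyadic_norm P q (indicator E :: real^'n \<Rightarrow> complex) \<le> ennreal (geometric_const P) * ennreal (2 powr (P * m))"
    by (simp add: seq_norm_single)
  then have "4 * dyadic_norm P q (indicator E :: real^'n \<Rightarrow> complex) \<le> 4 * (ennreal (geometric_const P) * ennreal (2 powr (P * m)))"
    by (rule mult_left_mono) simp
  also have "\<dots> = ennreal (4 * geometric_const P * 2 powr (P * m))"
    using geometric_const(2)[OF P(1)] by (simp add: ennreal_mult mult.assoc)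
  finally show ?thesis using lorentz_norm_le_dyadic order.trans by blast
qed

lemma lorentz_norm_bounded_finite:
  assumes f: "f \<in> borel_measurable lebesgue" and S: "S \<in> sets lebesgue" "emeasure lebesgue S < top"
    and supp: "\<And>x. x \<notin> S \<Longrightarrow> f x = 0" and B: "\<And>x. norm (f x) \<le> B"
  shows "lorentz_norm p q f < top"
proof -
  obtain s where s: "emeasure lebesgue S = ennreal s" "0 \<le> s" using S by (cases "emeasure lebesgue S") auto
  define m where "m = \<lceil>log 2 (s + 1)\<rceil>"
  have "s \<le> 2 powr (log 2 (s + 1))" using s by simp
  also have "\<dots> \<le> 2 powr m" unfolding m_def by (intro powr_mono) auto
  finally have m: "emeasure lebesgue S \<le> ennreal (2 powr real_of_int m)" using s by (simp add: ennreal_leI)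
  have "0 \<le> B" using B[of undefined] norm_ge_zero order.trans by blast
  have "lorentz_norm p q f \<le> lorentz_norm p q (\<lambda>x. complex_of_real B * indicator S x)"
    using S supp B \<open>0 \<le> B\<close> by (intro lorentz_norm_mono) (auto simp: indicator_def)
  also have "\<dots> = ennreal (norm (complex_of_real B)) * lorentz_norm p q (indicator S)"
    using S by (intro lorentz_norm_cmult) auto
  also have "\<dots> \<le> ennreal (norm (complex_of_real B)) * ennreal (4 * geometric_const P * 2 powr (P * m))"
    by (intro mult_left_mono lorentz_norm_indicator_le S m) auto
  also have "\<dots> < top" by (simp add: ennreal_mult_less_top)
  finally show ?thesis .
qed

lemma rearrangement_finite_of_lorentz_norm:
  assumes "lorentz_norm p q f < top"
  shows "rearrangement f (2 powr real_of_int k) < top"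
proof -
  have "ennreal (2 powr (P * k)) * rearrangement f (2 powr real_of_int k) \<le> dyadic_norm P q f"
    unfolding dyadic_norm_def by (rule le_seq_norm[OF q_pos])
  also have "\<dots> \<le> 4 * lorentz_norm p q f" by (rule dyadic_norm_le_lorentz)
  also have "\<dots> < top" using assms by (simp add: ennreal_mult_less_top)
  finally show ?thesis by (auto simp: ennreal_mult_less_top ennreal_eq_0_iff)
qed

text \<open>Dominated convergence over the scales k, with the summable sequence of f itself as
  majorant; this relies on q being finite.\<close>

lemma lorentz_norm_truncation_tendsto:
  fixes f :: "real^'n \<Rightarrow> complex"
  assumes f [measurable]: "f \<in> borel_measurable lebesgue" and fin: "lorentz_norm p q f < top"
  shows "(\<lambda>N. lorentz_norm p q (\<lambda>x. f x * indicator {x. real N < norm (f x)} x)) \<longlonglongrightarrow> 0"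
proof -
  define g where "g N x = f x * indicator {x. real N < norm (f x)} x" for N x
  have g [measurable]: "g N \<in> borel_measurable lebesgue" for N
    unfolding g_def using sets_superlevel[OF f, of "real N"] by measurable
  define X where "X h k = (ennreal (2 powr (P * real_of_int k)) * rearrangement h (2 powr real_of_int k)) ennpowr Q"
    for h :: "real^'n \<Rightarrow> complex" and k
  have dn: "dyadic_norm P q h = (\<integral>\<^sup>+k. X h k \<partial>count_space UNIV) ennpowr (1 / Q)" for h :: "real^'n \<Rightarrow> complex"
    using q by (auto simp: dyadic_norm_def seq_norm_def X_def)
  have le: "X (g N) k \<le> X f k" for N k
    unfolding X_def
    by (intro ennpowr_mono mult_left_mono rearrangement_mono f) (use Q in \<open>auto simp: g_def indicator_def\<close>)
  have "dyadic_norm P q f < top"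
    using fin dyadic_norm_le_lorentz[of f] by (simp add: ennreal_mult_less_top order.strict_trans1[of _ "4 * lorentz_norm p q f"])
  then have finX: "(\<integral>\<^sup>+k. X f k \<partial>count_space UNIV) < top" by (simp add: dn)
  have lim: "(\<lambda>N. X (g N) k) \<longlonglongrightarrow> 0" for k
  proof -
    obtain s where s: "rearrangement f (2 powr real_of_int k) = ennreal s" "0 \<le> s"
      using rearrangement_finite_of_lorentz_norm[OF fin, of k] by (cases "rearrangement f (2 powr real_of_int k)") auto
    \<comment> \<open>Once N exceeds the rearrangement of f at 2^k, the truncated function lives on
      a set of measure at most 2^k, so its sampled value at that scale is exactly 0.\<close>
    have "X (g N) k = 0" if "N \<ge> nat \<lceil>s\<rceil>" for N
    proof -
      have "s \<le> real N" using that by linarith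
      have "distribution_fun (g N) 0 \<le> distribution_fun f s"
        unfolding distribution_fun_def using \<open>s \<le> real N\<close>
        by (intro emeasure_mono sets_superlevel[OF f]) (auto simp: g_def indicator_def split: if_splits)
      also have "\<dots> \<le> ennreal (2 powr real_of_int k)" using s by (intro distribution_fun_le[OF f]) auto
      finally have "rearrangement (g N) (2 powr real_of_int k) \<le> ennreal 0" by (intro rearrangement_le[OF g]) auto
      then show ?thesis by (simp add: X_def)
    qed
    then have "eventually (\<lambda>N. X (g N) k = 0) sequentially"
      unfolding eventually_sequentially by blast
    then show ?thesis by (rule tendsto_eventually)
  qed
  have "(\<lambda>N. \<integral>\<^sup>+k. X (g N) k \<partial>count_space UNIV) \<longlonglongrightarrow> (\<integral>\<^sup>+k. 0 \<partial>(count_space UNIV :: int measure))"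
    by (rule nn_integral_dominated_convergence[where w="X f"]) (use le lim finX in auto)
  then have "(\<lambda>N. \<integral>\<^sup>+k. X (g N) k \<partial>count_space UNIV) \<longlonglongrightarrow> 0" by simp
  then have lim': "(\<lambda>N. dyadic_norm P q (g N)) \<longlonglongrightarrow> 0"
    unfolding dn using Q by (intro ennpowr_tendsto_0) auto
  then have "(\<lambda>N. 4 * dyadic_norm P q (g N)) \<longlonglongrightarrow> 4 * 0" by (intro ennreal_tendsto_cmult) auto
  then have lim4: "(\<lambda>N. 4 * dyadic_norm P q (g N)) \<longlonglongrightarrow> 0" by simp
  have "(\<lambda>N. lorentz_norm p q (g N)) \<longlonglongrightarrow> 0"
    by (rule tendsto_sandwich[OF _ _ tendsto_const lim4]) (auto intro: always_eventually lorentz_norm_le_dyadic)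
  then show ?thesis by (simp add: g_def[abs_def])
qed

end

lemma borel_measurable_cnj [measurable]: "cnj \<in> borel_measurable borel"
  by (intro borel_measurable_continuous_onI continuous_intros)

text \<open>By continuity from above, the measure of the set where |f| > n tends to 0. Real heights
  a k are thereby available in the converse of Hoelder's inequality before the norm is known to be
  finite.\<close>

lemma rearrangement_finite_support:
  fixes f :: "real^'n \<Rightarrow> complex"
  assumes f: "f \<in> borel_measurable lebesgue" and S: "S \<in> sets lebesgue" "emeasure lebesgue S < top"
    and supp: "\<And>x. x \<notin> S \<Longrightarrow> f x = 0" and u: "0 < u"
  shows "rearrangement f u < top"
proof -
  define A where "A n = {x. real n < norm (f x)}" for n
  have A: "A n \<in> sets lebesgue" "A n \<subseteq> S" for n
  proof -
    show "A n \<in> sets lebesgue" unfolding A_def by (rule sets_superlevel[OF f])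
    have "x \<in> S" if "real n < norm (f x)" for x
      using that supp[of x] by (cases "x \<in> S") auto
    then show "A n \<subseteq> S" by (auto simp: A_def)
  qed
  have "(\<lambda>n. emeasure lebesgue (A n)) \<longlonglongrightarrow> emeasure lebesgue (\<Inter>n. A n)"
  proof (rule Lim_emeasure_decseq)
    show "decseq A" by (auto simp: decseq_def A_def)
    show "emeasure lebesgue (A n) \<noteq> \<infinity>" for n
      using emeasure_mono[OF A(2) S(1), of n] S(2) by (auto simp: top_unique)
  qed (use A in auto)
  moreover have "(\<Inter>n. A n) = {}"
  proof (rule ccontr)
    assume "(\<Inter>n. A n) \<noteq> {}"
    then obtain x where "\<And>n. real n < norm (f x)" by (auto simp: A_def)
    then show False using reals_Archimedean2[of "norm (f x)"] by (metis not_less_iff_gr_or_eq)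
  qed
  ultimately have "(\<lambda>n. emeasure lebesgue (A n)) \<longlonglongrightarrow> 0" by simp
  then have "eventually (\<lambda>n. emeasure lebesgue (A n) < ennreal u) sequentially"
    by (rule order_tendstoD) (use u in simp)
  then obtain n where "emeasure lebesgue (A n) < ennreal u" by (auto simp: eventually_sequentially)
  then have "rearrangement f u \<le> ennreal (real n)"
    by (intro rearrangement_le[OF f]) (auto simp: distribution_fun_def A_def)
  then show ?thesis by (auto intro: le_less_trans)
qed

section \<open>Duality for a pair of conjugate Lorentz exponents\<close>

locale lorentz_pair = lorentz_exponent p q + conj: lorentz_exponent p' q' for p q p' q' +
  assumes conj_pair_p: "conj_pair p p'" and conj_pair_qq: "conj_pair q q'"
begin

text \<open>Symmetry allows the converse of Hoelder's inequality to be used for the conjugate norm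
  as well.\<close>

lemma swapped: "lorentz_pair p' q' p q"
  using conj_pair_sym[OF conj_pair_p] conj_pair_sym[OF conj_pair_qq] by unfold_locales

lemma conj_P: "1 / enn2real p' = 1 - P"
  using conj_pair_p p conj.p by (auto simp: conj_pair_def)

text \<open>The constant 64 is 4 from the dyadic inequality times 4 for each of the two
  norms.\<close>

lemma lorentz_norm_Holder:
  fixes f g :: "real^'n \<Rightarrow> complex"
  assumes "f \<in> borel_measurable lebesgue" "g \<in> borel_measurable lebesgue"
  shows "(\<integral>\<^sup>+x. ennreal (norm (f x * g x)) \<partial>lebesgue) \<le> 64 * (lorentz_norm p q f * lorentz_norm p' q' g)"
proof -
  have "(\<integral>\<^sup>+x. ennreal (norm (f x * g x)) \<partial>lebesgue) \<le> 4 * (dyadic_norm P q f * dyadic_norm (1 - P) q' g)"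
    by (rule dyadic_norm_Holder[OF assms P(1) conj_pair_qq])
  also have "\<dots> \<le> 4 * ((4 * lorentz_norm p q f) * (4 * lorentz_norm p' q' g))"
    using conj.dyadic_norm_le_lorentz[of g] dyadic_norm_le_lorentz[of f] unfolding conj_P
    by (intro mult_left_mono mult_mono) auto
  also have "\<dots> = (4 * (4 * 4)) * (lorentz_norm p q f * lorentz_norm p' q' g)"
    by (simp only: mult_ac)
  finally show ?thesis by simp
qed

text \<open>Here 64 is 4 * 4 * 4: the mass bound a k * 2^k / 4 on the chosen sets, and one passage
  between Lorentz and dyadic norm for the test function and one for f. The geometric factor is the
  cost of summing step functions in the conjugate norm.\<close>

definition converse_const :: real where
  "converse_const = 64 * geometric_const (1 - P)"

lemma converse_const_pos: "0 < converse_const"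
  unfolding converse_const_def using geometric_const(2)[of "1 - P"] P by simp

text \<open>The extremal function is a finite step function times the conjugate phase of f. It is
  bounded, supported in S and satisfies f b >= 0, so the hypothesis is demanded only for such b;
  this is what a functional known merely on bounded functions can supply.\<close>

theorem lorentz_norm_converse_Holder:
  fixes f :: "real^'n \<Rightarrow> complex"
  assumes f [measurable]: "f \<in> borel_measurable lebesgue"
    and S [measurable]: "S \<in> sets lebesgue" "emeasure lebesgue S < top" and K: "K < top"
    and le: "\<And>b B. b \<in> borel_measurable lebesgue \<Longrightarrow> (\<And>x. x \<notin> S \<Longrightarrow> b x = 0) \<Longrightarrow> (\<And>x. norm (b x) \<le> B) \<Longrightarrow>
      (\<And>x. f x * b x = complex_of_real (norm (f x * b x))) \<Longrightarrow> lorentz_norm p' q' b \<le> 1 \<Longrightarrow>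
      (\<integral>\<^sup>+x. ennreal (norm (f x * b x)) \<partial>lebesgue) \<le> K"
  shows "lorentz_norm p q (\<lambda>x. f x * indicator S x) \<le> ennreal converse_const * K"
proof -
  define G where "G = geometric_const (1 - P)"
  have G: "1 \<le> G" unfolding G_def using geometric_const(2)[of "1 - P"] P by simp
  define h where "h x = f x * indicator S x" for x
  have h [measurable]: "h \<in> borel_measurable lebesgue" unfolding h_def by measurable
  have hS: "h x = 0" if "x \<notin> S" for x using that by (simp add: h_def)
  define a where "a k = enn2real (rearrangement h (2 powr real_of_int k))" for k :: int
  have a: "rearrangement h (2 powr real_of_int k) = ennreal (a k)" "0 \<le> a k" for k
    using rearrangement_finite_support[OF h S hS, of "2 powr real_of_int k"] by (auto simp: a_def ennreal_enn2real_if)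
  \<comment> \<open>The last clause bounds from below the integral of |f| over F; for a k = 0 it is
    trivial and the empty set serves.\<close>
  have "\<exists>F. F \<in> sets lebesgue \<and> F \<subseteq> S \<and> emeasure lebesgue F \<le> ennreal (2 powr real_of_int k) \<and>
      (\<forall>x\<in>F. a k / 2 \<le> norm (f x)) \<and> ennreal (a k * 2 powr real_of_int k / 4) \<le> ennreal (a k / 2) * emeasure lebesgue F" for k
  proof (cases "a k = 0")
    case True
    then show ?thesis by (intro exI[of _ "{}"]) auto
  next
    case False
    then have ak: "0 < a k" using a(2)[of k] by simp
    then have "\<not> rearrangement h (2 powr real_of_int k) \<le> ennreal (a k / 2)" by (simp add: a)
    \<comment> \<open>As a k / 2 lies strictly below the rearrangement at 2^k, the superlevel set at
      this height has measure greater than 2^k, and a piece of measure between 2^k / 2 and 2^k can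
      be cut out.\<close>
    then have "ennreal (2 powr real_of_int k) < emeasure lebesgue {x. a k / 2 < norm (h x)}"
      using rearrangement_le_iff[OF h, of "a k / 2"] ak by (simp add: distribution_fun_def not_le)
    from exists_subset_comparable_measure[OF sets_superlevel[OF h] _ this]
    obtain F where F: "F \<in> sets lebesgue" "F \<subseteq> {x. a k / 2 < norm (h x)}"
      "ennreal (2 powr real_of_int k / 2) \<le> emeasure lebesgue F" "emeasure lebesgue F \<le> ennreal (2 powr real_of_int k)"
      by auto
    have *: "x \<in> S \<and> a k / 2 \<le> norm (f x)" if "x \<in> F" for x
    proof -
      have "a k / 2 < norm (h x)" using F(2) that by auto
      then show ?thesis using ak by (cases "x \<in> S") (auto simp: h_def)
    qed
    have "ennreal (a k * 2 powr real_of_int k / 4) = ennreal (a k / 2) * ennreal (2 powr real_of_int k / 2)"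
      using ak by (simp flip: ennreal_mult)
    also have "\<dots> \<le> ennreal (a k / 2) * emeasure lebesgue F" by (intro mult_left_mono F) auto
    finally show ?thesis using F * by (intro exI[of _ F]) auto
  qed
  then obtain F where F: "\<And>k. F k \<in> sets lebesgue" "\<And>k. F k \<subseteq> S"
      "\<And>k. emeasure lebesgue (F k) \<le> ennreal (2 powr real_of_int k)" "\<And>k x. x \<in> F k \<Longrightarrow> a k / 2 \<le> norm (f x)"
      "\<And>k. ennreal (a k * 2 powr real_of_int k / 4) \<le> ennreal (a k / 2) * emeasure lebesgue (F k)"
    by metis
  note F(1) [measurable]
  have "dyadic_norm P q h \<le> ennreal (16 * G) * K"
    unfolding dyadic_norm_def
  proof (rule seq_norm_converse_Holder[OF conj_pair_qq])
    show "ennreal (16 * G) * K < top" using K by (simp add: ennreal_mult_less_top)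
    fix y :: "int \<Rightarrow> real" and I :: "int set"
    assume I: "finite I" and y: "\<And>k. 0 \<le> y k" "\<And>k. k \<notin> I \<Longrightarrow> y k = 0"
    \<comment> \<open>The weights are chosen so that the weighted sequence 2^((1-P) k) * w k of the
      step function is the given test sequence y.\<close>
    define w where "w k = y k / 2 powr ((1 - P) * k)" for k :: int
    have w: "0 \<le> w k" "k \<notin> I \<Longrightarrow> w k = 0" "2 powr ((1 - P) * k) * w k = y k" for k
      unfolding w_def using y by auto
    define v where "v x = (\<Sum>k\<in>I. w k * indicator (F k) x)" for x
    have v [measurable]: "v \<in> borel_measurable lebesgue" unfolding v_def by measurable
    have v0: "0 \<le> v x" for x unfolding v_def by (intro sum_nonneg) (simp add: w)
    \<comment> \<open>The conjugate phase of f makes f b equal to |f| v, which is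
      nonnegative.\<close>
    define b where "b x = cnj (sgn (f x)) * complex_of_real (v x)" for x
    have b [measurable]: "b \<in> borel_measurable lebesgue" unfolding b_def by measurable
    have bv: "norm (b x) \<le> v x" for x
      unfolding b_def using v0[of x] by (simp add: norm_mult norm_sgn)
    have vS: "v x = 0" if "x \<notin> S" for x
      unfolding v_def using F(2) that by (intro sum.neutral) (auto simp: indicator_def)
    have vB: "v x \<le> (\<Sum>k\<in>I. w k)" for x
      unfolding v_def by (intro sum_mono) (auto simp: indicator_def w)
    have fb: "f x * b x = complex_of_real (norm (f x) * v x)" for x
      unfolding b_def by (simp add: sgn_eq complex_norm_square[symmetric] power2_eq_square flip: mult.assoc)
    have nfb: "norm (f x * b x) = norm (f x) * v x" for x
      unfolding fb norm_of_real using v0[of x] by simp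
    have pairing: "(\<Sum>k\<in>I. ennreal (y k) * (ennreal (2 powr (P * k)) * rearrangement h (2 powr k)))
        \<le> 4 * (\<integral>\<^sup>+x. ennreal (norm (f x * b x)) \<partial>lebesgue)"
    proof -
      have "(\<Sum>k\<in>I. ennreal (w k) * (ennreal (a k / 2) * emeasure lebesgue (F k)))
          = (\<integral>\<^sup>+x. (\<Sum>k\<in>I. ennreal (w k) * (ennreal (a k / 2) * indicator (F k) x)) \<partial>lebesgue)"
        by (simp add: nn_integral_sum nn_integral_cmult)
      also have "\<dots> \<le> (\<integral>\<^sup>+x. ennreal (norm (f x * b x)) \<partial>lebesgue)"
      proof (intro nn_integral_mono)
        fix x
        have "(\<Sum>k\<in>I. ennreal (w k) * (ennreal (a k / 2) * indicator (F k) x))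
            = ennreal (\<Sum>k\<in>I. w k * (a k / 2 * indicator (F k) x))"
        proof (subst sum_ennreal[symmetric])
          show "0 \<le> w k * (a k / 2 * indicator (F k) x)" for k by (simp add: w a)
          have "ennreal (w k) * (ennreal (a k / 2) * indicator (F k) x) = ennreal (w k * (a k / 2 * indicator (F k) x))" for k
            by (cases "x \<in> F k") (simp_all add: w a ennreal_mult del: times_divide_eq_right)
          then show "(\<Sum>k\<in>I. ennreal (w k) * (ennreal (a k / 2) * indicator (F k) x))
              = (\<Sum>k\<in>I. ennreal (w k * (a k / 2 * indicator (F k) x)))" by simp
        qed
        also have "\<dots> \<le> ennreal (\<Sum>k\<in>I. norm (f x) * (w k * indicator (F k) x))"
        proof (intro ennreal_leI sum_mono)
          fix k
          show "w k * (a k / 2 * indicator (F k) x) \<le> norm (f x) * (w k * indicator (F k) x)"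
          proof (cases "x \<in> F k")
            case True
            have "w k * (a k / 2) \<le> w k * norm (f x)" by (rule mult_left_mono[OF F(4)[OF True] w(1)])
            then show ?thesis using True by (simp add: mult.commute)
          qed simp
        qed
        also have "\<dots> = ennreal (norm (f x * b x))"
          unfolding nfb by (simp add: v_def sum_distrib_left)
        finally show "(\<Sum>k\<in>I. ennreal (w k) * (ennreal (a k / 2) * indicator (F k) x)) \<le> ennreal (norm (f x * b x))" .
      qed
      finally have "4 * (\<Sum>k\<in>I. ennreal (w k) * (ennreal (a k / 2) * emeasure lebesgue (F k)))
          \<le> 4 * (\<integral>\<^sup>+x. ennreal (norm (f x * b x)) \<partial>lebesgue)" by (rule mult_left_mono) simp
      moreover have "(\<Sum>k\<in>I. ennreal (y k) * (ennreal (2 powr (P * k)) * rearrangement h (2 powr k)))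
          \<le> 4 * (\<Sum>k\<in>I. ennreal (w k) * (ennreal (a k / 2) * emeasure lebesgue (F k)))"
        unfolding sum_distrib_left
      proof (rule sum_mono)
        fix k assume "k \<in> I"
        have "y k * 2 powr (P * k) = w k * 2 powr k"
        proof -
          have "y k * 2 powr (P * k) = w k * (2 powr ((1 - P) * k) * 2 powr (P * k))"
            using w(3)[of k] by (simp add: mult_ac)
          also have "2 powr ((1 - P) * k) * 2 powr (P * k) = 2 powr real_of_int k"
            unfolding powr_add[symmetric] by (simp add: algebra_simps)
          finally show ?thesis .
        qed
        then have "y k * (2 powr (P * k) * a k) = 4 * (w k * (a k * 2 powr k / 4))" by simp
        then have "ennreal (y k) * (ennreal (2 powr (P * k)) * rearrangement h (2 powr k))
            = 4 * (ennreal (w k) * ennreal (a k * 2 powr k / 4))"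
          using y(1) w(1) a(2) ennreal_mult[of 4 "w k * (a k * 2 powr k / 4)"] unfolding a(1)
          by (simp flip: ennreal_mult del: times_divide_eq_right times_divide_eq_left)
        also have "\<dots> \<le> 4 * (ennreal (w k) * (ennreal (a k / 2) * emeasure lebesgue (F k)))"
          by (intro mult_left_mono F) auto
        finally show "ennreal (y k) * (ennreal (2 powr (P * k)) * rearrangement h (2 powr k))
           \<le> 4 * (ennreal (w k) * (ennreal (a k / 2) * emeasure lebesgue (F k)))" .
      qed
      ultimately show ?thesis by (rule order.trans[rotated])
    qed
    define \<nu> where "\<nu> = (\<Sum>k\<in>I. y k powr enn2real q') powr (1 / enn2real q')"
    have \<nu>: "seq_norm q' (\<lambda>k. ennreal (y k)) = ennreal \<nu>"
      unfolding \<nu>_def by (rule seq_norm_finite_support) (use conj.q conj.q_pos I y in auto)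
    have "0 \<le> \<nu>" unfolding \<nu>_def by simp
    have nb: "lorentz_norm p' q' b \<le> ennreal (4 * G * \<nu>)"
    proof -
      have "dyadic_norm (1 - P) q' b \<le> ennreal G * seq_norm q' (\<lambda>k. ennreal (2 powr ((1 - P) * k) * w k))"
        unfolding G_def
        by (rule dyadic_norm_step_function[OF _ conj.conj_pair_q b I, where F=F])
           (use P w F bv in \<open>auto simp: v_def\<close>)
      then have "4 * dyadic_norm (1 - P) q' b \<le> 4 * (ennreal G * ennreal \<nu>)"
        unfolding w(3) \<nu> by (rule mult_left_mono) simp
      also have "\<dots> = ennreal (4 * G * \<nu>)" using G \<open>0 \<le> \<nu>\<close> by (simp add: ennreal_mult mult.assoc)
      finally show ?thesis using conj.lorentz_norm_le_dyadic[of b] unfolding conj_P by (rule order.trans[rotated])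
    qed
    show "(\<Sum>k\<in>I. ennreal (y k) * (ennreal (2 powr (P * k)) * rearrangement h (2 powr k)))
        \<le> ennreal (16 * G) * K * seq_norm q' (\<lambda>k. ennreal (y k))"
    proof (cases "\<nu> = 0")
      case True
      \<comment> \<open>Normalising by d is impossible here, but a vanishing norm forces the test
        sequence to vanish.\<close>
      have "y k = 0" for k
        using le_seq_norm[OF conj.q_pos, of "\<lambda>k. ennreal (y k)" k] y(1)[of k] by (simp add: \<nu> True)
      then show ?thesis by simp
    next
      case False
      \<comment> \<open>The upper bound just proved for the conjugate norm of b; dividing by it
        makes b admissible in the hypothesis.\<close>
      define d where "d = 4 * G * \<nu>"
      have d: "0 < d" unfolding d_def using G \<open>0 \<le> \<nu>\<close> False by simp
      define b' where "b' x = complex_of_real (1 / d) * b x" for x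
      have fb': "f x * b' x = complex_of_real (1 / d * (norm (f x) * v x))" for x
        unfolding b'_def using fb[of x] by (simp add: mult_ac)
      have "(\<integral>\<^sup>+x. ennreal (norm (f x * b' x)) \<partial>lebesgue) \<le> K"
      proof (rule le)
        show "b' \<in> borel_measurable lebesgue" unfolding b'_def by measurable
        show "b' x = 0" if "x \<notin> S" for x using vS[OF that] by (simp add: b'_def b_def)
        show "norm (b' x) \<le> 1 / d * (\<Sum>k\<in>I. w k)" for x
          unfolding b'_def using order.trans[OF bv[of x] vB[of x]] d by (simp add: norm_mult norm_divide divide_right_mono)
        show "f x * b' x = complex_of_real (norm (f x * b' x))" for x
        proof -
          have "0 \<le> 1 / d * (norm (f x) * v x)" using v0[of x] d by simp
          then show ?thesis unfolding fb' by (simp only: norm_of_real abs_of_nonneg)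
        qed
        have "lorentz_norm p' q' b' = ennreal (1 / d) * lorentz_norm p' q' b"
          unfolding b'_def using d by (subst conj.lorentz_norm_cmult) (auto simp: norm_divide)
        also have "\<dots> \<le> ennreal (1 / d) * ennreal d" unfolding d_def by (intro mult_left_mono nb) auto
        also have "\<dots> = 1" using d by (simp flip: ennreal_mult)
        finally show "lorentz_norm p' q' b' \<le> 1" .
      qed
      then have "ennreal d * (\<integral>\<^sup>+x. ennreal (norm (f x * b' x)) \<partial>lebesgue) \<le> ennreal d * K"
        by (rule mult_left_mono) simp
      moreover have "(\<integral>\<^sup>+x. ennreal (norm (f x * b x)) \<partial>lebesgue) = ennreal d * (\<integral>\<^sup>+x. ennreal (norm (f x * b' x)) \<partial>lebesgue)"
      proof -
        have "ennreal (norm (f x * b x)) = ennreal d * ennreal (norm (f x * b' x))" for x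
          unfolding b'_def using d by (simp add: norm_mult norm_divide flip: ennreal_mult)
        then show ?thesis unfolding b'_def by (simp add: nn_integral_cmult)
      qed
      ultimately have "4 * (\<integral>\<^sup>+x. ennreal (norm (f x * b x)) \<partial>lebesgue) \<le> 4 * (ennreal d * K)"
        by (intro mult_left_mono) auto
      also have "\<dots> = ennreal (16 * G) * K * ennreal \<nu>"
      proof -
        have "4 * ennreal d = ennreal (16 * G) * ennreal \<nu>"
          using G \<open>0 \<le> \<nu>\<close> ennreal_mult[of 4 d] ennreal_mult[of "16 * G" \<nu>] by (simp add: d_def mult.assoc)
        then show ?thesis unfolding mult.assoc[symmetric] by (simp only: mult_ac)
      qed
      finally show ?thesis unfolding \<nu> by (rule order.trans[OF pairing])
    qed
  qed
  then have "4 * dyadic_norm P q h \<le> 4 * (ennreal (16 * G) * K)" by (rule mult_left_mono) simp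
  also have "\<dots> = ennreal converse_const * K"
    using ennreal_mult[of 4 "16 * G"] G by (simp add: converse_const_def G_def flip: mult.assoc)
  finally show ?thesis using lorentz_norm_le_dyadic[of h] unfolding h_def[abs_def] by (rule order.trans[rotated])
qed

end

subsection \<open>Representations by blocks\<close>

lemma has_sum_L1_loc_cmult:
  fixes f :: "real^'n \<Rightarrow> complex" and u :: "'i \<Rightarrow> real^'n \<Rightarrow> complex"
  assumes [measurable]: "f \<in> borel_measurable lebesgue" "\<And>i. u i \<in> borel_measurable lebesgue"
    and sum: "has_sum_L1_loc u f"
  shows "has_sum_L1_loc (\<lambda>i x. a * u i x) (\<lambda>x. a * f x)"
  unfolding has_sum_L1_loc_def
proof (intro allI impI)
  fix K :: "(real^'n) set" assume K: "compact K"
  then have [measurable]: "K \<in> sets lebesgue" by (simp add: borel_compact)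
  have "((\<lambda>F. ennreal (norm a) * (\<integral>\<^sup>+x\<in>K. ennreal (norm (f x - (\<Sum>i\<in>F. u i x))) \<partial>lebesgue)) \<longlongrightarrow> ennreal (norm a) * 0)
     (finite_subsets_at_top UNIV)"
    using sum K unfolding has_sum_L1_loc_def by (intro ennreal_tendsto_cmult) auto
  moreover have "ennreal (norm a) * (\<integral>\<^sup>+x\<in>K. ennreal (norm (f x - (\<Sum>i\<in>F. u i x))) \<partial>lebesgue)
      = (\<integral>\<^sup>+x\<in>K. ennreal (norm (a * f x - (\<Sum>i\<in>F. a * u i x))) \<partial>lebesgue)" for F
    by (subst nn_integral_cmult[symmetric])
      (auto simp: norm_mult ennreal_mult mult.assoc simp flip: sum_distrib_left right_diff_distrib)
  ultimately show "((\<lambda>F. \<integral>\<^sup>+x\<in>K. ennreal (norm (a * f x - (\<Sum>i\<in>F. a * u i x))) \<partial>lebesgue) \<longlongrightarrow> 0)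
     (finite_subsets_at_top UNIV)" by simp
qed

lemma has_sum_L1_loc_add:
  fixes f g :: "real^'n \<Rightarrow> complex" and u v :: "'i \<Rightarrow> real^'n \<Rightarrow> complex"
  assumes [measurable]: "f \<in> borel_measurable lebesgue" "\<And>i. u i \<in> borel_measurable lebesgue"
      "g \<in> borel_measurable lebesgue" "\<And>i. v i \<in> borel_measurable lebesgue"
    and sum: "has_sum_L1_loc u f" "has_sum_L1_loc v g"
  shows "has_sum_L1_loc (\<lambda>i x. u i x + v i x) (\<lambda>x. f x + g x)"
  unfolding has_sum_L1_loc_def
proof (intro allI impI)
  fix K :: "(real^'n) set" assume K: "compact K"
  then have [measurable]: "K \<in> sets lebesgue" by (simp add: borel_compact)
  define X where "X F = (\<integral>\<^sup>+x\<in>K. ennreal (norm (f x - (\<Sum>i\<in>F. u i x))) \<partial>lebesgue)" for F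
  define Y where "Y F = (\<integral>\<^sup>+x\<in>K. ennreal (norm (g x - (\<Sum>i\<in>F. v i x))) \<partial>lebesgue)" for F
  have lim: "((\<lambda>F. X F + Y F) \<longlongrightarrow> 0) (finite_subsets_at_top UNIV)"
    using tendsto_add[of X 0 _ Y 0] sum K unfolding has_sum_L1_loc_def X_def Y_def by simp
  have "(\<integral>\<^sup>+x\<in>K. ennreal (norm (f x + g x - (\<Sum>i\<in>F. u i x + v i x))) \<partial>lebesgue) \<le> X F + Y F" for F
  proof -
    have "(\<integral>\<^sup>+x\<in>K. ennreal (norm (f x + g x - (\<Sum>i\<in>F. u i x + v i x))) \<partial>lebesgue)
      \<le> (\<integral>\<^sup>+x. ennreal (norm (f x - (\<Sum>i\<in>F. u i x))) * indicator K x
          + ennreal (norm (g x - (\<Sum>i\<in>F. v i x))) * indicator K x \<partial>lebesgue)"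
    proof (intro nn_integral_mono)
      fix x
      have "norm (f x + g x - (\<Sum>i\<in>F. u i x + v i x)) \<le> norm (f x - (\<Sum>i\<in>F. u i x)) + norm (g x - (\<Sum>i\<in>F. v i x))"
        using norm_triangle_ineq[of "f x - (\<Sum>i\<in>F. u i x)" "g x - (\<Sum>i\<in>F. v i x)"]
        by (simp add: sum.distrib algebra_simps)
      then show "ennreal (norm (f x + g x - (\<Sum>i\<in>F. u i x + v i x))) * indicator K x \<le>
          ennreal (norm (f x - (\<Sum>i\<in>F. u i x))) * indicator K x
          + ennreal (norm (g x - (\<Sum>i\<in>F. v i x))) * indicator K x"
        by (auto simp: indicator_def simp flip: ennreal_plus intro!: ennreal_leI)
    qed
    also have "\<dots> = X F + Y F" unfolding X_def Y_def by (intro nn_integral_add) measurable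
    finally show ?thesis .
  qed
  then show "((\<lambda>F. \<integral>\<^sup>+x\<in>K. ennreal (norm (f x + g x - (\<Sum>i\<in>F. u i x + v i x))) \<partial>lebesgue) \<longlongrightarrow> 0)
     (finite_subsets_at_top UNIV)"
    by (intro tendsto_sandwich[OF _ _ tendsto_const lim] always_eventually) auto
qed

lemma has_sum_L1_loc_finite:
  fixes u :: "'i \<Rightarrow> real^'n \<Rightarrow> complex"
  assumes "finite I" "\<And>i. i \<notin> I \<Longrightarrow> u i = (\<lambda>x. 0)"
  shows "has_sum_L1_loc u (\<lambda>x. \<Sum>i\<in>I. u i x)"
  unfolding has_sum_L1_loc_def
proof (intro allI impI)
  fix K :: "(real^'n) set"
  have "(\<integral>\<^sup>+x\<in>K. ennreal (norm ((\<Sum>i\<in>I. u i x) - (\<Sum>i\<in>F. u i x))) \<partial>lebesgue) = 0"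
    if "finite F" "I \<subseteq> F" for F
  proof -
    have "(\<Sum>i\<in>F. u i x) = (\<Sum>i\<in>I. u i x)" for x
      using that assms(2) by (intro sum.mono_neutral_right) auto
    then show ?thesis by simp
  qed
  then have "eventually (\<lambda>F. (\<integral>\<^sup>+x\<in>K. ennreal (norm ((\<Sum>i\<in>I. u i x) - (\<Sum>i\<in>F. u i x))) \<partial>lebesgue) = 0)
      (finite_subsets_at_top UNIV)"
    using assms(1) unfolding eventually_finite_subsets_at_top by auto
  then show "((\<lambda>F. \<integral>\<^sup>+x\<in>K. ennreal (norm ((\<Sum>i\<in>I. u i x) - (\<Sum>i\<in>F. u i x))) \<partial>lebesgue) \<longlongrightarrow> 0)
     (finite_subsets_at_top UNIV)"
    by (rule tendsto_eventually)
qed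

text \<open>For finite sets containing G the error integrals of both sums coincide, so the two nets
  eventually agree.\<close>

lemma has_sum_L1_loc_tail:
  fixes f :: "real^'n \<Rightarrow> complex" and u :: "'i \<Rightarrow> real^'n \<Rightarrow> complex"
  assumes sum: "has_sum_L1_loc u f" and G: "finite G"
  shows "has_sum_L1_loc (\<lambda>i x. if i \<in> G then 0 else u i x) (\<lambda>x. f x - (\<Sum>i\<in>G. u i x))"
  unfolding has_sum_L1_loc_def
proof (intro allI impI)
  fix K :: "(real^'n) set" assume K: "compact K"
  have "(\<integral>\<^sup>+x\<in>K. ennreal (norm (f x - (\<Sum>i\<in>G. u i x) - (\<Sum>i\<in>F. if i \<in> G then 0 else u i x))) \<partial>lebesgue)
     = (\<integral>\<^sup>+x\<in>K. ennreal (norm (f x - (\<Sum>i\<in>F. u i x))) \<partial>lebesgue)"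
    if "finite F" "G \<subseteq> F" for F
  proof -
    have "(\<Sum>i\<in>F. u i x) = (\<Sum>i\<in>G. u i x) + (\<Sum>i\<in>F. if i \<in> G then 0 else u i x)" for x
    proof -
      have "(\<Sum>i\<in>F. if i \<in> G then 0 else u i x) = (\<Sum>i\<in>F - G. u i x)"
        using that by (intro sum.mono_neutral_cong_right) auto
      then show ?thesis using that by (simp add: sum.subset_diff[of G F])
    qed
    then show ?thesis by (simp add: algebra_simps)
  qed
  then have "eventually (\<lambda>F. (\<integral>\<^sup>+x\<in>K. ennreal (norm (f x - (\<Sum>i\<in>F. u i x))) \<partial>lebesgue) =
      (\<integral>\<^sup>+x\<in>K. ennreal (norm (f x - (\<Sum>i\<in>G. u i x) - (\<Sum>i\<in>F. if i \<in> G then 0 else u i x))) \<partial>lebesgue))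
      (finite_subsets_at_top UNIV)"
    using G unfolding eventually_finite_subsets_at_top by (intro exI[of _ G]) auto
  moreover have "((\<lambda>F. \<integral>\<^sup>+x\<in>K. ennreal (norm (f x - (\<Sum>i\<in>F. u i x))) \<partial>lebesgue) \<longlongrightarrow> 0)
     (finite_subsets_at_top UNIV)"
    using sum K unfolding has_sum_L1_loc_def by blast
  ultimately show "((\<lambda>F. \<integral>\<^sup>+x\<in>K. ennreal (norm (f x - (\<Sum>i\<in>G. u i x)
      - (\<Sum>i\<in>F. if i \<in> G then 0 else u i x))) \<partial>lebesgue) \<longlongrightarrow> 0) (finite_subsets_at_top UNIV)"
    by (rule Lim_transform_eventually[rotated])
qed

lemma borel_measurable_nn_integral_count_space:
  fixes u :: "'i::countable \<Rightarrow> 'a \<Rightarrow> ennreal"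
  assumes u: "\<And>i. u i \<in> borel_measurable M"
  shows "(\<lambda>x. \<integral>\<^sup>+i. u i x \<partial>count_space UNIV) \<in> borel_measurable M"
proof -
  interpret sigma_finite_measure "count_space UNIV :: 'i measure" by (rule sigma_finite_measure_count_space)
  have "(\<lambda>z. u (snd z) (fst z)) \<in> borel_measurable (M \<Otimes>\<^sub>M count_space UNIV)"
    by (rule measurable_compose_countable'[where f="\<lambda>i z. u i (fst z)" and I=UNIV])
       (auto intro: measurable_compose[OF measurable_fst u])
  then show ?thesis by (intro borel_measurable_nn_integral) (simp add: split_def)
qed

text \<open>For every finite F the positive part of |f| - G is at most |f - (partial sum over F)|.
  Its integral over a ball is therefore 0 in the limit, and no almost everywhere convergent
  subsequence has to be extracted.\<close>

lemma has_sum_L1_loc_dominated: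
  fixes u :: "'i::countable \<Rightarrow> real^'n \<Rightarrow> complex"
  assumes [measurable]: "f \<in> borel_measurable lebesgue" "\<And>i. u i \<in> borel_measurable lebesgue"
    and sum: "has_sum_L1_loc u f"
  shows "AE x in lebesgue. ennreal (norm (f x)) \<le> (\<integral>\<^sup>+i. ennreal (norm (u i x)) \<partial>count_space UNIV)"
proof -
  define G where "G x = (\<integral>\<^sup>+i. ennreal (norm (u i x)) \<partial>count_space UNIV)" for x
  have G [measurable]: "G \<in> borel_measurable lebesgue"
    unfolding G_def by (intro borel_measurable_nn_integral_count_space) measurable
  have "AE x in lebesgue. x \<in> cball 0 (real N) \<longrightarrow> ennreal (norm (f x)) \<le> G x" for N
  proof -
    let ?K = "cball 0 (real N) :: (real^'n) set"
    have [measurable]: "?K \<in> sets lebesgue" by (simp add: borel_compact)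
    \<comment> \<open>Subtraction in \<open>ennreal\<close> is truncated at 0, so the left integrand
      is the positive part, also where G is infinite.\<close>
    have "(\<integral>\<^sup>+x. (ennreal (norm (f x)) - G x) * indicator ?K x \<partial>lebesgue)
        \<le> (\<integral>\<^sup>+x\<in>?K. ennreal (norm (f x - (\<Sum>i\<in>F. u i x))) \<partial>lebesgue)" if "finite F" for F
    proof (intro nn_integral_mono mult_right_mono)
      fix x
      have "ennreal (norm (\<Sum>i\<in>F. u i x)) \<le> ennreal (\<Sum>i\<in>F. norm (u i x))" by (intro ennreal_leI norm_sum)
      also have "\<dots> = (\<Sum>i\<in>F. ennreal (norm (u i x)))" by simp
      also have "\<dots> \<le> G x"
        unfolding G_def infsum_eq_nn_integral_count_space[symmetric]
        by (subst nonneg_infsum_complete) (use that in \<open>auto intro!: SUP_upper\<close>)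
      finally have 1: "ennreal (norm (\<Sum>i\<in>F. u i x)) \<le> G x" .
      have "norm (f x) \<le> norm (f x - (\<Sum>i\<in>F. u i x)) + norm (\<Sum>i\<in>F. u i x)"
        using norm_triangle_ineq[of "f x - (\<Sum>i\<in>F. u i x)" "\<Sum>i\<in>F. u i x"] by simp
      then have "ennreal (norm (f x)) \<le> ennreal (norm (f x - (\<Sum>i\<in>F. u i x))) + ennreal (norm (\<Sum>i\<in>F. u i x))"
        by (simp flip: ennreal_plus)
      also have "\<dots> \<le> ennreal (norm (f x - (\<Sum>i\<in>F. u i x))) + G x" by (intro add_left_mono 1)
      finally show "ennreal (norm (f x)) - G x \<le> ennreal (norm (f x - (\<Sum>i\<in>F. u i x)))"
        by (simp add: ennreal_minus_le_iff add.commute)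
    qed simp
    then have ev: "eventually (\<lambda>F. (\<integral>\<^sup>+x. (ennreal (norm (f x)) - G x) * indicator ?K x \<partial>lebesgue)
        \<le> (\<integral>\<^sup>+x\<in>?K. ennreal (norm (f x - (\<Sum>i\<in>F. u i x))) \<partial>lebesgue)) (finite_subsets_at_top UNIV)"
      unfolding eventually_finite_subsets_at_top by blast
    have "((\<lambda>F. \<integral>\<^sup>+x\<in>?K. ennreal (norm (f x - (\<Sum>i\<in>F. u i x))) \<partial>lebesgue) \<longlongrightarrow> 0) (finite_subsets_at_top UNIV)"
      using sum compact_cball unfolding has_sum_L1_loc_def by blast
    from tendsto_lowerbound[OF this ev]
    have "(\<integral>\<^sup>+x. (ennreal (norm (f x)) - G x) * indicator ?K x \<partial>lebesgue) = 0" by simp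
    then have "AE x in lebesgue. (ennreal (norm (f x)) - G x) * indicator ?K x = 0"
      by (subst (asm) nn_integral_0_iff_AE) auto
    then show ?thesis
    proof eventually_elim
      case (elim x)
      then show ?case by (auto simp: diff_eq_0_iff_ennreal)
    qed
  qed
  then have "AE x in lebesgue. \<forall>N. x \<in> cball 0 (real N) \<longrightarrow> ennreal (norm (f x)) \<le> G x"
    by (subst AE_all_countable) simp
  then show ?thesis
  proof eventually_elim
    case (elim x)
    obtain N where "norm x \<le> real N" using real_arch_simple by blast
    then have "x \<in> cball 0 (real N)" by simp
    then show ?case using elim unfolding G_def by blast
  qed
qed

text \<open>The pointwise domination and Tonelli bound the pairing termwise, without any statement
  about convergence of the sum of the products h u i.\<close>

lemma has_sum_L1_loc_pairing:
  fixes u :: "'i::countable \<Rightarrow> real^'n \<Rightarrow> complex"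
  assumes [measurable]: "f \<in> borel_measurable lebesgue" "\<And>i. u i \<in> borel_measurable lebesgue"
    "h \<in> borel_measurable lebesgue" and sum: "has_sum_L1_loc u f"
  shows "(\<integral>\<^sup>+x. ennreal (norm (h x * f x)) \<partial>lebesgue)
     \<le> (\<integral>\<^sup>+i. (\<integral>\<^sup>+x. ennreal (norm (h x * u i x)) \<partial>lebesgue) \<partial>count_space UNIV)"
proof -
  have "(\<integral>\<^sup>+x. ennreal (norm (h x * f x)) \<partial>lebesgue)
      \<le> (\<integral>\<^sup>+x. (\<integral>\<^sup>+i. ennreal (norm (h x * u i x)) \<partial>count_space UNIV) \<partial>lebesgue)"
  proof (rule nn_integral_mono_AE)
    show "AE x in lebesgue. ennreal (norm (h x * f x)) \<le> (\<integral>\<^sup>+i. ennreal (norm (h x * u i x)) \<partial>count_space UNIV)"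
      using has_sum_L1_loc_dominated[OF assms(1,2) sum]
    proof eventually_elim
      case (elim x)
      then have "ennreal (norm (h x)) * ennreal (norm (f x))
          \<le> ennreal (norm (h x)) * (\<integral>\<^sup>+i. ennreal (norm (u i x)) \<partial>count_space UNIV)"
        by (rule mult_left_mono) simp
      then show ?case by (simp add: norm_mult ennreal_mult nn_integral_cmult)
    qed
  qed
  also have "\<dots> = (\<integral>\<^sup>+i. (\<integral>\<^sup>+x. ennreal (norm (h x * u i x)) \<partial>lebesgue) \<partial>count_space UNIV)"
    by (intro nn_integral_count_space_nn_integral) auto
  finally show ?thesis .
qed

section \<open>Block norms for a general gauge\<close>

definition cube_weight :: "real \<Rightarrow> int \<times> (int^'n) \<Rightarrow> real" where
  "cube_weight e i = measure lebesgue (dyadic_cube i :: (real^'n) set) powr e"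

lemma cube_weight_pos: "0 < cube_weight e i"
  using measure_dyadic_cube_pos[of i] by (simp add: cube_weight_def)

text \<open>The gauge \<sigma> is instantiated twice: by the conjugate Lorentz quasi-norm, which
  gives the blocks of the statement, and by the associate norm, which gives the sublinear block norm
  used for Hahn-Banach.\<close>

definition gen_block ::
    "((real^'n \<Rightarrow> complex) \<Rightarrow> ennreal) \<Rightarrow> real \<Rightarrow> int \<times> (int^'n) \<Rightarrow> (real^'n \<Rightarrow> complex) \<Rightarrow> bool" where
  "gen_block \<sigma> e i b \<longleftrightarrow> b \<in> borel_measurable lebesgue \<and> (\<forall>x. x \<notin> dyadic_cube i \<longrightarrow> b x = 0) \<and>
     \<sigma> b \<le> ennreal (cube_weight e i)"

definition gen_representation ::
    "((real^'n \<Rightarrow> complex) \<Rightarrow> ennreal) \<Rightarrow> real \<Rightarrow> ennreal \<Rightarrow> (real^'n \<Rightarrow> complex) \<Rightarrow>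
     (int \<times> (int^'n) \<Rightarrow> complex) \<Rightarrow> (int \<times> (int^'n) \<Rightarrow> real^'n \<Rightarrow> complex) \<Rightarrow> bool" where
  "gen_representation \<sigma> e s g c b \<longleftrightarrow> lseq_norm s c < \<infinity> \<and> (\<forall>i. gen_block \<sigma> e i (b i)) \<and>
     has_sum_L1_loc (\<lambda>i x. c i * b i x) g"

definition gen_norm ::
    "((real^'n \<Rightarrow> complex) \<Rightarrow> ennreal) \<Rightarrow> real \<Rightarrow> ennreal \<Rightarrow> (real^'n \<Rightarrow> complex) \<Rightarrow> ennreal" where
  "gen_norm \<sigma> e s g = Inf {lseq_norm s c | c. \<exists>b. gen_representation \<sigma> e s g c b}"

lemma gen_representation_block:
  assumes "gen_representation \<sigma> e s g c b" shows "gen_block \<sigma> e i (b i)"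
  using assms unfolding gen_representation_def by blast

lemma gen_block_measurable: "gen_block \<sigma> e i b \<Longrightarrow> b \<in> borel_measurable lebesgue"
  unfolding gen_block_def by blast

lemma block_representation_eq_gen:
  "block_representation p q t s = gen_representation (lorentz_norm p q) (1 / enn2real p - 1 / enn2real t) s"
  by (simp add: block_representation_def gen_representation_def gen_block_def is_block_def cube_weight_def fun_eq_iff)

lemma block_norm_eq_gen:
  "block_norm p q t s = gen_norm (lorentz_norm p q) (1 / enn2real p - 1 / enn2real t) s"
  by (simp add: block_norm_def gen_norm_def block_representation_eq_gen fun_eq_iff)

lemma gen_norm_le: "gen_representation \<sigma> e s g c b \<Longrightarrow> gen_norm \<sigma> e s g \<le> lseq_norm s c"
  unfolding gen_norm_def by (rule Inf_lower) auto

lemma gen_norm_finite: "gen_representation \<sigma> e s g c b \<Longrightarrow> gen_norm \<sigma> e s g < top"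
  using gen_norm_le[of \<sigma> e s g c b] by (auto simp: gen_representation_def intro: le_less_trans)

lemma gen_norm_greatest:
  "(\<And>c b. gen_representation \<sigma> e s g c b \<Longrightarrow> K \<le> lseq_norm s c) \<Longrightarrow> K \<le> gen_norm \<sigma> e s g"
  unfolding gen_norm_def by (rule Inf_greatest) auto

lemma lseq_norm_cmult:
  assumes "0 < s"
  shows "lseq_norm s (\<lambda>i :: int \<times> (int^'n). a * c i) = ennreal (norm a) * lseq_norm s c"
  unfolding lseq_norm_eq by (simp add: norm_mult ennreal_mult seq_norm_cmult[OF assms])

text \<open>The constant \<kappa> is the quasi-triangle constant of the gauge, and the block norm
  inherits exactly this constant: 32 for the Lorentz gauge, 1 for the associate norm.\<close>

locale block_gauge =
  fixes \<sigma> :: "(real^'n \<Rightarrow> complex) \<Rightarrow> ennreal" and \<kappa> e :: real and s s' :: ennreal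
  assumes gauge_cmult: "f \<in> borel_measurable lebesgue \<Longrightarrow> \<sigma> (\<lambda>x. a * f x) = ennreal (norm a) * \<sigma> f"
    and gauge_add: "f \<in> borel_measurable lebesgue \<Longrightarrow> g \<in> borel_measurable lebesgue \<Longrightarrow>
      \<sigma> (\<lambda>x. f x + g x) \<le> ennreal \<kappa> * (\<sigma> f + \<sigma> g)"
    and kappa: "0 < \<kappa>" and conj_s: "conj_pair s s'"
begin

abbreviation "rep \<equiv> gen_representation \<sigma> e s"
abbreviation "N \<equiv> gen_norm \<sigma> e s"

lemma gauge_zero: "\<sigma> (\<lambda>x. 0) = 0"
  using gauge_cmult[of "\<lambda>x. 0" 0] by simp

lemma s_pos: "0 < s"
  using conj_pair_pos[OF conj_s] .

text \<open>Normalising each u i by A i turns it into a block. Where A i = 0, division gives 0,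
  which is why u i is required to vanish there.\<close>

lemma rep_family:
  fixes A :: "int \<times> (int^'n) \<Rightarrow> real"
  assumes u: "\<And>i. u i \<in> borel_measurable lebesgue" "\<And>i x. x \<notin> dyadic_cube i \<Longrightarrow> u i x = 0"
    and A: "\<And>i. 0 \<le> A i" "\<And>i. \<sigma> (u i) \<le> ennreal (A i) * ennreal (cube_weight e i)"
      "\<And>i x. A i = 0 \<Longrightarrow> u i x = 0" "lseq_norm s (\<lambda>i. complex_of_real (A i)) < top"
    and sum: "has_sum_L1_loc u g"
  shows "rep g (\<lambda>i. complex_of_real (A i)) (\<lambda>i x. complex_of_real (1 / A i) * u i x)"
  unfolding gen_representation_def
proof (intro conjI allI)
  have "(\<lambda>i x. complex_of_real (A i) * (complex_of_real (1 / A i) * u i x)) = u"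
    using A(3) by (auto simp: fun_eq_iff)
  then show "has_sum_L1_loc (\<lambda>i x. complex_of_real (A i) * (complex_of_real (1 / A i) * u i x)) g" using sum by simp
  show "gen_block \<sigma> e i (\<lambda>x. complex_of_real (1 / A i) * u i x)" for i
    unfolding gen_block_def
  proof (intro conjI allI impI)
    show "(\<lambda>x. complex_of_real (1 / A i) * u i x) \<in> borel_measurable lebesgue" using u(1)[of i] by measurable
    show "complex_of_real (1 / A i) * u i x = 0" if "x \<notin> dyadic_cube i" for x using u(2)[OF that] by simp
    show "\<sigma> (\<lambda>x. complex_of_real (1 / A i) * u i x) \<le> ennreal (cube_weight e i)"
    proof (cases "A i = 0")
      case False
      then have Ai: "0 < A i" using A(1)[of i] by simp
      have "\<sigma> (\<lambda>x. complex_of_real (1 / A i) * u i x) = ennreal (1 / A i) * \<sigma> (u i)"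
        using Ai by (subst gauge_cmult[OF u(1)]) (simp add: norm_divide)
      also have "\<dots> \<le> ennreal (1 / A i) * (ennreal (A i) * ennreal (cube_weight e i))"
        by (intro mult_left_mono A) auto
      also have "\<dots> = ennreal (cube_weight e i)"
        using Ai by (simp flip: mult.assoc ennreal_mult)
      finally show ?thesis .
    qed (simp add: gauge_zero)
  qed
qed (use A in auto)

lemma rep_cmult:
  assumes "rep g c b" "g \<in> borel_measurable lebesgue"
  shows "rep (\<lambda>x. a * g x) (\<lambda>i. a * c i) b"
proof -
  have "has_sum_L1_loc (\<lambda>i x. a * (c i * b i x)) (\<lambda>x. a * g x)"
    using assms gen_block_measurable[OF gen_representation_block[OF assms(1)]]
    by (intro has_sum_L1_loc_cmult borel_measurable_times) (auto simp: gen_representation_def)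
  then show ?thesis using assms
    by (simp add: gen_representation_def lseq_norm_cmult[OF s_pos] ennreal_mult_less_top mult.assoc)
qed

text \<open>Both representations use one block per cube, so they are merged cube by cube with
  coefficients \<kappa> (|c i| + |d i|); the triangle inequality for sequences does the
  rest.\<close>

lemma rep_add:
  assumes g: "rep g c b" "g \<in> borel_measurable lebesgue" and h: "rep h d b'" "h \<in> borel_measurable lebesgue"
  shows "\<exists>c'' b''. rep (\<lambda>x. g x + h x) c'' b'' \<and> lseq_norm s c'' \<le> ennreal \<kappa> * (lseq_norm s c + lseq_norm s d)"
proof -
  define A where "A i = \<kappa> * (norm (c i) + norm (d i))" for i
  define u where "u i x = c i * b i x + d i * b' i x" for i x
  have blk: "gen_block \<sigma> e i (b i)" "gen_block \<sigma> e i (b' i)" for i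
    using g h by (auto intro: gen_representation_block)
  have "(\<lambda>i. ennreal (norm (complex_of_real (A i)))) = (\<lambda>i. ennreal \<kappa> * (ennreal (norm (c i)) + ennreal (norm (d i))))"
  proof
    fix i
    have "0 \<le> A i" using kappa by (simp add: A_def)
    then have "ennreal (norm (complex_of_real (A i))) = ennreal (\<kappa> * (norm (c i) + norm (d i)))"
      by (simp add: A_def[symmetric])
    also have "\<dots> = ennreal \<kappa> * (ennreal (norm (c i)) + ennreal (norm (d i)))"
      using kappa by (simp add: ennreal_mult)
    finally show "ennreal (norm (complex_of_real (A i))) = ennreal \<kappa> * (ennreal (norm (c i)) + ennreal (norm (d i)))" .
  qed
  then have A: "lseq_norm s (\<lambda>i. complex_of_real (A i)) \<le> ennreal \<kappa> * (lseq_norm s c + lseq_norm s d)"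
    unfolding lseq_norm_eq using seq_norm_triangle[OF conj_s]
    by (simp only: seq_norm_cmult[OF s_pos]) (intro mult_left_mono; simp)
  also have "\<dots> < top" using g h by (simp add: gen_representation_def ennreal_mult_less_top)
  finally have Afin: "lseq_norm s (\<lambda>i. complex_of_real (A i)) < top" .
  have "rep (\<lambda>x. g x + h x) (\<lambda>i. complex_of_real (A i)) (\<lambda>i x. complex_of_real (1 / A i) * u i x)"
  proof (rule rep_family)
    show "u i \<in> borel_measurable lebesgue" for i
      unfolding u_def using blk[of i] by (auto simp: gen_block_def)
    show "u i x = 0" if "x \<notin> dyadic_cube i" for i x using blk[of i] that by (auto simp: gen_block_def u_def)
    show "0 \<le> A i" for i using kappa by (simp add: A_def)
    show "u i x = 0" if "A i = 0" for i x
    proof -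
      have "norm (c i) + norm (d i) = 0" using that kappa by (simp add: A_def)
      then have "c i = 0" "d i = 0" using norm_ge_zero[of "c i"] norm_ge_zero[of "d i"] by (smt (verit) norm_eq_zero)+
      then show ?thesis by (simp add: u_def)
    qed
    show "has_sum_L1_loc u (\<lambda>x. g x + h x)"
      unfolding u_def[abs_def] using g h gen_block_measurable[OF blk(1)] gen_block_measurable[OF blk(2)]
      by (intro has_sum_L1_loc_add borel_measurable_times) (auto simp: gen_representation_def)
    show "\<sigma> (u i) \<le> ennreal (A i) * ennreal (cube_weight e i)" for i
    proof -
      have [measurable]: "b i \<in> borel_measurable lebesgue" "b' i \<in> borel_measurable lebesgue"
        using blk[of i] by (auto simp: gen_block_def)
      have "\<sigma> (u i) \<le> ennreal \<kappa> * (\<sigma> (\<lambda>x. c i * b i x) + \<sigma> (\<lambda>x. d i * b' i x))"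
        unfolding u_def[abs_def] by (intro gauge_add) measurable
      also have "\<dots> \<le> ennreal \<kappa> * (ennreal (norm (c i)) * ennreal (cube_weight e i) + ennreal (norm (d i)) * ennreal (cube_weight e i))"
        using blk[of i] by (simp add: gauge_cmult gen_block_def) (intro mult_left_mono add_mono; simp)
      also have "\<dots> = ennreal (A i) * ennreal (cube_weight e i)"
        using kappa by (simp add: A_def ennreal_mult distrib_right mult.assoc distrib_left)
      finally show ?thesis .
    qed
  qed (rule Afin)
  then show ?thesis using A by blast
qed

lemma rep_tail:
  assumes "rep g c b" "finite G"
  shows "rep (\<lambda>x. g x - (\<Sum>i\<in>G. c i * b i x)) (\<lambda>i. if i \<in> G then 0 else c i) b"
proof -
  have "(\<lambda>i x. (if i \<in> G then 0 else c i) * b i x) = (\<lambda>i x. if i \<in> G then 0 else c i * b i x)"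
    by (auto simp: fun_eq_iff)
  moreover have "lseq_norm s (\<lambda>i. if i \<in> G then 0 else c i) \<le> lseq_norm s c"
    unfolding lseq_norm_eq by (rule seq_norm_mono) auto
  ultimately show ?thesis
    using assms has_sum_L1_loc_tail[of "\<lambda>i x. c i * b i x" g G] by (auto simp: gen_representation_def)
qed

lemma rep_finite:
  assumes I: "finite I" and b: "\<And>i. i \<in> I \<Longrightarrow> gen_block \<sigma> e i (b i)"
    and c: "\<And>i. i \<notin> I \<Longrightarrow> c i = 0" and fin: "lseq_norm s c < top"
  shows "rep (\<lambda>x. \<Sum>i\<in>I. c i * b i x) c (\<lambda>i. if i \<in> I then b i else (\<lambda>x. 0))"
proof -
  have "has_sum_L1_loc (\<lambda>i x. c i * (if i \<in> I then b i else (\<lambda>x. 0)) x)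
      (\<lambda>x. \<Sum>i\<in>I. c i * (if i \<in> I then b i else (\<lambda>x. 0)) x)"
    by (rule has_sum_L1_loc_finite[OF I]) (simp add: c)
  moreover have "gen_block \<sigma> e i (\<lambda>x. 0)" for i
    by (simp add: gen_block_def gauge_zero)
  ultimately show ?thesis
    using b fin by (auto simp: gen_representation_def)
qed

lemma rep_single:
  assumes u: "u \<in> borel_measurable lebesgue" "\<And>x. x \<notin> dyadic_cube i \<Longrightarrow> u x = 0"
    and A: "0 < A" "\<sigma> u \<le> ennreal A * ennreal (cube_weight e i)"
  shows "\<exists>c b. rep u c b \<and> lseq_norm s c = ennreal A"
proof -
  define c where "c j = (if j = i then complex_of_real A else 0)" for j
  have "(\<lambda>j. ennreal (norm (c j))) = (\<lambda>j. if j = i then ennreal A else 0)"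
    using A by (auto simp: c_def)
  then have c: "lseq_norm s c = ennreal A"
    unfolding lseq_norm_eq by (simp add: seq_norm_single[OF s_pos])
  have "gen_block \<sigma> e i (\<lambda>x. complex_of_real (1 / A) * u x)"
    unfolding gen_block_def
  proof (intro conjI allI impI)
    show "(\<lambda>x. complex_of_real (1 / A) * u x) \<in> borel_measurable lebesgue" using u(1) by measurable
    show "\<sigma> (\<lambda>x. complex_of_real (1 / A) * u x) \<le> ennreal (cube_weight e i)"
    proof -
      have "\<sigma> (\<lambda>x. complex_of_real (1 / A) * u x) = ennreal (1 / A) * \<sigma> u"
        using A by (subst gauge_cmult[OF u(1)]) (simp add: norm_divide)
      also have "\<dots> \<le> ennreal (1 / A) * (ennreal A * ennreal (cube_weight e i))" by (intro mult_left_mono A) auto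
      also have "\<dots> = ennreal (cube_weight e i)" using A by (simp flip: mult.assoc ennreal_mult)
      finally show ?thesis .
    qed
  qed (simp add: u)
  then have "rep (\<lambda>x. \<Sum>j\<in>{i}. c j * (complex_of_real (1 / A) * u x)) c
      (\<lambda>j. if j \<in> {i} then (\<lambda>x. complex_of_real (1 / A) * u x) else (\<lambda>x. 0))"
    by (intro rep_finite[of "{i}" "\<lambda>_ x. complex_of_real (1 / A) * u x"]) (auto simp: c, simp add: c_def)
  moreover have "(\<lambda>x. \<Sum>j\<in>{i}. c j * (complex_of_real (1 / A) * u x)) = u"
    using A by (simp add: c_def)
  ultimately show ?thesis using c by auto
qed

lemma rep_zero: "rep (\<lambda>x. 0) (\<lambda>i. 0) (\<lambda>i x. 0)"
  using rep_finite[of "{}" "\<lambda>_ _. 0" "\<lambda>i. 0"] by (simp add: lseq_norm_eq)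

lemma N_zero: "N (\<lambda>x. 0) = 0"
  using gen_norm_le[OF rep_zero] by (simp add: lseq_norm_eq)

lemma N_cmult:
  assumes g: "g \<in> borel_measurable lebesgue"
  shows "N (\<lambda>x. a * g x) = ennreal (norm a) * N g"
proof (cases "a = 0")
  case False
  have le: "ennreal (norm (inverse a)) * N (\<lambda>x. a * g x) \<le> N g" if "a \<noteq> 0" "g \<in> borel_measurable lebesgue" for a g
  proof (rule gen_norm_greatest)
    fix c b assume "rep g c b"
    from gen_norm_le[OF rep_cmult[OF this that(2), of a]]
    have "ennreal (norm (inverse a)) * N (\<lambda>x. a * g x) \<le> ennreal (norm (inverse a)) * (ennreal (norm a) * lseq_norm s c)"
      unfolding lseq_norm_cmult[OF s_pos] by (rule mult_left_mono) simp
    also have "\<dots> = lseq_norm s c"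
      using that(1) by (simp add: norm_inverse flip: mult.assoc ennreal_mult)
    finally show "ennreal (norm (inverse a)) * N (\<lambda>x. a * g x) \<le> lseq_norm s c" .
  qed
  have ag: "(\<lambda>x. a * g x) \<in> borel_measurable lebesgue" using g by measurable
  have "ennreal (norm a) * N g \<le> N (\<lambda>x. a * g x)"
    using le[of "inverse a" "\<lambda>x. a * g x"] False ag by (simp flip: mult.assoc)
  moreover have "N (\<lambda>x. a * g x) = ennreal (norm a) * (ennreal (norm (inverse a)) * N (\<lambda>x. a * g x))"
    using False by (simp add: norm_inverse flip: mult.assoc ennreal_mult)
  moreover have "\<dots> \<le> ennreal (norm a) * N g" by (intro mult_left_mono le[OF False g]) simp
  ultimately show ?thesis by (metis antisym)
qed (simp add: N_zero)

lemma N_add: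
  assumes g: "g \<in> borel_measurable lebesgue" and h: "h \<in> borel_measurable lebesgue"
  shows "N (\<lambda>x. g x + h x) \<le> ennreal \<kappa> * (N g + N h)"
proof (rule ennreal_le_epsilon)
  fix \<epsilon> :: real assume fin: "ennreal \<kappa> * (N g + N h) < top" and "0 < \<epsilon>"
  \<comment> \<open>Each near-optimal representation loses at most d, and the total loss \<kappa> *
    2 d is \<epsilon>.\<close>
  define d where "d = \<epsilon> / (2 * \<kappa>)"
  have d: "0 < d" unfolding d_def using \<open>0 < \<epsilon>\<close> kappa by simp
  have ex: "\<exists>c b. rep f c b \<and> lseq_norm s c < N f + ennreal d" if "N f < top" for f
  proof -
    have "Inf {lseq_norm s c | c. \<exists>b. rep f c b} < N f + ennreal d"
      unfolding gen_norm_def[symmetric] using that d by (cases "N f") (auto simp flip: ennreal_plus intro!: ennreal_lessI)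
    then show ?thesis unfolding Inf_less_iff by blast
  qed
  have "N g < top" "N h < top"
    using fin kappa by (auto simp: ennreal_mult_less_top)
  then obtain c b c' b' where r: "rep g c b" "lseq_norm s c < N g + ennreal d" "rep h c' b'" "lseq_norm s c' < N h + ennreal d"
    using ex by metis
  obtain c'' b'' where r'': "rep (\<lambda>x. g x + h x) c'' b''" "lseq_norm s c'' \<le> ennreal \<kappa> * (lseq_norm s c + lseq_norm s c')"
    using rep_add[OF r(1) g r(3) h] by blast
  have "N (\<lambda>x. g x + h x) \<le> lseq_norm s c''" by (rule gen_norm_le[OF r''(1)])
  also have "\<dots> \<le> ennreal \<kappa> * (lseq_norm s c + lseq_norm s c')" by (rule r'')
  also have "\<dots> \<le> ennreal \<kappa> * ((N g + ennreal d) + (N h + ennreal d))"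
    using r by (intro mult_left_mono add_mono) (auto intro: less_imp_le)
  also have "\<dots> = ennreal \<kappa> * (N g + N h) + ennreal \<kappa> * (ennreal d + ennreal d)"
    by (simp add: distrib_left add_ac)
  also have "ennreal \<kappa> * (ennreal d + ennreal d) = ennreal \<epsilon>"
    using d kappa by (simp add: d_def field_simps flip: ennreal_plus ennreal_mult)
  finally show "N (\<lambda>x. g x + h x) \<le> ennreal \<kappa> * (N g + N h) + ennreal \<epsilon>" .
qed

end

subsection \<open>Densities of additive set functions\<close>

text \<open>Smallness on sets of small measure gives continuity at the empty set, hence countable
  additivity, and it also makes null sets of M null. Radon-Nikodym then yields a density, which is
  integrable because the total mass is finite.\<close>

lemma nonneg_additive_density:
  fixes \<mu> :: "'a set \<Rightarrow> real"
  assumes "finite_measure M"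
    and nonneg: "\<And>A. A \<in> sets M \<Longrightarrow> 0 \<le> \<mu> A"
    and add: "\<And>A B. A \<in> sets M \<Longrightarrow> B \<in> sets M \<Longrightarrow> A \<inter> B = {} \<Longrightarrow> \<mu> (A \<union> B) = \<mu> A + \<mu> B"
    and small: "\<And>\<epsilon>. 0 < \<epsilon> \<Longrightarrow> \<exists>\<delta>>0. \<forall>A\<in>sets M. measure M A < \<delta> \<longrightarrow> \<mu> A \<le> \<epsilon>"
  shows "\<exists>g. integrable M g \<and> (\<forall>A\<in>sets M. \<mu> A = (\<integral>x. g x * indicator A x \<partial>M))"
proof -
  interpret finite_measure M by fact
  have \<mu>0: "\<mu> {} = 0" using add[of "{}" "{}"] by simp
  have ca: "countably_additive (sets M) (\<lambda>A. ennreal (\<mu> A))"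
  proof (rule sets.empty_continuous_imp_countably_additive)
    show "positive (sets M) (\<lambda>A. ennreal (\<mu> A))" by (simp add: positive_def \<mu>0)
    show "additive (sets M) (\<lambda>A. ennreal (\<mu> A))"
      using add nonneg by (auto simp: additive_def simp flip: ennreal_plus)
    fix A :: "nat \<Rightarrow> 'a set" assume A: "range A \<subseteq> sets M" "decseq A" "(\<Inter>i. A i) = {}"
    have "(\<lambda>i. measure M (A i)) \<longlonglongrightarrow> measure M (\<Inter>i. A i)"
      by (rule finite_Lim_measure_decseq) (use A in auto)
    then have lim: "(\<lambda>i. measure M (A i)) \<longlonglongrightarrow> 0" using A by simp
    have "(\<lambda>i. \<mu> (A i)) \<longlonglongrightarrow> 0"
    proof (rule LIMSEQ_I)
      fix r :: real assume "0 < r"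
      then obtain \<delta> where \<delta>: "0 < \<delta>" "\<And>B. B \<in> sets M \<Longrightarrow> measure M B < \<delta> \<Longrightarrow> \<mu> B \<le> r / 2"
        using small[of "r / 2"] by auto
      obtain n0 where "\<And>n. n \<ge> n0 \<Longrightarrow> norm (measure M (A n) - 0) < \<delta>"
        using LIMSEQ_D[OF lim \<delta>(1)] by blast
      then have "\<And>n. n \<ge> n0 \<Longrightarrow> norm (\<mu> (A n) - 0) < r"
        using \<delta>(2) nonneg A(1) \<open>0 < r\<close> by (force simp: image_subset_iff)
      then show "\<exists>n0. \<forall>n\<ge>n0. norm (\<mu> (A n) - 0) < r" by blast
    qed
    then show "(\<lambda>i. ennreal (\<mu> (A i))) \<longlonglongrightarrow> 0"
      using tendsto_ennrealI by fastforce
  qed auto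
  define N where "N = measure_of (space M) (sets M) (\<lambda>A. ennreal (\<mu> A))"
  have sN: "sets N = sets M" "space N = space M" unfolding N_def by simp_all
  have eN: "emeasure N A = ennreal (\<mu> A)" if "A \<in> sets M" for A
    unfolding N_def using that ca \<mu>0
    by (intro emeasure_measure_of_sigma) (auto simp: positive_def sets.sigma_algebra_axioms)
  have "absolutely_continuous M N"
    unfolding absolutely_continuous_def
  proof
    fix A assume A: "A \<in> null_sets M"
    have "\<mu> A \<le> \<epsilon>" if "0 < \<epsilon>" for \<epsilon>
    proof -
      have "A \<in> sets M" "measure M A = 0" using A by (auto simp: null_sets_def measure_def)
      then show ?thesis using small[OF that] by auto
    qed
    then have "\<mu> A \<le> 0" by (meson dense_ge)
    then show "A \<in> null_sets N" using A eN[of A] by (auto simp: null_sets_def sN ennreal_neg)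
  qed
  from Radon_Nikodym[OF this sN(1)] obtain f where f [measurable]: "f \<in> borel_measurable M" and dN: "density M f = N"
    by blast
  have fA: "(\<integral>\<^sup>+x. f x * indicator A x \<partial>M) = ennreal (\<mu> A)" if "A \<in> sets M" for A
    using emeasure_density[OF f that] eN[OF that] by (simp add: dN)
  have "(\<integral>\<^sup>+x. f x \<partial>M) = (\<integral>\<^sup>+x. f x * indicator (space M) x \<partial>M)"
    by (intro nn_integral_cong) simp
  then have "(\<integral>\<^sup>+x. f x \<partial>M) \<noteq> \<infinity>" using fA[of "space M"] by simp
  then have "AE x in M. f x \<noteq> \<infinity>" by (rule nn_integral_PInf_AE[OF f])
  then have fr: "AE x in M. ennreal (enn2real (f x)) = f x"
    by eventually_elim (simp add: less_top)
  have int: "integrable M (\<lambda>x. enn2real (f x) * indicator A x) \<and> (\<integral>x. enn2real (f x) * indicator A x \<partial>M) = \<mu> A"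
    if A [measurable]: "A \<in> sets M" for A
  proof -
    have "(\<integral>\<^sup>+x. ennreal (enn2real (f x) * indicator A x) \<partial>M) = (\<integral>\<^sup>+x. f x * indicator A x \<partial>M)"
      using fr by (intro nn_integral_cong_AE) (auto elim!: eventually_mono simp: indicator_def)
    also have "\<dots> = ennreal (\<mu> A)" by (rule fA[OF A])
    finally have "(\<integral>\<^sup>+x. ennreal (enn2real (f x) * indicator A x) \<partial>M) = ennreal (\<mu> A)" .
    then have "has_bochner_integral M (\<lambda>x. enn2real (f x) * indicator A x) (\<mu> A)"
      by (intro has_bochner_integral_nn_integral) (use nonneg[OF A] in auto)
    then show ?thesis by (simp add: has_bochner_integral_iff)
  qed
  have "integrable M (\<lambda>x. enn2real (f x) * indicator (space M) x)" using int by blast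
  moreover have "integrable M (\<lambda>x. enn2real (f x) * indicator (space M) x) \<longleftrightarrow> integrable M (\<lambda>x. enn2real (f x))"
    by (intro Bochner_Integration.integrable_cong) auto
  ultimately have "integrable M (\<lambda>x. enn2real (f x))" by simp
  then show ?thesis using int by (intro exI[of _ "\<lambda>x. enn2real (f x)"]) auto
qed

text \<open>A Jordan decomposition by hand: the positive variation vp and the difference vp - \<nu>
  are both nonnegative, additive and small on small sets, so each has a density.\<close>

lemma additive_density:
  fixes \<nu> :: "'a set \<Rightarrow> real"
  assumes M: "finite_measure M"
    and add: "\<And>A B. A \<in> sets M \<Longrightarrow> B \<in> sets M \<Longrightarrow> A \<inter> B = {} \<Longrightarrow> \<nu> (A \<union> B) = \<nu> A + \<nu> B"
    and bound: "\<And>A. A \<in> sets M \<Longrightarrow> \<bar>\<nu> A\<bar> \<le> B"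
    and small: "\<And>\<epsilon>. 0 < \<epsilon> \<Longrightarrow> \<exists>\<delta>>0. \<forall>A\<in>sets M. measure M A < \<delta> \<longrightarrow> \<bar>\<nu> A\<bar> \<le> \<epsilon>"
  shows "\<exists>g. integrable M g \<and> (\<forall>A\<in>sets M. \<nu> A = (\<integral>x. g x * indicator A x \<partial>M))"
proof -
  interpret finite_measure M by fact
  have \<nu>0: "\<nu> {} = 0" using add[of "{}" "{}"] by simp
  define vp where "vp E = (SUP A\<in>{A \<in> sets M. A \<subseteq> E}. \<nu> A)" for E
  have bdd: "bdd_above (\<nu> ` {A \<in> sets M. A \<subseteq> E})" for E
    using bound by (intro bdd_aboveI[of _ B]) (auto simp: abs_le_iff)
  have up: "\<nu> A \<le> vp E" if "A \<in> sets M" "A \<subseteq> E" for A E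
    unfolding vp_def by (rule cSUP_upper[OF _ bdd]) (use that in auto)
  have least: "vp E \<le> c" if "\<And>A. A \<in> sets M \<Longrightarrow> A \<subseteq> E \<Longrightarrow> \<nu> A \<le> c" for E c
    unfolding vp_def by (rule cSUP_least) (use that in auto)
  have vp0: "0 \<le> vp E" for E using up[of "{}" E] by (simp add: \<nu>0)
  have vp_add: "vp (E \<union> F) = vp E + vp F" if E: "E \<in> sets M" and F: "F \<in> sets M" and EF: "E \<inter> F = {}" for E F
  proof (rule antisym)
    show "vp (E \<union> F) \<le> vp E + vp F"
    proof (rule least)
      fix A assume A: "A \<in> sets M" "A \<subseteq> E \<union> F"
      have "\<nu> ((A \<inter> E) \<union> (A \<inter> F)) = \<nu> (A \<inter> E) + \<nu> (A \<inter> F)"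
        using A E F EF by (intro add) auto
      moreover have "(A \<inter> E) \<union> (A \<inter> F) = A" using A by blast
      ultimately show "\<nu> A \<le> vp E + vp F" using up[of "A \<inter> E" E] up[of "A \<inter> F" F] A E F by auto
    qed
    \<comment> \<open>The two suprema are taken one after the other: a subset of E is fixed while
      the subsets of F vary.\<close>
    have "vp E \<le> vp (E \<union> F) - vp F"
    proof (rule least)
      fix A assume A: "A \<in> sets M" "A \<subseteq> E"
      have "vp F \<le> vp (E \<union> F) - \<nu> A"
      proof (rule least)
        fix A' assume A': "A' \<in> sets M" "A' \<subseteq> F"
        have "\<nu> (A \<union> A') = \<nu> A + \<nu> A'" using A A' EF by (intro add) auto
        moreover have "\<nu> (A \<union> A') \<le> vp (E \<union> F)" using A A' by (intro up) auto
        ultimately show "\<nu> A' \<le> vp (E \<union> F) - \<nu> A" by simp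
      qed
      then show "\<nu> A \<le> vp (E \<union> F) - vp F" by simp
    qed
    then show "vp E + vp F \<le> vp (E \<union> F)" by simp
  qed
  have vp_small: "\<exists>\<delta>>0. \<forall>E\<in>sets M. measure M E < \<delta> \<longrightarrow> vp E \<le> \<epsilon>" if \<epsilon>: "0 < \<epsilon>" for \<epsilon>
  proof -
    obtain \<delta> where \<delta>: "0 < \<delta>" "\<And>A. A \<in> sets M \<Longrightarrow> measure M A < \<delta> \<Longrightarrow> \<bar>\<nu> A\<bar> \<le> \<epsilon>"
      using small[OF \<epsilon>] by blast
    have "vp E \<le> \<epsilon>" if "E \<in> sets M" "measure M E < \<delta>" for E
    proof (rule least)
      fix A assume "A \<in> sets M" "A \<subseteq> E"
      then show "\<nu> A \<le> \<epsilon>" using \<delta>(2)[of A] finite_measure_mono[of A E] that by auto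
    qed
    then show ?thesis using \<delta>(1) by blast
  qed
  obtain g where g: "integrable M g" "\<And>A. A \<in> sets M \<Longrightarrow> vp A = (\<integral>x. g x * indicator A x \<partial>M)"
    using nonneg_additive_density[OF M vp0 vp_add vp_small] by blast
  have "\<exists>h. integrable M h \<and> (\<forall>A\<in>sets M. vp A - \<nu> A = (\<integral>x. h x * indicator A x \<partial>M))"
  proof (rule nonneg_additive_density[OF M])
    show "0 \<le> vp A - \<nu> A" if "A \<in> sets M" for A using up[OF that order_refl] by simp
    show "vp (A \<union> B) - \<nu> (A \<union> B) = vp A - \<nu> A + (vp B - \<nu> B)"
      if "A \<in> sets M" "B \<in> sets M" "A \<inter> B = {}" for A B
      using add[OF that] vp_add[OF that] by simp
    show "\<exists>\<delta>>0. \<forall>A\<in>sets M. measure M A < \<delta> \<longrightarrow> vp A - \<nu> A \<le> \<epsilon>" if "0 < \<epsilon>" for \<epsilon>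
    proof -
      obtain \<delta> where \<delta>: "0 < \<delta>" "\<And>A. A \<in> sets M \<Longrightarrow> measure M A < \<delta> \<Longrightarrow> vp A \<le> \<epsilon> / 2"
        using vp_small[of "\<epsilon> / 2"] \<open>0 < \<epsilon>\<close> by auto
      obtain \<delta>' where \<delta>': "0 < \<delta>'" "\<And>A. A \<in> sets M \<Longrightarrow> measure M A < \<delta>' \<Longrightarrow> \<bar>\<nu> A\<bar> \<le> \<epsilon> / 2"
        using small[of "\<epsilon> / 2"] \<open>0 < \<epsilon>\<close> by auto
      show ?thesis
      proof (intro exI[of _ "min \<delta> \<delta>'"] conjI ballI impI)
        fix A assume "A \<in> sets M" "measure M A < min \<delta> \<delta>'"
        then show "vp A - \<nu> A \<le> \<epsilon>" using \<delta>(2)[of A] \<delta>'(2)[of A] by auto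
      qed (use \<delta> \<delta>' in auto)
    qed
  qed
  then obtain h where h: "integrable M h" "\<And>A. A \<in> sets M \<Longrightarrow> vp A - \<nu> A = (\<integral>x. h x * indicator A x \<partial>M)"
    by blast
  have "\<nu> A = (\<integral>x. (g x - h x) * indicator A x \<partial>M)" if "A \<in> sets M" for A
  proof -
    have "integrable M (\<lambda>x. g x * indicator A x)" "integrable M (\<lambda>x. h x * indicator A x)"
      using integrable_real_mult_indicator[OF that] g h by auto
    then have "(\<integral>x. (g x - h x) * indicator A x \<partial>M) = vp A - (vp A - \<nu> A)"
      using g(2)[OF that] h(2)[OF that] by (simp add: left_diff_distrib)
    then show ?thesis by simp
  qed
  then show ?thesis using g h by (intro exI[of _ "\<lambda>x. g x - h x"]) auto
qed

subsection \<open>Linear minorants of sublinear functionals\<close>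

text \<open>Only real scalars occur; complex linearity is restored afterwards from a real linear
  functional.\<close>

locale sublinear_space =
  fixes Y :: "('a \<Rightarrow> complex) set"
  assumes zero: "(\<lambda>x. 0) \<in> Y" and add: "g \<in> Y \<Longrightarrow> h \<in> Y \<Longrightarrow> (\<lambda>x. g x + h x) \<in> Y"
    and scale: "g \<in> Y \<Longrightarrow> (\<lambda>x. complex_of_real t * g x) \<in> Y"
begin

definition sublinear :: "(('a \<Rightarrow> complex) \<Rightarrow> real) \<Rightarrow> bool" where
  "sublinear n \<longleftrightarrow> (\<forall>g\<in>Y. \<forall>h\<in>Y. n (\<lambda>x. g x + h x) \<le> n g + n h) \<and>
     (\<forall>t\<ge>0. \<forall>g\<in>Y. n (\<lambda>x. complex_of_real t * g x) = t * n g)"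

lemma sublinear_add: "sublinear n \<Longrightarrow> g \<in> Y \<Longrightarrow> h \<in> Y \<Longrightarrow> n (\<lambda>x. g x + h x) \<le> n g + n h"
  and sublinear_scale: "sublinear n \<Longrightarrow> g \<in> Y \<Longrightarrow> 0 \<le> t \<Longrightarrow> n (\<lambda>x. complex_of_real t * g x) = t * n g"
  by (auto simp: sublinear_def)

lemma uminus: "g \<in> Y \<Longrightarrow> (\<lambda>x. - g x) \<in> Y"
  using scale[of g "-1"] by simp

lemma sublinear_zero: "sublinear n \<Longrightarrow> n (\<lambda>x. 0) = 0"
  using sublinear_scale[OF _ zero, of n 0] by simp

lemma sublinear_uminus: "sublinear n \<Longrightarrow> g \<in> Y \<Longrightarrow> - n (\<lambda>x. - g x) \<le> n g"
  using sublinear_add[OF _ _ uminus, of n g g] sublinear_zero[of n] by simp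

text \<open>The largest sublinear functional below \<open>n\<close> that takes the value \<open>- n w\<close> at \<open>- w\<close>.\<close>

definition straighten :: "(('a \<Rightarrow> complex) \<Rightarrow> real) \<Rightarrow> ('a \<Rightarrow> complex) \<Rightarrow> ('a \<Rightarrow> complex) \<Rightarrow> real" where
  "straighten n w y = (if y \<in> Y then INF t\<in>{0..}. n (\<lambda>x. y x + complex_of_real t * w x) - t * n w else 0)"

context
  fixes n w assumes n: "sublinear n" and w: "w \<in> Y"
begin

text \<open>Subadditivity for t w = (y + t w) + (-y) gives a lower bound independent of t; without
  it the real infimum would carry no information.\<close>

lemma straighten_bdd: "y \<in> Y \<Longrightarrow> bdd_below ((\<lambda>t. n (\<lambda>x. y x + complex_of_real t * w x) - t * n w) ` {0..})"
proof (intro bdd_belowI[of _ "- n (\<lambda>x. - y x)"], clarify)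
  fix t :: real assume y: "y \<in> Y" and t: "0 \<le> t"
  have "n (\<lambda>x. (y x + complex_of_real t * w x) + (- y x)) \<le> n (\<lambda>x. y x + complex_of_real t * w x) + n (\<lambda>x. - y x)"
    by (intro sublinear_add[OF n] add scale uminus y w)
  then show "- n (\<lambda>x. - y x) \<le> n (\<lambda>x. y x + complex_of_real t * w x) - t * n w"
    using sublinear_scale[OF n w t] by simp
qed

lemma straighten_le: "y \<in> Y \<Longrightarrow> 0 \<le> t \<Longrightarrow> straighten n w y \<le> n (\<lambda>x. y x + complex_of_real t * w x) - t * n w"
  unfolding straighten_def using straighten_bdd by (auto intro!: cINF_lower)

lemma straighten_greatest:
  "y \<in> Y \<Longrightarrow> (\<And>t. 0 \<le> t \<Longrightarrow> c \<le> n (\<lambda>x. y x + complex_of_real t * w x) - t * n w) \<Longrightarrow> c \<le> straighten n w y"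
  unfolding straighten_def by (auto intro!: cINF_greatest)

lemma straighten_le_self: "y \<in> Y \<Longrightarrow> straighten n w y \<le> n y"
  using straighten_le[of y 0] by simp

lemma straighten_uminus: "straighten n w (\<lambda>x. - w x) \<le> - n w"
  using straighten_le[OF uminus[OF w], of 1] sublinear_zero[OF n] by simp

text \<open>Parameters t and s used for g and h combine to t + s for g + h; homogeneity is the
  substitution of c t for t.\<close>

lemma sublinear_straighten: "sublinear (straighten n w)"
  unfolding sublinear_def
proof (intro conjI ballI allI impI)
  fix g h assume g: "g \<in> Y" and h: "h \<in> Y"
  have "straighten n w (\<lambda>x. g x + h x) - straighten n w h \<le> straighten n w g"
  proof (rule straighten_greatest[OF g])
    fix t :: real assume t: "0 \<le> t"
    have "straighten n w (\<lambda>x. g x + h x) - (n (\<lambda>x. g x + complex_of_real t * w x) - t * n w) \<le> straighten n w h"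
    proof (rule straighten_greatest[OF h])
      fix s :: real assume s: "0 \<le> s"
      have "n (\<lambda>x. (g x + h x) + complex_of_real (t + s) * w x)
          = n (\<lambda>x. (g x + complex_of_real t * w x) + (h x + complex_of_real s * w x))"
        by (rule arg_cong[of _ _ n]) (auto simp: algebra_simps)
      also have "\<dots> \<le> n (\<lambda>x. g x + complex_of_real t * w x) + n (\<lambda>x. h x + complex_of_real s * w x)"
        by (intro sublinear_add[OF n] add scale g h w)
      finally show "straighten n w (\<lambda>x. g x + h x) - (n (\<lambda>x. g x + complex_of_real t * w x) - t * n w)
          \<le> n (\<lambda>x. h x + complex_of_real s * w x) - s * n w"
        using straighten_le[OF add[OF g h], of "t + s"] t s by (simp add: algebra_simps)
    qed
    then show "straighten n w (\<lambda>x. g x + h x) - straighten n w h \<le> n (\<lambda>x. g x + complex_of_real t * w x) - t * n w"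
      by simp
  qed
  then show "straighten n w (\<lambda>x. g x + h x) \<le> straighten n w g + straighten n w h" by simp
next
  fix c :: real and g assume c: "0 \<le> c" and g: "g \<in> Y"
  have le: "straighten n w (\<lambda>x. complex_of_real c * g x) \<le> c * straighten n w g" if c: "0 < c" and g: "g \<in> Y" for c g
  proof -
    have "straighten n w (\<lambda>x. complex_of_real c * g x) / c \<le> straighten n w g"
    proof (rule straighten_greatest[OF g])
      fix t :: real assume t: "0 \<le> t"
      have "n (\<lambda>x. complex_of_real c * g x + complex_of_real (c * t) * w x)
          = n (\<lambda>x. complex_of_real c * (g x + complex_of_real t * w x))"
        by (rule arg_cong[of _ _ n]) (auto simp: algebra_simps)
      also have "\<dots> = c * n (\<lambda>x. g x + complex_of_real t * w x)"
        using c by (intro sublinear_scale[OF n] add scale g w) auto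
      finally have "straighten n w (\<lambda>x. complex_of_real c * g x)
          \<le> c * (n (\<lambda>x. g x + complex_of_real t * w x) - t * n w)"
        using straighten_le[OF scale[OF g], of "c * t" c] t c by (simp add: algebra_simps)
      then show "straighten n w (\<lambda>x. complex_of_real c * g x) / c \<le> n (\<lambda>x. g x + complex_of_real t * w x) - t * n w"
        using c by (simp add: field_simps)
    qed
    then show ?thesis using c by (simp add: field_simps)
  qed
  show "straighten n w (\<lambda>x. complex_of_real c * g x) = c * straighten n w g"
  proof (cases "c = 0")
    case True
    have "straighten n w (\<lambda>x. 0) \<le> 0" using straighten_le_self[OF zero] sublinear_zero[OF n] by simp
    moreover have "0 \<le> straighten n w (\<lambda>x. 0)"
      by (rule straighten_greatest[OF zero]) (simp add: sublinear_scale[OF n w])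
    ultimately show ?thesis using True by simp
  next
    case False
    then have c: "0 < c" using c by simp
    have eq: "(\<lambda>x. complex_of_real (1 / c) * (complex_of_real c * g x)) = g"
      using c by (auto simp: fun_eq_iff)
    \<comment> \<open>The reverse inequality is the one already proved, applied to c g with the
      factor 1/c.\<close>
    have "straighten n w (\<lambda>x. complex_of_real (1 / c) * (complex_of_real c * g x))
        \<le> 1 / c * straighten n w (\<lambda>x. complex_of_real c * g x)"
      using c by (intro le scale g) auto
    then have "c * straighten n w g \<le> straighten n w (\<lambda>x. complex_of_real c * g x)"
      unfolding eq using c by (simp add: field_simps)
    then show ?thesis using le[OF c g] by simp
  qed
qed

end

text \<open>Hahn--Banach: a minimal element among the sublinear functionals below \<open>straighten N g\<^sub>0\<close>
  coincides with all its straightenings, hence is linear.\<close>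

theorem linear_minorant:
  assumes N: "sublinear N" and g0: "g0 \<in> Y"
  shows "\<exists>l. (\<forall>g\<in>Y. \<forall>h\<in>Y. l (\<lambda>x. g x + h x) = l g + l h) \<and>
     (\<forall>t. \<forall>g\<in>Y. l (\<lambda>x. complex_of_real t * g x) = t * l g) \<and> (\<forall>g\<in>Y. l g \<le> N g) \<and> N g0 \<le> l g0"
proof -
  \<comment> \<open>Minorants of N0 are at most - N g0 at - g0; for a linear one this forces the
    value at g0 to be at least N g0.\<close>
  define N0 where "N0 = straighten N g0"
  \<comment> \<open>Fixing the value 0 outside Y makes the pointwise order antisymmetric on total
    functions, so minimality yields genuine equality.\<close>
  define A where "A = {n. sublinear n \<and> (\<forall>g. g \<notin> Y \<longrightarrow> n g = 0) \<and> (\<forall>g\<in>Y. n g \<le> N0 g)}"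
  define P where "P a b \<longleftrightarrow> (\<forall>g. b g \<le> (a g :: real))" for a b :: "('a \<Rightarrow> complex) \<Rightarrow> real"
  have N0A: "N0 \<in> A"
    using sublinear_straighten[OF N g0] by (auto simp: A_def N0_def straighten_def)
  \<comment> \<open>A lower bound uniform in n; it makes infima over chains real numbers.\<close>
  have lower: "- N0 (\<lambda>x. - g x) \<le> n g" if "n \<in> A" "g \<in> Y" for n g
    using sublinear_uminus[of n g] that uminus[OF that(2)] by (force simp: A_def)
  have "\<exists>m\<in>A. \<forall>a\<in>A. P m a \<longrightarrow> a = m"
  proof (rule predicate_Zorn)
    show "partial_order_on A (relation_of P A)"
      by (rule partial_order_on_relation_ofI) (auto simp: P_def fun_eq_iff intro: order.trans antisym)
    fix C assume C: "C \<in> Chains (relation_of P A)"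
    then have CA: "C \<subseteq> A" and chain: "\<And>a b. a \<in> C \<Longrightarrow> b \<in> C \<Longrightarrow> P a b \<or> P b a"
      by (auto simp: Chains_def relation_of_def)
    show "\<exists>u\<in>A. \<forall>a\<in>C. P a u"
    proof (cases "C = {}")
      case True
      then show ?thesis using N0A by blast
    next
      case False
      define u where "u g = (if g \<in> Y then INF n\<in>C. n g else 0)" for g
      have bdd: "bdd_below ((\<lambda>n. n g) ` C)" if "g \<in> Y" for g
        using lower[OF _ that] CA by (intro bdd_belowI[of _ "- N0 (\<lambda>x. - g x)"]) auto
      have ul: "u g \<le> n g" if "g \<in> Y" "n \<in> C" for g n
        unfolding u_def using bdd[OF that(1)] that by (auto intro!: cINF_lower)
      have ug: "c \<le> u g" if "g \<in> Y" "\<And>n. n \<in> C \<Longrightarrow> c \<le> n g" for c g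
        unfolding u_def using that False by (auto intro!: cINF_greatest)
      have sub: "sublinear n" if "n \<in> C" for n using that CA by (auto simp: A_def)
      have "sublinear u"
        unfolding sublinear_def
      proof (intro conjI ballI allI impI)
        fix g h assume g: "g \<in> Y" and h: "h \<in> Y"
        have "u (\<lambda>x. g x + h x) - u h \<le> u g"
        proof (rule ug[OF g])
          fix n assume nC: "n \<in> C"
          have "u (\<lambda>x. g x + h x) - n g \<le> u h"
          proof (rule ug[OF h])
            fix m assume mC: "m \<in> C"
            \<comment> \<open>In a chain, the smaller of n and m lies below both, so its
              subadditivity bounds the infimum by n g + m h.\<close>
            obtain k where k: "k \<in> C" "\<And>g. k g \<le> n g" "\<And>g. k g \<le> m g"
              using chain[OF nC mC] nC mC by (auto simp: P_def)
            have "u (\<lambda>x. g x + h x) \<le> k (\<lambda>x. g x + h x)" by (rule ul[OF add[OF g h] k(1)])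
            also have "\<dots> \<le> k g + k h" by (rule sublinear_add[OF sub[OF k(1)] g h])
            finally show "u (\<lambda>x. g x + h x) - n g \<le> m h" using k(2)[of g] k(3)[of h] by simp
          qed
          then show "u (\<lambda>x. g x + h x) - u h \<le> n g" by simp
        qed
        then show "u (\<lambda>x. g x + h x) \<le> u g + u h" by simp
      next
        fix t :: real and g assume t: "0 \<le> t" and g: "g \<in> Y"
        show "u (\<lambda>x. complex_of_real t * g x) = t * u g"
        proof (rule antisym)
          show "t * u g \<le> u (\<lambda>x. complex_of_real t * g x)"
          proof (rule ug[OF scale[OF g]])
            fix n assume nC: "n \<in> C"
            show "t * u g \<le> n (\<lambda>x. complex_of_real t * g x)"
              unfolding sublinear_scale[OF sub[OF nC] g t] using t ul[OF g nC] by (intro mult_left_mono) auto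
          qed
          show "u (\<lambda>x. complex_of_real t * g x) \<le> t * u g"
          proof (cases "t = 0")
            case True
            obtain n where nC: "n \<in> C" using False by blast
            show ?thesis using True ul[OF zero nC] sublinear_zero[OF sub[OF nC]] by simp
          next
            case False
            then have t0: "0 < t" using t by simp
            have "u (\<lambda>x. complex_of_real t * g x) / t \<le> u g"
            proof (rule ug[OF g])
              fix n assume nC: "n \<in> C"
              show "u (\<lambda>x. complex_of_real t * g x) / t \<le> n g"
                using ul[OF scale[OF g] nC, of t] sublinear_scale[OF sub[OF nC] g t] t0 by (simp add: field_simps)
            qed
            then show ?thesis using t0 by (simp add: field_simps)
          qed
        qed
      qed
      moreover have "u g \<le> N0 g" if "g \<in> Y" for g
      proof -
        obtain n where nC: "n \<in> C" using False by blast
        then have "n g \<le> N0 g" using CA that by (auto simp: A_def)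
        then show ?thesis using ul[OF that nC] by simp
      qed
      ultimately have "u \<in> A" by (auto simp: A_def u_def)
      moreover have "P n u" if "n \<in> C" for n
        using ul[OF _ that] CA that by (auto simp: P_def u_def A_def)
      ultimately show ?thesis by blast
    qed
  qed
  then obtain m where m: "m \<in> A" and min: "\<And>a. a \<in> A \<Longrightarrow> P m a \<Longrightarrow> a = m" by blast
  have sub: "sublinear m" and mN0: "\<And>g. g \<in> Y \<Longrightarrow> m g \<le> N0 g" and out: "\<And>g. g \<notin> Y \<Longrightarrow> m g = 0"
    using m by (auto simp: A_def)
  \<comment> \<open>Straightening m at w gives a member of A below m, hence m itself; so m(-w) <= -
    m w, and oddness upgrades subadditivity to additivity.\<close>
  have neg: "m (\<lambda>x. - w x) = - m w" if w: "w \<in> Y" for w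
  proof -
    have "straighten m w \<in> A"
      using sublinear_straighten[OF sub w] straighten_le_self[OF sub w] mN0
      by (auto simp: A_def) (auto simp: straighten_def intro: order.trans)
    moreover have "P m (straighten m w)"
      using straighten_le_self[OF sub w] out by (auto simp: P_def straighten_def)
    ultimately have "straighten m w = m" by (rule min)
    then show ?thesis using straighten_uminus[OF sub w] sublinear_uminus[OF sub w] by simp
  qed
  have ladd: "m (\<lambda>x. g x + h x) = m g + m h" if g: "g \<in> Y" and h: "h \<in> Y" for g h
  proof -
    have "m (\<lambda>x. - g x + - h x) \<le> m (\<lambda>x. - g x) + m (\<lambda>x. - h x)"
      by (intro sublinear_add[OF sub] uminus g h)
    moreover have "m (\<lambda>x. - g x + - h x) = - m (\<lambda>x. g x + h x)"
      using neg[OF add[OF g h]] by simp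
    ultimately show ?thesis using sublinear_add[OF sub g h] neg[OF g] neg[OF h] by simp
  qed
  have lscale: "m (\<lambda>x. complex_of_real t * g x) = t * m g" if g: "g \<in> Y" for t g
  proof (cases "0 \<le> t")
    case False
    then have "m (\<lambda>x. complex_of_real (- t) * g x) = - t * m g"
      by (intro sublinear_scale[OF sub g]) auto
    then show ?thesis using neg[OF scale[OF g], of "-t"] by simp
  qed (rule sublinear_scale[OF sub g])
  have "m g \<le> N g" if "g \<in> Y" for g
    using mN0[OF that] straighten_le_self[OF N g0 that] by (simp add: N0_def)
  moreover have "N g0 \<le> m g0"
    using mN0[OF uminus[OF g0]] straighten_uminus[OF N g0] neg[OF g0] by (simp add: N0_def)
  ultimately show ?thesis using ladd lscale by blast
qed

end

subsection \<open>The pairing\<close>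

locale bml_duality = lorentz_pair p q p' q' for p q p' q' +
  fixes t t' r r' :: ennreal and dim :: "'n::finite itself"
  assumes conj_pair_t: "conj_pair t t'" and t: "1 < t" "t < top"
    and conj_pair_r: "conj_pair r r'" and r: "1 < r"
begin

abbreviation \<rho> :: "(real^'n \<Rightarrow> complex) \<Rightarrow> ennreal" where "\<rho> \<equiv> lorentz_norm p q"
abbreviation \<rho>' :: "(real^'n \<Rightarrow> complex) \<Rightarrow> ennreal" where "\<rho>' \<equiv> lorentz_norm p' q'"

text \<open>One exponent serves both spaces: by conjugacy 1/p' - 1/t' equals 1/t - 1/p, so the
  weight in the space norm is also the size bound of the blocks.\<close>

definition e :: real where "e = 1 / enn2real t - 1 / enn2real p"

lemma e_conj: "1 / enn2real p' - 1 / enn2real t' = e"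
  using conj_pair_t t conj_pair_p p by (auto simp: conj_pair_def e_def)

sublocale blk: block_gauge \<rho>' 32 e r' r
  using conj.lorentz_norm_cmult conj.lorentz_norm_add_le conj_pair_sym[OF conj_pair_r]
  by unfold_locales auto

abbreviation M :: "(real^'n \<Rightarrow> complex) set" where "M \<equiv> bml_space p q t r"
abbreviation NM :: "(real^'n \<Rightarrow> complex) \<Rightarrow> ennreal" where "NM \<equiv> bml_norm p q t r"
abbreviation H :: "(real^'n \<Rightarrow> complex) set" where "H \<equiv> block_space p' q' t' r'"
abbreviation NH :: "(real^'n \<Rightarrow> complex) \<Rightarrow> ennreal" where "NH \<equiv> block_norm p' q' t' r'"
abbreviation w :: "int \<times> (int^'n) \<Rightarrow> real" where "w \<equiv> cube_weight e"

lemma r_pos: "0 < r" "0 < r'" and r': "r' < top"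
  using conj_pair_pos conj_pair_r conj_pair_sym[OF conj_pair_r] r by (auto simp: conj_pair_def)

lemma NH_eq: "NH = blk.N"
  by (simp add: block_norm_eq_gen e_conj)

lemma H_iff: "g \<in> H \<longleftrightarrow> g \<in> borel_measurable lebesgue \<and> (\<exists>c b. blk.rep g c b)"
  by (simp add: block_space_def block_representation_eq_gen e_conj)

lemma H_measurable: "g \<in> H \<Longrightarrow> g \<in> borel_measurable lebesgue"
  and M_measurable: "f \<in> M \<Longrightarrow> f \<in> borel_measurable lebesgue"
  and NM_finite: "f \<in> M \<Longrightarrow> NM f < top"
  by (auto simp: H_iff bml_space_def)

lemma NH_finite: "g \<in> H \<Longrightarrow> NH g < top"
  unfolding NH_eq H_iff using gen_norm_finite by blast

definition loc :: "(real^'n \<Rightarrow> complex) \<Rightarrow> int \<times> (int^'n) \<Rightarrow> real^'n \<Rightarrow> complex" where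
  "loc f i x = f x * indicator (dyadic_cube i) x"

lemma loc_measurable [measurable]: "f \<in> borel_measurable lebesgue \<Longrightarrow> loc f i \<in> borel_measurable lebesgue"
  unfolding loc_def by (intro borel_measurable_times borel_measurable_indicator) auto

text \<open>Here the weight moves inside the r-th power and the sum over the set of cubes becomes a
  sum over indices, so that the sequence inequalities apply uniformly for finite and infinite
  r.\<close>

lemma NM_eq: "NM f = seq_norm r (\<lambda>i. ennreal (w i) * \<rho> (loc f i))"
proof (cases "r = \<infinity>")
  case True
  then show ?thesis
    by (simp add: bml_norm_def seq_norm_def dyadic_cubes_def image_image cube_weight_def e_def
        lorentz_norm_on_def loc_def[abs_def])
next
  case False
  have "(\<Sum>\<^sub>\<infinity>Q\<in>dyadic_cubes.
              ennreal (measure lebesgue Q powr (enn2real r / enn2real t - enn2real r / enn2real p))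
              * lorentz_norm_on p q Q f ennpowr enn2real r)
     = (\<Sum>\<^sub>\<infinity>i\<in>UNIV. ennreal (measure lebesgue (dyadic_cube i :: (real^'n) set) powr (enn2real r / enn2real t - enn2real r / enn2real p))
              * lorentz_norm_on p q (dyadic_cube i) f ennpowr enn2real r)"
    unfolding dyadic_cubes_def by (subst infsum_reindex[OF inj_dyadic_cube]) (simp add: o_def)
  also have "\<dots> = (\<Sum>\<^sub>\<infinity>i\<in>UNIV. (ennreal (w i) * \<rho> (loc f i)) ennpowr enn2real r)"
  proof (intro infsum_cong)
    fix i :: "int \<times> (int^'n)"
    have "w i powr enn2real r = measure lebesgue (dyadic_cube i :: (real^'n) set) powr (enn2real r / enn2real t - enn2real r / enn2real p)"
      unfolding cube_weight_def e_def powr_powr by (simp add: algebra_simps)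
    then show "ennreal (measure lebesgue (dyadic_cube i :: (real^'n) set) powr (enn2real r / enn2real t - enn2real r / enn2real p))
              * lorentz_norm_on p q (dyadic_cube i) f ennpowr enn2real r = (ennreal (w i) * \<rho> (loc f i)) ennpowr enn2real r"
      using cube_weight_pos[of e i]
      by (simp add: ennpowr_mult ennpowr_ennreal less_imp_le lorentz_norm_on_def loc_def[abs_def])
  qed
  finally show ?thesis
    using False by (simp add: bml_norm_def seq_norm_def infsum_eq_nn_integral_count_space)
qed

text \<open>Hoelder's inequality twice: for Lorentz norms on each cube, where the block bound
  contributes the weight w i, and then for sequences over the cubes.\<close>

lemma pairing_rep:
  assumes f [measurable]: "f \<in> borel_measurable lebesgue" and g: "g \<in> borel_measurable lebesgue" and rep: "blk.rep g c b"
  shows "(\<integral>\<^sup>+x. ennreal (norm (f x * g x)) \<partial>lebesgue) \<le> 64 * NM f * lseq_norm r' c"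
proof -
  have blk: "gen_block \<rho>' e i (b i)" for i using rep by (rule gen_representation_block)
  have [measurable]: "b i \<in> borel_measurable lebesgue" for i using blk[of i] by (rule gen_block_measurable)
  have "(\<integral>\<^sup>+x. ennreal (norm (f x * g x)) \<partial>lebesgue)
     \<le> (\<integral>\<^sup>+i. (\<integral>\<^sup>+x. ennreal (norm (f x * (c i * b i x))) \<partial>lebesgue) \<partial>count_space UNIV)"
    by (rule has_sum_L1_loc_pairing) (use g f rep in \<open>auto simp: gen_representation_def\<close>)
  also have "\<dots> \<le> (\<integral>\<^sup>+i. 64 * ((ennreal (w i) * \<rho> (loc f i)) * ennreal (norm (c i))) \<partial>count_space UNIV)"
  proof (intro nn_integral_mono)
    fix i
    have "(\<integral>\<^sup>+x. ennreal (norm (f x * (c i * b i x))) \<partial>lebesgue)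
        = (\<integral>\<^sup>+x. ennreal (norm (c i)) * ennreal (norm (loc f i x * b i x)) \<partial>lebesgue)"
    proof (intro nn_integral_cong)
      fix x
      have "f x * b i x = loc f i x * b i x"
        using blk[of i] by (cases "x \<in> dyadic_cube i") (auto simp: loc_def gen_block_def)
      then show "ennreal (norm (f x * (c i * b i x))) = ennreal (norm (c i)) * ennreal (norm (loc f i x * b i x))"
        by (metis ennreal_mult mult.left_commute norm_ge_zero norm_mult)
    qed
    also have "\<dots> = ennreal (norm (c i)) * (\<integral>\<^sup>+x. ennreal (norm (loc f i x * b i x)) \<partial>lebesgue)"
      by (intro nn_integral_cmult) measurable
    also have "\<dots> \<le> ennreal (norm (c i)) * (64 * (\<rho> (loc f i) * \<rho>' (b i)))"
      by (intro mult_left_mono lorentz_norm_Holder) measurable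
    also have "\<dots> \<le> ennreal (norm (c i)) * (64 * (\<rho> (loc f i) * ennreal (w i)))"
      using blk[of i] by (intro mult_left_mono) (auto simp: gen_block_def)
    finally show "(\<integral>\<^sup>+x. ennreal (norm (f x * (c i * b i x))) \<partial>lebesgue)
       \<le> 64 * ((ennreal (w i) * \<rho> (loc f i)) * ennreal (norm (c i)))" by (simp only: mult_ac)
  qed
  also have "\<dots> = 64 * (\<integral>\<^sup>+i. (ennreal (w i) * \<rho> (loc f i)) * ennreal (norm (c i)) \<partial>count_space UNIV)"
    by (intro nn_integral_cmult) simp
  also have "\<dots> \<le> 64 * (NM f * lseq_norm r' c)"
    unfolding NM_eq lseq_norm_eq by (intro mult_left_mono seq_norm_Holder conj_pair_r) simp
  finally show ?thesis by (simp only: mult_ac)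
qed

lemma pairing_bound:
  assumes f: "f \<in> M" and g: "g \<in> H"
  shows "(\<integral>\<^sup>+x. ennreal (norm (f x * g x)) \<partial>lebesgue) \<le> 64 * NM f * NH g"
proof -
  let ?I = "\<integral>\<^sup>+x. ennreal (norm (f x * g x)) \<partial>lebesgue"
  note le = pairing_rep[OF M_measurable[OF f] H_measurable[OF g]]
  obtain c b where cb: "blk.rep g c b" using g by (auto simp: H_iff)
  have fin: "64 * NM f < top" using NM_finite[OF f] by (simp add: ennreal_mult_less_top)
  show ?thesis
  proof (cases "NM f = 0")
    case True
    then show ?thesis using le[OF cb] by simp
  next
    case False
    then have pos: "64 * NM f \<noteq> 0" by simp
    \<comment> \<open>Dividing isolates the norm of the coefficients, over which the infimum is
      taken; for NM f = 0 the bound for a single representation already gives 0.\<close>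
    have "?I / (64 * NM f) \<le> NH g"
      unfolding NH_eq
    proof (rule gen_norm_greatest)
      fix c b assume "blk.rep g c b"
      from divide_right_mono_ennreal[OF le[OF this], of "64 * NM f"]
      show "?I / (64 * NM f) \<le> lseq_norm r' c"
        using pos fin by (simp add: mult_divide_eq_ennreal mult.commute[of "64 * NM f"] less_top)
    qed
    then have "64 * NM f * (?I / (64 * NM f)) \<le> 64 * NM f * NH g" by (rule mult_left_mono) simp
    moreover have "64 * NM f * (?I / (64 * NM f)) = ?I"
      using pos fin by (simp add: ennreal_times_divide mult_divide_eq_ennreal mult.commute[of "64 * NM f"] less_top)
    ultimately show ?thesis by simp
  qed
qed

lemma pairing_integrable:
  assumes f: "f \<in> M" and g: "g \<in> H"
  shows "integrable lebesgue (\<lambda>x. f x * g x)"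
proof (rule integrableI_bounded)
  show "(\<lambda>x. f x * g x) \<in> borel_measurable lebesgue"
    using M_measurable[OF f] H_measurable[OF g] by measurable
  show "(\<integral>\<^sup>+x. ennreal (norm (f x * g x)) \<partial>lebesgue) < \<infinity>"
    using pairing_bound[OF f g] NM_finite[OF f] NH_finite[OF g]
    by (auto simp: ennreal_mult_less_top intro: le_less_trans)
qed

lemma pairing_integral_le:
  assumes f: "f \<in> M" and g: "g \<in> H"
  shows "ennreal (norm (LINT x|lebesgue. f x * g x)) \<le> 64 * NM f * NH g"
proof -
  have "norm (LINT x|lebesgue. f x * g x) \<le> (LINT x|lebesgue. norm (f x * g x))"
    by (rule integral_norm_bound)
  then have "ennreal (norm (LINT x|lebesgue. f x * g x)) \<le> ennreal (LINT x|lebesgue. norm (f x * g x))"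
    by (rule ennreal_leI)
  also have "\<dots> = (\<integral>\<^sup>+x. ennreal (norm (f x * g x)) \<partial>lebesgue)"
    by (intro nn_integral_eq_integral[symmetric] integrable_norm pairing_integrable f g) auto
  finally show ?thesis using pairing_bound[OF f g] by simp
qed

section \<open>Linear structure of the two spaces and test functions\<close>

lemma H_add: "g \<in> H \<Longrightarrow> h \<in> H \<Longrightarrow> (\<lambda>x. g x + h x) \<in> H"
  unfolding H_iff using blk.rep_add[of g _ _ h] by (auto intro: borel_measurable_add) blast

lemma H_cmult: "g \<in> H \<Longrightarrow> (\<lambda>x. a * g x) \<in> H"
  unfolding H_iff using blk.rep_cmult[of g _ _ a] by (auto intro: borel_measurable_times borel_measurable_const)

lemma H_zero: "(\<lambda>x. 0) \<in> H"
  unfolding H_iff using blk.rep_zero by auto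

lemma H_diff: "g \<in> H \<Longrightarrow> h \<in> H \<Longrightarrow> (\<lambda>x. g x - h x) \<in> H"
  using H_add[of g "\<lambda>x. -1 * h x"] H_cmult[of h "-1"] by simp

lemma H_sum: "finite I \<Longrightarrow> (\<And>i. i \<in> I \<Longrightarrow> g i \<in> H) \<Longrightarrow> (\<lambda>x. \<Sum>i\<in>I. g i x) \<in> H"
  by (induction I rule: finite_induct) (auto simp: H_zero intro: H_add)

lemma NH_cmult: "g \<in> H \<Longrightarrow> NH (\<lambda>x. a * g x) = ennreal (norm a) * NH g"
  unfolding NH_eq by (rule blk.N_cmult[OF H_measurable])

lemma NM_add:
  assumes "f \<in> borel_measurable lebesgue" "g \<in> borel_measurable lebesgue"
  shows "NM (\<lambda>x. f x + g x) \<le> 32 * (NM f + NM g)"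
proof -
  have "ennreal (w i) * \<rho> (loc (\<lambda>x. f x + g x) i)
      \<le> 32 * (ennreal (w i) * \<rho> (loc f i) + ennreal (w i) * \<rho> (loc g i))" for i
  proof -
    have "loc (\<lambda>x. f x + g x) i = (\<lambda>x. loc f i x + loc g i x)"
      by (simp add: loc_def fun_eq_iff distrib_right)
    then have "ennreal (w i) * \<rho> (loc (\<lambda>x. f x + g x) i) \<le> ennreal (w i) * (32 * (\<rho> (loc f i) + \<rho> (loc g i)))"
      using lorentz_norm_add_le[of "loc f i" "loc g i"] assms by (simp add: mult_left_mono)
    also have "\<dots> = 32 * (ennreal (w i) * \<rho> (loc f i) + ennreal (w i) * \<rho> (loc g i))"
      by (simp only: distrib_left mult_ac)
    finally show ?thesis .
  qed
  then have "NM (\<lambda>x. f x + g x) \<le> seq_norm r (\<lambda>i. 32 * (ennreal (w i) * \<rho> (loc f i) + ennreal (w i) * \<rho> (loc g i)))"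
    unfolding NM_eq by (rule seq_norm_mono)
  also have "\<dots> \<le> 32 * (NM f + NM g)"
    unfolding NM_eq seq_norm_cmult[OF r_pos(1)] by (intro mult_left_mono seq_norm_triangle[OF conj_pair_r]) simp
  finally show ?thesis .
qed

lemma NM_cmult:
  assumes "f \<in> borel_measurable lebesgue"
  shows "NM (\<lambda>x. a * f x) = ennreal (norm a) * NM f"
proof -
  have "\<rho> (loc (\<lambda>x. a * f x) i) = ennreal (norm a) * \<rho> (loc f i)" for i
  proof -
    have "loc (\<lambda>x. a * f x) i = (\<lambda>x. a * loc f i x)" by (simp add: loc_def fun_eq_iff)
    then show ?thesis using lorentz_norm_cmult[of "loc f i"] assms by simp
  qed
  then show ?thesis
    unfolding NM_eq seq_norm_cmult[OF r_pos(1), symmetric] by (simp add: mult.left_commute)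
qed

lemma M_add: "f \<in> M \<Longrightarrow> g \<in> M \<Longrightarrow> (\<lambda>x. f x + g x) \<in> M"
  using NM_add[of f g] by (auto simp: bml_space_def ennreal_mult_less_top intro: le_less_trans)

lemma M_cmult: "f \<in> M \<Longrightarrow> (\<lambda>x. a * f x) \<in> M"
  by (auto simp: bml_space_def NM_cmult ennreal_mult_less_top)

lemma M_zero: "(\<lambda>x. 0) \<in> M"
  using NM_cmult[of "\<lambda>x. 0" 0] by (auto simp: bml_space_def)

text \<open>The test functions of the duality argument: they belong to H and can be paired with a
  locally integrable f.\<close>

definition bump :: "int \<times> (int^'n) \<Rightarrow> (real^'n \<Rightarrow> complex) \<Rightarrow> bool" where
  "bump i h \<longleftrightarrow> h \<in> borel_measurable lebesgue \<and> (\<forall>x. x \<notin> dyadic_cube i \<longrightarrow> h x = 0) \<and> (\<exists>B. \<forall>x. norm (h x) \<le> B)"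

lemma H_supported:
  assumes h: "h \<in> borel_measurable lebesgue" "\<And>x. x \<notin> dyadic_cube i \<Longrightarrow> h x = 0"
    and A: "0 < A" "\<rho>' h \<le> ennreal A * ennreal (w i)"
  shows "h \<in> H" "NH h \<le> ennreal A"
proof -
  obtain c b where "blk.rep h c b" "lseq_norm r' c = ennreal A"
    using blk.rep_single[OF h A] by blast
  then show "h \<in> H" "NH h \<le> ennreal A"
    using gen_norm_le[of \<rho>' e r' h c b] h by (auto simp: H_iff NH_eq)
qed

text \<open>A single block needs a strictly positive coefficient, so s / w i + \<delta> is used,
  which also covers functions of norm 0; \<delta> is then removed.\<close>

lemma H_of_finite:
  assumes h: "h \<in> borel_measurable lebesgue" "\<And>x. x \<notin> dyadic_cube i \<Longrightarrow> h x = 0" and fin: "\<rho>' h < top"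
  shows "h \<in> H" "ennreal (w i) * NH h \<le> \<rho>' h"
proof -
  obtain s where s: "\<rho>' h = ennreal s" "0 \<le> s" using fin by (cases "\<rho>' h") auto
  have w: "0 < w i" by (rule cube_weight_pos)
  have A: "h \<in> H \<and> NH h \<le> ennreal (s / w i + \<delta>)" if "0 < \<delta>" for \<delta>
  proof -
    have "0 < s / w i + \<delta>" using s w that by (simp add: add_nonneg_pos)
    moreover have "\<rho>' h \<le> ennreal (s / w i + \<delta>) * ennreal (w i)"
      using s w that by (simp add: ennreal_mult[symmetric] del: ennreal_plus) (simp add: distrib_right ennreal_leI del: ennreal_plus)
    ultimately show ?thesis using H_supported[OF h, where A="s / w i + \<delta>"] by blast
  qed
  then show "h \<in> H" using zero_less_one by blast
  have "NH h \<le> ennreal (s / w i)"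
    by (rule ennreal_le_epsilon) (use A s w in \<open>simp flip: ennreal_plus\<close>)
  then have "ennreal (w i) * NH h \<le> ennreal (w i) * ennreal (s / w i)" by (rule mult_left_mono) simp
  then show "ennreal (w i) * NH h \<le> \<rho>' h" using s w by (simp flip: ennreal_mult)
qed

lemma bump_finite: "bump i h \<Longrightarrow> \<rho>' h < top"
  unfolding bump_def
  by (auto intro: conj.lorentz_norm_bounded_finite[OF _ sets_dyadic_cube emeasure_dyadic_cube_finite])

lemma bump_H:
  assumes "bump i h" shows "h \<in> H"
  using H_of_finite(1)[OF _ _ bump_finite[OF assms]] assms unfolding bump_def by blast

lemma bump_cmult: "bump i h \<Longrightarrow> bump i (\<lambda>x. a * h x)"
proof -
  assume h: "bump i h"
  then obtain B where B: "\<And>x. norm (h x) \<le> B" by (auto simp: bump_def)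
  have "norm (a * h x) \<le> norm a * B" for x
    unfolding norm_mult by (intro mult_left_mono B) simp
  then show ?thesis using h by (auto simp: bump_def intro!: borel_measurable_times)
qed

text \<open>Near-optimal blocks on finitely many cubes turn the \<open>\<ell>\<^sup>r\<close> norm over the cubes into a pairing
  with a finite sum of blocks.\<close>

lemma NM_le:
  fixes f :: "real^'n \<Rightarrow> complex"
  assumes f [measurable]: "f \<in> borel_measurable lebesgue" and K: "0 \<le> K"
    and int: "\<And>i h. bump i h \<Longrightarrow> integrable lebesgue (\<lambda>x. f x * h x)"
    and le: "\<And>I h. finite I \<Longrightarrow> (\<And>i. i \<in> I \<Longrightarrow> bump i (h i)) \<Longrightarrow>
      ennreal (norm (LINT x|lebesgue. f x * (\<Sum>i\<in>I. h i x))) \<le> ennreal K * NH (\<lambda>x. \<Sum>i\<in>I. h i x)"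
  shows "NM f \<le> ennreal (2 * converse_const * K)"
proof -
  \<comment> \<open>For these h the products f h are nonnegative, so pairings over different cubes
    add up without cancellation.\<close>
  define good where "good i h \<longleftrightarrow> bump i h \<and> (\<forall>x. f x * h x = complex_of_real (norm (f x * h x))) \<and> \<rho>' h \<le> 1" for i h
  define J where "J h = (LINT x|lebesgue. norm (f x * h x))" for h
  have nnJ: "(\<integral>\<^sup>+x. ennreal (norm (f x * h x)) \<partial>lebesgue) = ennreal (J h)" if "good i h" for i h
    unfolding J_def by (intro nn_integral_eq_integral integrable_norm int) (use that in \<open>auto simp: good_def\<close>)
  have J0: "0 \<le> J h" for h unfolding J_def by simp
  \<comment> \<open>The functions w i h i are blocks, so their combination with coefficients y i has
    block norm at most the norm of y; the assumed bound on the pairing becomes a bound on a sum over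
    cubes.\<close>
  have comb: "(\<Sum>i\<in>I. y i * (w i * J (h i))) \<le> K * enn2real (seq_norm r' (\<lambda>i. ennreal (y i)))"
    if I: "finite I" and h: "\<And>i. i \<in> I \<Longrightarrow> good i (h i)" and y: "\<And>i. 0 \<le> y i" "\<And>i. i \<notin> I \<Longrightarrow> y i = 0" for I h y
  proof -
    define b where "b i x = complex_of_real (w i) * h i x" for i x
    define c where "c i = complex_of_real (y i)" for i
    have wi: "0 < w i" for i by (rule cube_weight_pos)
    have bump_h: "bump i (h i)" if "i \<in> I" for i using h[OF that] by (simp add: good_def)
    have bump: "bump i (\<lambda>x. c i * b i x)" if "i \<in> I" for i
      unfolding b_def mult.assoc[symmetric] by (intro bump_cmult bump_h that)
    have blk: "gen_block \<rho>' e i (b i)" if "i \<in> I" for i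
    proof -
      have hm: "h i \<in> borel_measurable lebesgue" using bump_h[OF that] by (simp add: bump_def)
      have "\<rho>' (b i) = ennreal (w i) * \<rho>' (h i)"
        unfolding b_def using conj.lorentz_norm_cmult[OF hm] wi[of i] by (simp add: less_imp_le)
      also have "\<dots> \<le> ennreal (w i) * 1" using h[OF that] by (intro mult_left_mono) (auto simp: good_def)
      finally show ?thesis
        using bump_h[OF that] hm unfolding gen_block_def bump_def b_def by (auto intro!: borel_measurable_times)
    qed
    have cn: "lseq_norm r' c = seq_norm r' (\<lambda>i. ennreal (y i))"
      unfolding lseq_norm_eq c_def using y by simp
    have fin: "seq_norm r' (\<lambda>i. ennreal (y i)) < top"
      using seq_norm_finite_support[OF r_pos(2) r' I, of y] y by simp
    have "blk.rep (\<lambda>x. \<Sum>i\<in>I. c i * b i x) c (\<lambda>i. if i \<in> I then b i else (\<lambda>x. 0))"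
      using y fin by (intro blk.rep_finite I blk) (auto simp: c_def cn[unfolded c_def])
    from gen_norm_le[OF this] have NHle: "NH (\<lambda>x. \<Sum>i\<in>I. c i * b i x) \<le> seq_norm r' (\<lambda>i. ennreal (y i))"
      by (simp add: NH_eq cn)
    have "(LINT x|lebesgue. f x * (\<Sum>i\<in>I. c i * b i x)) = (\<Sum>i\<in>I. (LINT x|lebesgue. f x * (c i * b i x)))"
      unfolding sum_distrib_left by (intro Bochner_Integration.integral_sum int[OF bump])
    also have "\<dots> = (\<Sum>i\<in>I. complex_of_real (y i * (w i * J (h i))))"
    proof (intro sum.cong refl)
      fix i assume i: "i \<in> I"
      have "(LINT x|lebesgue. f x * (c i * b i x)) = (LINT x|lebesgue. complex_of_real (y i * w i) * (f x * h i x))"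
        by (simp add: c_def b_def mult_ac)
      also have "\<dots> = complex_of_real (y i * w i) * (LINT x|lebesgue. f x * h i x)" by simp
      also have "(LINT x|lebesgue. f x * h i x) = (LINT x|lebesgue. complex_of_real (norm (f x * h i x)))"
        using h[OF i] by (intro Bochner_Integration.integral_cong) (auto simp: good_def simp del: norm_mult)
      also have "\<dots> = complex_of_real (J (h i))" unfolding J_def by (rule integral_complex_of_real)
      finally show "(LINT x|lebesgue. f x * (c i * b i x)) = complex_of_real (y i * (w i * J (h i)))"
        by simp
    qed
    finally have eq: "(LINT x|lebesgue. f x * (\<Sum>i\<in>I. c i * b i x)) = complex_of_real (\<Sum>i\<in>I. y i * (w i * J (h i)))"
      by simp
    have "0 \<le> (\<Sum>i\<in>I. y i * (w i * J (h i)))" using y J0 wi by (intro sum_nonneg) (auto simp: less_imp_le)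
    then have "ennreal (\<Sum>i\<in>I. y i * (w i * J (h i))) = ennreal (norm (LINT x|lebesgue. f x * (\<Sum>i\<in>I. c i * b i x)))"
      unfolding eq norm_of_real by simp
    also have "\<dots> \<le> ennreal K * NH (\<lambda>x. \<Sum>i\<in>I. c i * b i x)" by (intro le I bump)
    also have "\<dots> \<le> ennreal K * seq_norm r' (\<lambda>i. ennreal (y i))" by (intro mult_left_mono NHle) simp
    also have "\<dots> = ennreal (K * enn2real (seq_norm r' (\<lambda>i. ennreal (y i))))"
      using fin K by (simp add: ennreal_mult ennreal_enn2real_if less_top)
    finally show ?thesis using K by (simp add: ennreal_le_iff)
  qed
  have CC: "0 < converse_const" by (rule converse_const_pos)
  have conv: "\<rho> (loc f i) \<le> ennreal converse_const * ennreal k"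
    if k: "\<And>h. good i h \<Longrightarrow> J h \<le> k" for i k
    unfolding loc_def[abs_def]
  proof (rule lorentz_norm_converse_Holder[OF f sets_dyadic_cube emeasure_dyadic_cube_finite])
    fix b B assume b: "b \<in> borel_measurable lebesgue" "\<And>x. x \<notin> dyadic_cube i \<Longrightarrow> b x = 0" "\<And>x. norm (b x) \<le> B"
      "\<And>x. f x * b x = complex_of_real (norm (f x * b x))" "\<rho>' b \<le> 1"
    then have "good i b" unfolding good_def bump_def by blast
    from nnJ[OF this] k[OF this] show "(\<integral>\<^sup>+x. ennreal (norm (f x * b x)) \<partial>lebesgue) \<le> ennreal k"
      by (simp add: ennreal_leI)
  qed simp
  \<comment> \<open>A maximiser need not exist; half of the bound is attained, which is the origin
    of the factor 2. The test sequence concentrated at i shows beforehand that the local norm is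
    finite.\<close>
  have near: "\<exists>h. good i h \<and> \<rho> (loc f i) \<le> ennreal (2 * converse_const * J h)" for i
  proof -
    have wi: "0 < w i" by (rule cube_weight_pos)
    have "J h \<le> K / w i" if "good i h" for h
    proof -
      have "(\<lambda>j. ennreal (if j = i then 1 else 0)) = (\<lambda>j. if j = i then 1 else 0)" by auto
      then have "seq_norm r' (\<lambda>j. ennreal (if j = i then 1 else 0)) = 1"
        using seq_norm_single[OF r_pos(2), of i 1] by simp
      then have "w i * J h \<le> K" using comb[of "{i}" "\<lambda>_. h" "\<lambda>j. if j = i then 1 else 0"] that by simp
      then show ?thesis using wi by (simp add: field_simps)
    qed
    then have "\<rho> (loc f i) \<le> ennreal converse_const * ennreal (K / w i)" by (rule conv)
    also have "\<dots> < top" by (simp add: ennreal_mult_less_top)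
    finally have "\<rho> (loc f i) < top" .
    then obtain a where a: "\<rho> (loc f i) = ennreal a" "0 \<le> a" by (cases "\<rho> (loc f i)") auto
    show ?thesis
    proof (rule ccontr)
      assume no: "\<not> ?thesis"
      have J: "J h \<le> a / (2 * converse_const)" if "good i h" for h
      proof -
        have "\<not> \<rho> (loc f i) \<le> ennreal (2 * converse_const * J h)" using no that by blast
        then have "2 * converse_const * J h < a"
          using a CC J0[of h] by (auto simp: not_le ennreal_less_iff)
        then show ?thesis using CC by (simp add: field_simps)
      qed
      \<comment> \<open>If no h were good enough, the converse of Hoelder's inequality would give a
        <= a/2, so a = 0; but then h = 0 qualifies.\<close>
      have "ennreal a \<le> ennreal converse_const * ennreal (a / (2 * converse_const))"
        unfolding a(1)[symmetric] by (rule conv[OF J])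
      also have "\<dots> = ennreal (a / 2)" using CC a by (simp flip: ennreal_mult)
      finally have "a = 0" using a by (simp add: ennreal_le_iff)
      moreover have "good i (\<lambda>x. 0)" by (auto simp: good_def bump_def blk.gauge_zero)
      ultimately show False using no a by auto
    qed
  qed
  then obtain h where h: "\<And>i. good i (h i)" "\<And>i. \<rho> (loc f i) \<le> ennreal (2 * converse_const * J (h i))" by metis
  show ?thesis
    unfolding NM_eq
  proof (rule seq_norm_converse_Holder[OF conj_pair_r])
    fix y :: "int \<times> (int^'n) \<Rightarrow> real" and I :: "(int \<times> (int^'n)) set"
    assume I: "finite I" and y: "\<And>i. 0 \<le> y i" "\<And>i. i \<notin> I \<Longrightarrow> y i = 0"
    have fin: "seq_norm r' (\<lambda>i. ennreal (y i)) < top"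
      using seq_norm_finite_support[OF r_pos(2) r' I, of y] y by simp
    have "(\<Sum>i\<in>I. ennreal (y i) * (ennreal (w i) * \<rho> (loc f i)))
        \<le> (\<Sum>i\<in>I. ennreal (y i) * (ennreal (w i) * ennreal (2 * converse_const * J (h i))))"
      by (intro sum_mono mult_left_mono h) auto
    also have "\<dots> = ennreal (\<Sum>i\<in>I. y i * (w i * (2 * converse_const * J (h i))))"
    proof (subst sum_ennreal[symmetric])
      have nn: "0 \<le> 2 * converse_const * J (h i)" "0 \<le> w i" for i
        using CC J0 cube_weight_pos[of e i] by (auto simp: less_imp_le)
      show "0 \<le> y i * (w i * (2 * converse_const * J (h i)))" for i
        by (intro mult_nonneg_nonneg nn y)
      have "ennreal (y i) * (ennreal (w i) * ennreal (2 * converse_const * J (h i)))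
          = ennreal (y i * (w i * (2 * converse_const * J (h i))))" for i
        unfolding ennreal_mult[OF y(1) mult_nonneg_nonneg[OF nn(2,1)]] ennreal_mult[OF nn(2,1)] ..
      then show "(\<Sum>i\<in>I. ennreal (y i) * (ennreal (w i) * ennreal (2 * converse_const * J (h i))))
          = (\<Sum>i\<in>I. ennreal (y i * (w i * (2 * converse_const * J (h i)))))" by simp
    qed
    also have "(\<Sum>i\<in>I. y i * (w i * (2 * converse_const * J (h i)))) = 2 * converse_const * (\<Sum>i\<in>I. y i * (w i * J (h i)))"
      by (simp add: sum_distrib_left mult_ac)
    also have "ennreal \<dots> \<le> ennreal (2 * converse_const * (K * enn2real (seq_norm r' (\<lambda>i. ennreal (y i)))))"
      using comb[OF I h(1) y] CC by (intro ennreal_leI mult_left_mono) auto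
    also have "\<dots> = ennreal (2 * converse_const * K) * seq_norm r' (\<lambda>i. ennreal (y i))"
      using fin K CC by (simp add: ennreal_mult ennreal_enn2real_if less_top mult.assoc)
    finally show "(\<Sum>i\<in>I. ennreal (y i) * (ennreal (w i) * \<rho> (loc f i)))
        \<le> ennreal (2 * converse_const * K) * seq_norm r' (\<lambda>i. ennreal (y i))" .
  qed simp
qed

end

subsection \<open>Representation of functionals\<close>

lemma sum_indicator_floor:
  assumes "0 \<le> y" "y \<le> real n"
  shows "\<bar>y - (\<Sum>k\<in>{1..n}. if real k \<le> y then 1 else 0)\<bar> \<le> 1"
proof -
  have "(\<Sum>k\<in>{1..n}. if real k \<le> y then 1 else 0 :: real) = real (card {k\<in>{1..n}. real k \<le> y})"
    by (subst sum.If_cases) (auto simp: Int_def)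
  also have "{k\<in>{1..n}. real k \<le> y} = {1..nat \<lfloor>y\<rfloor>}"
    using assms by (auto simp: le_nat_floor) linarith+
  also have "real (card \<dots>) = real_of_int \<lfloor>y\<rfloor>" using assms by simp
  finally show ?thesis by linarith
qed

context bml_duality
begin

lemma dual_bounded:
  assumes L: "L \<in> dual_space H NH"
  shows "\<exists>K\<ge>0. \<forall>g\<in>H. ennreal (norm (L g)) \<le> ennreal K * NH g"
proof -
  have hom: "L (\<lambda>x. a * g x) = a * L g" if "g \<in> H" for a g
    using L that by (auto simp: dual_space_def)
  have L0: "L (\<lambda>x. 0) = 0" using hom[OF H_zero, of 0] by simp
  have "\<exists>\<delta>>0. \<forall>h\<in>H. NH (\<lambda>x. h x - (\<lambda>x. 0) x) < ennreal \<delta> \<longrightarrow> norm (L h - L (\<lambda>x. 0)) < 1"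
    using L H_zero unfolding dual_space_def mem_Collect_eq by (meson zero_less_one)
  then obtain \<delta> where \<delta>: "0 < \<delta>" "\<And>h. h \<in> H \<Longrightarrow> NH h < ennreal \<delta> \<Longrightarrow> norm (L h) < 1"
    by (auto simp: L0)
  have "ennreal (norm (L g)) \<le> ennreal (1 / \<delta>) * NH g" if g: "g \<in> H" for g
  proof -
    obtain \<nu> where \<nu>: "NH g = ennreal \<nu>" "0 \<le> \<nu>" using NH_finite[OF g] by (cases "NH g") auto
    \<comment> \<open>The slack s > 0 makes the rescaled function strictly smaller than \<delta> and
      covers functions of norm 0.\<close>
    have le: "norm (L g) \<le> (\<nu> + s) / \<delta>" if s: "0 < s" for s
    proof -
      define a where "a = \<delta> / (\<nu> + s)"
      have a: "0 < a" using \<delta> \<nu> s by (simp add: a_def)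
      have "NH (\<lambda>x. complex_of_real a * g x) = ennreal (a * \<nu>)"
        using NH_cmult[OF g, of "complex_of_real a"] a \<nu> by (simp add: ennreal_mult)
      also have "\<dots> < ennreal \<delta>"
        using \<delta> \<nu> s by (intro ennreal_lessI) (auto simp: a_def field_simps)
      finally have "norm (L (\<lambda>x. complex_of_real a * g x)) < 1" using \<delta>(2) H_cmult[OF g] by blast
      then have "a * norm (L g) < 1" using hom[OF g] a by (simp add: norm_mult)
      then show ?thesis using \<delta> \<nu> s by (simp add: a_def field_simps)
    qed
    have "norm (L g) * \<delta> \<le> \<nu> + s" if "0 < s" for s
      using le[OF that] \<delta>(1) by (simp add: pos_le_divide_eq)
    then have "norm (L g) * \<delta> \<le> \<nu>" by (rule field_le_epsilon)
    then have "norm (L g) \<le> 1 / \<delta> * \<nu>" using \<delta> by (simp add: field_simps)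
    then show ?thesis using \<nu> \<delta> by (simp add: ennreal_leI flip: ennreal_mult)
  qed
  then show ?thesis using \<delta> by (intro exI[of _ "1 / \<delta>"]) auto
qed

lemma indicator_bump:
  assumes "A \<in> sets lebesgue" "A \<subseteq> dyadic_cube i"
  shows "bump i (indicator A)"
  unfolding bump_def using assms by (auto simp: indicator_def intro!: exI[of _ 1])

lemma bump_add:
  assumes "bump i g" "bump i h" shows "bump i (\<lambda>x. g x + h x)"
proof -
  obtain B C where "\<And>x. norm (g x) \<le> B" "\<And>x. norm (h x) \<le> C" using assms by (auto simp: bump_def)
  then have "norm (g x + h x) \<le> B + C" for x by (intro norm_triangle_mono)
  then show ?thesis using assms by (auto simp: bump_def)
qed

lemma bump_sum: "finite I \<Longrightarrow> (\<And>k. k \<in> I \<Longrightarrow> bump i (h k)) \<Longrightarrow> bump i (\<lambda>x. \<Sum>k\<in>I. h k x)"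
proof (induction I rule: finite_induct)
  case empty
  then show ?case by (auto simp: bump_def)
qed (simp add: bump_add)

lemma integrable_bump:
  assumes f: "integrable lebesgue f" and h: "bump i h"
  shows "integrable lebesgue (\<lambda>x. f x * h x :: complex)"
proof -
  obtain B where B: "\<And>x. norm (h x) \<le> B" and [measurable]: "h \<in> borel_measurable lebesgue"
    using h by (auto simp: bump_def)
  have "0 \<le> B" using B[of 0] norm_ge_zero order.trans by blast
  show ?thesis
  proof (rule Bochner_Integration.integrable_bound)
    show "integrable lebesgue (\<lambda>x. complex_of_real B * f x)" using f by simp
    show "AE x in lebesgue. norm (f x * h x) \<le> norm (complex_of_real B * f x)"
      using B \<open>0 \<le> B\<close> by (auto simp: norm_mult mult.commute[of B] intro!: mult_left_mono)
  qed (use f in measurable)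
qed

text \<open>Linearity and a bound on H are assumed instead of membership in
  \<open>dual_space\<close>: the norming functionals from Hahn-Banach are represented too, and they
  are not extensional.\<close>

context
  fixes L :: "(real^'n \<Rightarrow> complex) \<Rightarrow> complex" and K :: real
  assumes L_add: "\<And>g h. g \<in> H \<Longrightarrow> h \<in> H \<Longrightarrow> L (\<lambda>x. g x + h x) = L g + L h"
    and L_cmult: "\<And>a g. g \<in> H \<Longrightarrow> L (\<lambda>x. a * g x) = a * L g"
    and K: "0 \<le> K" and L_le: "\<And>g. g \<in> H \<Longrightarrow> ennreal (norm (L g)) \<le> ennreal K * NH g"
begin

lemma L_zero: "L (\<lambda>x. 0) = 0"
  using L_cmult[OF H_zero, of 0] by simp

lemma L_sum: "finite I \<Longrightarrow> (\<And>k. k \<in> I \<Longrightarrow> h k \<in> H) \<Longrightarrow> L (\<lambda>x. \<Sum>k\<in>I. h k x) = (\<Sum>k\<in>I. L (h k))"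
  by (induction I rule: finite_induct) (auto simp: L_zero L_add H_sum)

lemma L_le_gauge:
  assumes h: "bump i h" and A: "0 \<le> A" "\<rho>' h \<le> ennreal A"
  shows "norm (L h) \<le> K / w i * A"
proof -
  have wi: "0 < w i" by (rule cube_weight_pos)
  have "ennreal (w i) * NH h \<le> ennreal A"
    using H_of_finite(2)[OF _ _ bump_finite[OF h]] h A(2) unfolding bump_def by (blast intro: order.trans)
  then have *: "ennreal K * (ennreal (w i) * NH h) \<le> ennreal K * ennreal A" by (rule mult_left_mono) simp
  have "ennreal (w i * norm (L h)) = ennreal (w i) * ennreal (norm (L h))"
    using wi by (simp add: ennreal_mult)
  also have "\<dots> \<le> ennreal (w i) * (ennreal K * NH h)" by (intro mult_left_mono L_le bump_H[OF h]) simp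
  also have "\<dots> \<le> ennreal (K * A)" using * K A by (simp add: ennreal_mult mult_ac)
  finally have "w i * norm (L h) \<le> K * A" using K A by (simp add: ennreal_le_iff)
  then show ?thesis using wi by (simp add: field_simps)
qed

lemma L_indicator_le:
  assumes A: "A \<in> sets lebesgue" "A \<subseteq> dyadic_cube i" "emeasure lebesgue A \<le> ennreal (2 powr real_of_int m)"
  shows "norm (L (indicator A)) \<le> K / w i * (4 * geometric_const (1 / enn2real p') * 2 powr (1 / enn2real p' * m))"
  using geometric_const(2)[OF conj.P(1)]
  by (intro L_le_gauge indicator_bump A conj.lorentz_norm_indicator_le) auto

text \<open>A -> L(1_A) is additive and small on small sets because of its bound by the power 1/p'
  of the measure; real and imaginary parts get separate densities on the cube, extended by
  0.\<close>

lemma cube_density: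
  "\<exists>f. integrable lebesgue f \<and>
     (\<forall>A\<in>sets lebesgue. A \<subseteq> dyadic_cube i \<longrightarrow> L (indicator A) = (LINT x|lebesgue. f x * indicator A x))"
proof -
  let ?Q = "dyadic_cube i :: (real^'n) set"
  define R where "R = restrict_space lebesgue ?Q"
  have sR: "A \<in> sets R \<longleftrightarrow> A \<in> sets lebesgue \<and> A \<subseteq> ?Q" for A
    unfolding R_def by (subst sets_restrict_space_iff) auto
  have mR: "measure R A = measure lebesgue A" "emeasure R A = emeasure lebesgue A" if "A \<in> sets R" for A
    using that sR unfolding R_def by (auto simp: measure_restrict_space emeasure_restrict_space)
  have finR: "finite_measure R"
  proof (rule finite_measureI)
    have "?Q \<in> sets R" by (simp add: sR)
    moreover have "space R = ?Q" by (simp add: R_def space_restrict_space)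
    ultimately show "emeasure R (space R) \<noteq> \<infinity>"
      using mR(2)[of ?Q] emeasure_dyadic_cube_finite[of i] by simp
  qed
  define C where "C = K / w i * (4 * geometric_const (1 / enn2real p'))"
  have C0: "0 \<le> C" unfolding C_def
    using K cube_weight_pos[of e i] geometric_const(2)[OF conj.P(1)] by (auto simp: less_imp_le)
  have Lm: "norm (L (indicator A)) \<le> C * 2 powr (1 / enn2real p' * m)"
    if "A \<in> sets R" "measure R A \<le> 2 powr real_of_int m" for A m
  proof -
    have "emeasure lebesgue A \<le> ennreal (2 powr real_of_int m)"
      using that mR finite_measure.emeasure_eq_measure[OF finR, of A] by (simp add: ennreal_leI)
    then show ?thesis using L_indicator_le[of A i m] that sR by (simp add: C_def mult.assoc)
  qed
  have small: "\<exists>\<delta>>0. \<forall>A\<in>sets R. measure R A < \<delta> \<longrightarrow> norm (L (indicator A)) \<le> \<epsilon>" if "0 < \<epsilon>" for \<epsilon>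
  proof -
    \<comment> \<open>The integer m is chosen with 2^(m/p') <= c, so sets of measure below 2^m have
      value at most C c <= \<epsilon>; the summand 1 keeps c meaningful for C = 0.\<close>
    define c where "c = \<epsilon> / (C + 1)"
    have c: "0 < c" using that C0 by (simp add: c_def)
    define m where "m = \<lfloor>log 2 c * enn2real p'\<rfloor>"
    have pp: "0 < enn2real p'" using conj.P(1) by simp
    have "1 / enn2real p' * real_of_int m \<le> log 2 c"
    proof -
      have "real_of_int m \<le> log 2 c * enn2real p'" unfolding m_def by linarith
      then show ?thesis using pp by (simp add: field_simps)
    qed
    then have "2 powr (1 / enn2real p' * real_of_int m) \<le> 2 powr (log 2 c)" by (intro powr_mono) auto
    then have "C * 2 powr (1 / enn2real p' * real_of_int m) \<le> C * c" using C0 c by (intro mult_left_mono) auto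
    also have "\<dots> \<le> \<epsilon>" using that C0 by (simp add: c_def field_simps)
    finally show ?thesis using Lm[of _ m] by (intro exI[of _ "2 powr real_of_int m"]) force
  qed
  obtain m0 :: int where m0: "measure R (space R) \<le> 2 powr real_of_int m0"
  proof
    let ?s = "measure R (space R) + 1"
    have "?s = 2 powr (log 2 ?s)" by (simp add: add_nonneg_pos)
    also have "\<dots> \<le> 2 powr real_of_int \<lceil>log 2 ?s\<rceil>" by (intro powr_mono) auto
    finally show "measure R (space R) \<le> 2 powr real_of_int \<lceil>log 2 ?s\<rceil>" by simp
  qed
  have bound: "norm (L (indicator A)) \<le> C * 2 powr (1 / enn2real p' * m0)" if "A \<in> sets R" for A
    using Lm[OF that, of m0] m0 finite_measure.bounded_measure[OF finR, of A] by simp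
  have Ladd: "L (indicator (A \<union> B)) = L (indicator A) + L (indicator B)"
    if A: "A \<in> sets R" and B: "B \<in> sets R" and AB: "A \<inter> B = {}" for A B
  proof -
    have "(indicator (A \<union> B) :: real^'n \<Rightarrow> complex) = (\<lambda>x. indicator A x + indicator B x)"
      using AB by (auto simp: indicator_def fun_eq_iff)
    then show ?thesis
      using L_add[OF bump_H[OF indicator_bump] bump_H[OF indicator_bump], of A i B i] A B by (simp add: sR)
  qed
  have "\<exists>g. integrable R g \<and> (\<forall>A\<in>sets R. Re (L (indicator A)) = (\<integral>x. g x * indicator A x \<partial>R))"
  proof (rule additive_density[OF finR])
    show "\<bar>Re (L (indicator A))\<bar> \<le> C * 2 powr (1 / enn2real p' * m0)" if "A \<in> sets R" for A
      using abs_Re_le_cmod[of "L (indicator A)"] bound[OF that] by linarith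
    show "\<exists>\<delta>>0. \<forall>A\<in>sets R. measure R A < \<delta> \<longrightarrow> \<bar>Re (L (indicator A))\<bar> \<le> \<epsilon>" if "0 < \<epsilon>" for \<epsilon>
      using small[OF that] abs_Re_le_cmod order.trans by blast
  qed (simp add: Ladd)
  then obtain g1 where g1: "integrable R g1" "\<And>A. A \<in> sets R \<Longrightarrow> Re (L (indicator A)) = (\<integral>x. g1 x * indicator A x \<partial>R)"
    by blast
  have "\<exists>g. integrable R g \<and> (\<forall>A\<in>sets R. Im (L (indicator A)) = (\<integral>x. g x * indicator A x \<partial>R))"
  proof (rule additive_density[OF finR])
    show "\<bar>Im (L (indicator A))\<bar> \<le> C * 2 powr (1 / enn2real p' * m0)" if "A \<in> sets R" for A
      using abs_Im_le_cmod[of "L (indicator A)"] bound[OF that] by linarith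
    show "\<exists>\<delta>>0. \<forall>A\<in>sets R. measure R A < \<delta> \<longrightarrow> \<bar>Im (L (indicator A))\<bar> \<le> \<epsilon>" if "0 < \<epsilon>" for \<epsilon>
      using small[OF that] abs_Im_le_cmod order.trans by blast
  qed (simp add: Ladd)
  then obtain g2 where g2: "integrable R g2" "\<And>A. A \<in> sets R \<Longrightarrow> Im (L (indicator A)) = (\<integral>x. g2 x * indicator A x \<partial>R)"
    by blast
  define g where "g x = complex_of_real (g1 x) + \<i> * complex_of_real (g2 x)" for x
  have gint: "integrable R g" unfolding g_def using g1(1) g2(1) by simp
  define f where "f x = indicator ?Q x *\<^sub>R g x" for x
  have "integrable lebesgue f"
    using gint integrable_restrict_space[of ?Q lebesgue g] unfolding R_def f_def[abs_def] by (simp add: set_integrable_def)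
  moreover have "L (indicator A) = (LINT x|lebesgue. f x * indicator A x)" if A: "A \<in> sets R" for A
  proof -
    have i1: "integrable R (\<lambda>x. g1 x * indicator A x)" "integrable R (\<lambda>x. g2 x * indicator A x)"
      using integrable_real_mult_indicator[OF A] g1(1) g2(1) by auto
    have "(\<integral>x. g x * indicator A x \<partial>R)
        = (\<integral>x. complex_of_real (g1 x * indicator A x) + \<i> * complex_of_real (g2 x * indicator A x) \<partial>R)"
      by (intro Bochner_Integration.integral_cong) (auto simp: g_def indicator_def)
    also have "\<dots> = (\<integral>x. complex_of_real (g1 x * indicator A x) \<partial>R) + (\<integral>x. \<i> * complex_of_real (g2 x * indicator A x) \<partial>R)"
      using i1 by (intro Bochner_Integration.integral_add integrable_mult_right integrable_of_real) auto
    also have "\<dots> = complex_of_real (\<integral>x. g1 x * indicator A x \<partial>R) + \<i> * complex_of_real (\<integral>x. g2 x * indicator A x \<partial>R)"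
      by (simp only: integral_mult_right_zero integral_complex_of_real)
    also have "\<dots> = L (indicator A)" using g1(2)[OF A] g2(2)[OF A] by (simp add: complex_eq_iff)
    finally have "L (indicator A) = (\<integral>x. g x * indicator A x \<partial>R)" by simp
    also have "\<dots> = (LINT x|lebesgue. indicator ?Q x *\<^sub>R (g x * indicator A x))"
      unfolding R_def by (subst integral_restrict_space) (auto simp: set_lebesgue_integral_def)
    finally show ?thesis by (simp add: f_def)
  qed
  ultimately show ?thesis using sR by blast
qed

text \<open>The defect D vanishes on indicators and is bounded by the supremum norm on the cube.
  Hence it vanishes on functions with values in [0, 1], which are uniform limits of layer sums, and
  by affine rescaling on all bounded functions.\<close>

lemma density_bump:
  assumes f: "integrable lebesgue f"
    and fA: "\<And>A. A \<in> sets lebesgue \<Longrightarrow> A \<subseteq> dyadic_cube i \<Longrightarrow> L (indicator A) = (LINT x|lebesgue. f x * indicator A x)"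
    and h: "bump i h"
  shows "L h = (LINT x|lebesgue. f x * h x)"
proof -
  let ?Q = "dyadic_cube i :: (real^'n) set"
  define D where "D h = L h - (LINT x|lebesgue. f x * h x)" for h
  have D_add: "D (\<lambda>x. g x + h x) = D g + D h" if "bump i g" "bump i h" for g h
    using that integrable_bump[OF f] by (simp add: D_def L_add bump_H distrib_left)
  have D_cmult: "D (\<lambda>x. a * h x) = a * D h" if "bump i h" for a h
    using that L_cmult[OF bump_H[OF that]] by (simp add: D_def right_diff_distrib mult.left_commute)
  have D_zero: "D (\<lambda>x. 0) = 0" by (simp add: D_def L_zero)
  have D_sum: "D (\<lambda>x. \<Sum>k\<in>I. h k x) = (\<Sum>k\<in>I. D (h k))" if "finite I" "\<And>k. k \<in> I \<Longrightarrow> bump i (h k)" for I and h :: "nat \<Rightarrow> real^'n \<Rightarrow> complex"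
    using that by (induction I rule: finite_induct) (auto simp: D_zero D_add bump_sum)
  have D_ind: "D (indicator A) = 0" if "A \<in> sets lebesgue" "A \<subseteq> ?Q" for A
    using fA[OF that] by (simp add: D_def)
  have bQ: "bump i (indicator ?Q)" by (intro indicator_bump) auto
  obtain c where c: "\<rho>' (indicator ?Q) = ennreal c" "0 \<le> c"
    using bump_finite[OF bQ] by (cases "\<rho>' (indicator ?Q)") auto
  define C where "C = K / w i * c + (LINT x|lebesgue. norm (f x))"
  have D_le: "norm (D h) \<le> \<eta> * C" if h: "bump i h" and \<eta>: "0 \<le> \<eta>" "\<And>x. norm (h x) \<le> \<eta>" for h \<eta>
  proof -
    have "\<rho>' h \<le> \<rho>' (\<lambda>x. complex_of_real \<eta> * indicator ?Q x)"
      using h \<eta> by (intro conj.lorentz_norm_mono) (auto simp: bump_def indicator_def)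
    also have "\<dots> = ennreal (\<eta> * c)"
      using c \<eta> by (subst conj.lorentz_norm_cmult) (auto simp: ennreal_mult)
    finally have "norm (L h) \<le> K / w i * (\<eta> * c)" using \<eta> c by (intro L_le_gauge[OF h]) auto
    moreover have "norm (LINT x|lebesgue. f x * h x) \<le> (LINT x|lebesgue. \<eta> * norm (f x))"
    proof (rule order.trans[OF integral_norm_bound integral_mono])
      show "integrable lebesgue (\<lambda>x. norm (f x * h x))" by (intro integrable_norm integrable_bump[OF f h])
      show "integrable lebesgue (\<lambda>x. \<eta> * norm (f x))" using f by simp
      show "norm (f x * h x) \<le> \<eta> * norm (f x)" for x
        unfolding norm_mult mult.commute[of \<eta>] by (intro mult_left_mono \<eta>) simp
    qed
    moreover have "(LINT x|lebesgue. \<eta> * norm (f x)) = \<eta> * (LINT x|lebesgue. norm (f x))" by simp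
    ultimately show ?thesis
      using norm_triangle_ineq4[of "L h" "LINT x|lebesgue. f x * h x"] unfolding D_def C_def by (simp add: algebra_simps)
  qed
  have unit: "D (\<lambda>x. complex_of_real (g x) * indicator ?Q x) = 0"
    if g [measurable]: "g \<in> borel_measurable lebesgue" and g01: "\<And>x. 0 \<le> g x" "\<And>x. g x \<le> 1" for g :: "real^'n \<Rightarrow> real"
  proof -
    let ?h = "\<lambda>x. complex_of_real (g x) * indicator ?Q x"
    have bh: "bump i ?h"
      unfolding bump_def using g01
      by (auto simp: indicator_def norm_mult intro!: borel_measurable_times borel_measurable_indicator exI[of _ 1]) 
    have le: "norm (D ?h) \<le> 1 / real n * C" if n: "0 < n" for n
    proof -
      define A where "A k = {x \<in> ?Q. real k / real n \<le> g x}" for k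
      have A: "A k \<in> sets lebesgue" "A k \<subseteq> ?Q" for k
      proof -
        have "{x \<in> space lebesgue. real k / real n \<le> g x} \<in> sets lebesgue" by measurable
        then have "?Q \<inter> {x. real k / real n \<le> g x} \<in> sets lebesgue" by (intro sets.Int) auto
        then show "A k \<in> sets lebesgue" by (simp add: A_def Int_def)
      qed (auto simp: A_def)
      \<comment> \<open>On the cube s is floor(n g) / n, since the layers start at k = 1; the error
        is at most 1/n.\<close>
      define s where "s x = (\<Sum>k\<in>{1..n}. complex_of_real (1 / n) * indicator (A k) x)" for x
      have bs: "bump i s" unfolding s_def[abs_def] by (intro bump_sum bump_cmult indicator_bump A) auto
      have "D (\<lambda>x. complex_of_real (1 / n) * indicator (A k) x) = 0" for k
        by (simp only: D_cmult[OF indicator_bump[OF A]] D_ind[OF A] mult_zero_right)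
      then have "D s = 0"
        unfolding s_def[abs_def] by (subst D_sum) (auto intro: bump_cmult[OF indicator_bump[OF A]] simp del: of_real_divide)
      moreover have "norm (D (\<lambda>x. ?h x + (-1) * s x)) \<le> 1 / real n * C"
      proof (rule D_le)
        show "bump i (\<lambda>x. ?h x + (-1) * s x)" by (intro bump_add bump_cmult bh bs)
        show "norm (?h x + (-1) * s x) \<le> 1 / real n" for x
        proof (cases "x \<in> ?Q")
          case True
          have "s x = complex_of_real (1 / n * (\<Sum>k\<in>{1..n}. if real k \<le> n * g x then 1 else 0))"
            unfolding s_def of_real_mult of_real_sum sum_distrib_left
            using n True by (intro sum.cong) (auto simp: A_def field_simps)
          then have "?h x + (-1) * s x = complex_of_real (1 / n * (n * g x - (\<Sum>k\<in>{1..n}. if real k \<le> n * g x then 1 else 0)))"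
            using True n by (simp add: field_simps)
          then have "norm (?h x + (-1) * s x) = 1 / n * \<bar>n * g x - (\<Sum>k\<in>{1..n}. if real k \<le> n * g x then 1 else 0)\<bar>"
            by (simp only: norm_of_real abs_mult) simp
          also have "\<dots> \<le> 1 / n * 1"
            using g01[of x] n by (intro mult_left_mono sum_indicator_floor) (auto intro: mult_left_le)
          finally show ?thesis by simp
        next
          case False
          then have "s x = 0" unfolding s_def A_def by (intro sum.neutral) auto
          then show ?thesis using False n by simp
        qed
      qed simp
      moreover have "D (\<lambda>x. ?h x + (-1) * s x) = D ?h + (-1) * D s"
        using D_add[OF bh bump_cmult[OF bs, of "-1"]] D_cmult[OF bs, of "-1"] by simp
      ultimately show ?thesis by simp
    qed
    have "norm (D ?h) \<le> 0"
    proof (rule tendsto_lowerbound)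
      show "(\<lambda>n. 1 / real n * C) \<longlonglongrightarrow> 0" using tendsto_mult_left_zero[OF lim_1_over_n, of C] by simp
      show "eventually (\<lambda>n. norm (D ?h) \<le> 1 / real n * C) sequentially"
        using eventually_gt_at_top[of 0] by eventually_elim (rule le)
    qed simp
    then show ?thesis by simp
  qed
  obtain B0 where B0: "\<And>x. norm (h x) \<le> B0" using h by (auto simp: bump_def)
  define B where "B = max 1 B0"
  have B: "0 < B" "norm (h x) \<le> B" for x using B0[of x] by (auto simp: B_def)
  have [measurable]: "h \<in> borel_measurable lebesgue" using h by (simp add: bump_def)
  \<comment> \<open>Dividing by 2 B and adding 1/2 moves real and imaginary parts into [0, 1]; the
    added constants are later compensated by a multiple of the indicator of the cube.\<close>
  define g1 g2 where "g1 x = Re (h x) / (2 * B) + 1 / 2" and "g2 x = Im (h x) / (2 * B) + 1 / 2" for x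
  have g1: "g1 \<in> borel_measurable lebesgue" "0 \<le> g1 x" "g1 x \<le> 1" for x
  proof -
    have "\<bar>Re (h x) / (2 * B)\<bar> \<le> 1 / 2"
      using abs_Re_le_cmod[of "h x"] B(1) B(2)[of x] by (simp add: abs_divide divide_le_eq)
    then show "0 \<le> g1 x" "g1 x \<le> 1" unfolding g1_def abs_le_iff by linarith+
    show "g1 \<in> borel_measurable lebesgue" unfolding g1_def[abs_def] by measurable
  qed
  have g2: "g2 \<in> borel_measurable lebesgue" "0 \<le> g2 x" "g2 x \<le> 1" for x
  proof -
    have "\<bar>Im (h x) / (2 * B)\<bar> \<le> 1 / 2"
      using abs_Im_le_cmod[of "h x"] B(1) B(2)[of x] by (simp add: abs_divide divide_le_eq)
    then show "0 \<le> g2 x" "g2 x \<le> 1" unfolding g2_def abs_le_iff by linarith+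
    show "g2 \<in> borel_measurable lebesgue" unfolding g2_def[abs_def] by measurable
  qed
  let ?G1 = "\<lambda>x. complex_of_real (g1 x) * indicator ?Q x"
  let ?G2 = "\<lambda>x. complex_of_real (g2 x) * indicator ?Q x"
  have bG: "bump i ?G1" "bump i ?G2"
    unfolding bump_def using g1 g2
    by (auto simp: indicator_def norm_mult intro!: borel_measurable_times borel_measurable_indicator exI[of _ 1])
  have "h = (\<lambda>x. (2 * B) * ?G1 x + ((2 * B * \<i>) * ?G2 x + (- B * (1 + \<i>)) * indicator ?Q x))"
  proof
    fix x
    show "h x = (2 * B) * ?G1 x + ((2 * B * \<i>) * ?G2 x + (- B * (1 + \<i>)) * indicator ?Q x)"
    proof (cases "x \<in> ?Q")
      case True
      then show ?thesis using B(1) by (simp add: complex_eq_iff g1_def g2_def field_simps)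
    qed (use h in \<open>auto simp: bump_def\<close>)
  qed
  moreover have "D (\<lambda>x. (2 * B) * ?G1 x + ((2 * B * \<i>) * ?G2 x + (- B * (1 + \<i>)) * indicator ?Q x)) = 0"
    unfolding D_add[OF bump_cmult[OF bG(1)] bump_add[OF bump_cmult[OF bG(2)] bump_cmult[OF bQ]]]
      D_add[OF bump_cmult[OF bG(2)] bump_cmult[OF bQ]] D_cmult[OF bG(1)] D_cmult[OF bG(2)] D_cmult[OF bQ]
    using unit[OF g1] unit[OF g2] D_ind[of ?Q] by simp
  ultimately have "D h = 0" by simp
  then show ?thesis by (simp add: D_def)
qed

text \<open>Unit cubes partition space, so their densities glue without any compatibility condition;
  a test function on an arbitrary cube is the finite sum of its restrictions to unit cubes.\<close>

lemma global_density:
  "\<exists>f. f \<in> borel_measurable lebesgue \<and>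
     (\<forall>i h. bump i h \<longrightarrow> integrable lebesgue (\<lambda>x. f x * h x) \<and> L h = (LINT x|lebesgue. f x * h x))"
proof -
  have "\<exists>F. \<forall>m. integrable lebesgue (F m) \<and> (\<forall>A\<in>sets lebesgue. A \<subseteq> dyadic_cube (0, m) \<longrightarrow>
      L (indicator A) = (LINT x|lebesgue. F m x * indicator A x))"
    by (intro choice allI cube_density)
  then obtain F where F: "\<And>m. integrable lebesgue (F m)"
    "\<And>m A. A \<in> sets lebesgue \<Longrightarrow> A \<subseteq> dyadic_cube (0, m) \<Longrightarrow> L (indicator A) = (LINT x|lebesgue. F m x * indicator A x)"
    by blast
  \<comment> \<open>The vector of integer parts selects the unit cube containing x.\<close>
  define f where "f x = F (\<chi> k. \<lfloor>x $ k\<rfloor>) x" for x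
  have "(\<lambda>x. F (\<chi> k. \<lfloor>x $ k\<rfloor>) x) \<in> borel_measurable lebesgue"
  proof (rule measurable_compose_countable'[where I=UNIV and f=F])
    show "(\<lambda>x::real^'n. (\<chi> k. \<lfloor>x $ k\<rfloor>)) \<in> measurable lebesgue (count_space UNIV)"
      unfolding measurable_count_space_eq2_countable
    proof (intro conjI ballI)
      fix m :: "int^'n"
      have "(\<lambda>x::real^'n. (\<chi> k. \<lfloor>x $ k\<rfloor>)) -` {m} = dyadic_cube (0, m)"
        using dyadic_cube_unique dyadic_cube_cover[of _ 0] by auto
      then show "(\<lambda>x::real^'n. (\<chi> k. \<lfloor>x $ k\<rfloor>)) -` {m} \<inter> space lebesgue \<in> sets lebesgue" by simp
    qed auto
  qed (use F(1) in auto)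
  then have fm: "f \<in> borel_measurable lebesgue" by (simp add: f_def[abs_def])
  have "integrable lebesgue (\<lambda>x. f x * h x) \<and> L h = (LINT x|lebesgue. f x * h x)" if h: "bump i h" for i h
  proof -
    define S where "S = {m. dyadic_cube (0, m) \<inter> dyadic_cube i \<noteq> ({} :: (real^'n) set)}"
    have S: "finite S" unfolding S_def by (rule dyadic_cube_finite_unit_cover)
    define u where "u m x = h x * indicator (dyadic_cube (0, m)) x" for m x
    have um: "u m \<in> borel_measurable lebesgue" for m
      unfolding u_def using h by (intro borel_measurable_times borel_measurable_indicator) (auto simp: bump_def)
    obtain B where B: "\<And>x. norm (h x) \<le> B" using h by (auto simp: bump_def)
    have uB: "norm (u m x) \<le> B" for m x
      using B[of x] norm_ge_zero[of "h x"] by (auto simp: u_def indicator_def simp del: norm_ge_zero)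
    have bu: "bump (0, m) (u m)" for m
      unfolding bump_def using um uB by (auto simp: u_def)
    have hsum: "h x = (\<Sum>m\<in>S. u m x)" for x
    proof (cases "x \<in> dyadic_cube i")
      case True
      let ?m = "\<chi> k. \<lfloor>x $ k\<rfloor>"
      have xm: "x \<in> dyadic_cube (0, ?m)" using dyadic_cube_cover[of x 0] by simp
      have "?m \<in> S" using xm True by (auto simp: S_def)
      moreover have "u m x = 0" if "m \<noteq> ?m" for m
        using that dyadic_cube_unique[of x m] by (auto simp: u_def indicator_def)
      ultimately have "(\<Sum>m\<in>S. u m x) = (\<Sum>m\<in>{?m}. u m x)" using S by (intro sum.mono_neutral_right) auto
      then show ?thesis using xm by (simp add: u_def)
    next
      case False
      then have "h x = 0" using h by (simp add: bump_def)
      then show ?thesis by (simp add: u_def)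
    qed
    have fu: "f x * u m x = F m x * u m x" for m x
      using dyadic_cube_unique[of x m] by (cases "x \<in> dyadic_cube (0, m)") (auto simp: f_def u_def)
    have iu: "integrable lebesgue (\<lambda>x. f x * u m x)" for m
      unfolding fu by (rule integrable_bump[OF F(1) bu])
    have Lu: "L (u m) = (LINT x|lebesgue. f x * u m x)" for m
      unfolding fu by (rule density_bump[OF F bu])
    have fh: "f x * h x = (\<Sum>m\<in>S. f x * u m x)" for x
      by (simp add: hsum[of x] sum_distrib_left)
    have "h = (\<lambda>x. \<Sum>m\<in>S. u m x)" using hsum by (simp add: fun_eq_iff)
    then have "L h = (\<Sum>m\<in>S. L (u m))" using L_sum[OF S, of u] bump_H[OF bu] by simp
    then show ?thesis unfolding fh Lu using iu by simp
  qed
  then show ?thesis using fm by blast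
qed

text \<open>Dominated convergence along an enumeration of the cubes, available because r' is
  finite.\<close>

lemma lseq_norm_tail:
  fixes c :: "int \<times> (int^'n) \<Rightarrow> complex"
  assumes fin: "lseq_norm r' c < top"
  shows "(\<lambda>n. lseq_norm r' (\<lambda>i. if i \<in> {i. to_nat i < n} then 0 else c i)) \<longlonglongrightarrow> 0"
proof -
  define R where "R = enn2real r'"
  have R: "0 < R" unfolding R_def using r_pos(2) r' by (simp add: enn2real_positive_iff)
  define X where "X n i = ennreal (norm (if i \<in> {i. to_nat i < n} then 0 else c i)) ennpowr R" for n i
  have lse: "lseq_norm r' d = (\<integral>\<^sup>+i. ennreal (norm (d i)) ennpowr R \<partial>count_space UNIV) ennpowr (1 / R)"
    for d :: "int \<times> (int^'n) \<Rightarrow> complex"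
    using r' by (auto simp: lseq_norm_eq seq_norm_def R_def)
  have "(\<lambda>n. \<integral>\<^sup>+i. X n i \<partial>count_space UNIV) \<longlonglongrightarrow> (\<integral>\<^sup>+i. 0 \<partial>(count_space UNIV :: (int \<times> (int^'n)) measure))"
  proof (rule nn_integral_dominated_convergence[where w="\<lambda>i. ennreal (norm (c i)) ennpowr R"])
    show "(\<integral>\<^sup>+i. ennreal (norm (c i)) ennpowr R \<partial>count_space UNIV) < \<infinity>" using fin by (simp add: lse)
    show "AE i in count_space UNIV. X n i \<le> ennreal (norm (c i)) ennpowr R" for n by (simp add: X_def)
    have "eventually (\<lambda>n. X n i = 0) sequentially" for i
      unfolding eventually_sequentially by (intro exI[of _ "Suc (to_nat i)"]) (auto simp: X_def)
    then show "AE i in count_space UNIV. (\<lambda>n. X n i) \<longlonglongrightarrow> 0" by (simp add: tendsto_eventually)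
  qed auto
  then have "(\<lambda>n. \<integral>\<^sup>+i. X n i \<partial>count_space UNIV) \<longlonglongrightarrow> 0" by simp
  then show ?thesis
    unfolding lse X_def using R by (intro ennpowr_tendsto_0) auto
qed

text \<open>\<open>D = L - L\<^sub>f\<close> is bounded and vanishes on bounded functions supported in a cube; truncation
  extends this to blocks, and the tails of a representation tend to \<open>0\<close> because \<open>r' < \<infinity>\<close>.\<close>

theorem representation:
  "\<exists>f\<in>M. NM f \<le> ennreal (2 * converse_const * K) \<and> (\<forall>g\<in>H. L g = (LINT x|lebesgue. f x * g x))"
proof -
  obtain f where f: "f \<in> borel_measurable lebesgue"
    "\<And>i h. bump i h \<Longrightarrow> integrable lebesgue (\<lambda>x. f x * h x)"
    "\<And>i h. bump i h \<Longrightarrow> L h = (LINT x|lebesgue. f x * h x)"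
    using global_density by blast
  have NMf: "NM f \<le> ennreal (2 * converse_const * K)"
  proof (rule NM_le[OF f(1) K f(2)])
    fix I h assume I: "finite I" and h: "\<And>i. i \<in> I \<Longrightarrow> bump i (h i)"
    have "(LINT x|lebesgue. f x * (\<Sum>i\<in>I. h i x)) = (\<Sum>i\<in>I. LINT x|lebesgue. f x * h i x)"
      unfolding sum_distrib_left by (intro Bochner_Integration.integral_sum f(2)[OF h])
    also have "\<dots> = (\<Sum>i\<in>I. L (h i))" by (intro sum.cong refl f(3)[symmetric, OF h])
    also have "\<dots> = L (\<lambda>x. \<Sum>i\<in>I. h i x)" using L_sum[OF I, of h] bump_H[OF h] by simp
    finally show "ennreal (norm (LINT x|lebesgue. f x * (\<Sum>i\<in>I. h i x))) \<le> ennreal K * NH (\<lambda>x. \<Sum>i\<in>I. h i x)"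
      using L_le[OF H_sum[OF I bump_H[OF h]]] by simp
  qed
  then have fM: "f \<in> M" using f(1) by (auto simp: bml_space_def intro: le_less_trans)
  define D where "D g = L g - (LINT x|lebesgue. f x * g x)" for g
  define C where "C = ennreal K + 64 * NM f"
  have C: "C < top" unfolding C_def using NM_finite[OF fM] by (simp add: ennreal_mult_less_top)
  have D_add: "D (\<lambda>x. g x + h x) = D g + D h" if "g \<in> H" "h \<in> H" for g h
    using that pairing_integrable[OF fM] by (simp add: D_def L_add distrib_left)
  have D_cmult: "D (\<lambda>x. a * h x) = a * D h" if "h \<in> H" for a h
    using that L_cmult[OF that] by (simp add: D_def right_diff_distrib mult.left_commute)
  have D_le: "ennreal (norm (D g)) \<le> C * NH g" if g: "g \<in> H" for g
  proof -
    have "ennreal (norm (D g)) \<le> ennreal (norm (L g)) + ennreal (norm (LINT x|lebesgue. f x * g x))"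
      unfolding D_def by (simp add: norm_triangle_ineq4 ennreal_leI flip: ennreal_plus)
    also have "\<dots> \<le> ennreal K * NH g + 64 * NM f * NH g"
      by (intro add_mono L_le pairing_integral_le g fM)
    finally show ?thesis by (simp add: C_def distrib_right)
  qed
  have D_lim: "D g = 0" if X: "X \<longlonglongrightarrow> 0" and le: "\<And>n :: nat. ennreal (norm (D g)) \<le> C * X n" for g X
  proof -
    have "(\<lambda>n. C * X n) \<longlonglongrightarrow> C * 0" using C X by (intro ennreal_tendsto_cmult) auto
    then have "ennreal (norm (D g)) \<le> C * 0"
      by (rule tendsto_lowerbound) (simp_all add: le)
    then show ?thesis by simp
  qed
  have D_block: "D b = 0" if b: "gen_block \<rho>' e i b" for b i
  proof (rule D_lim)
    \<comment> \<open>T n is the large part of b. The rest is bounded by n, so D vanishes on it and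
      D b = D (T n) for every n, while the norms of T n tend to 0.\<close>
    define T where "T n x = b x * indicator {x. real n < norm (b x)} x" for n x
    have bm: "b \<in> borel_measurable lebesgue" and bs: "\<And>x. x \<notin> dyadic_cube i \<Longrightarrow> b x = 0"
      using b by (auto simp: gen_block_def)
    have bfin: "\<rho>' b < top" using b by (auto simp: gen_block_def intro: le_less_trans)
    have Tm: "T n \<in> borel_measurable lebesgue" for n
      unfolding T_def using sets_superlevel[OF bm] by (intro borel_measurable_times borel_measurable_indicator bm) auto
    have Ts: "T n x = 0" if "x \<notin> dyadic_cube i" for n x using bs[OF that] by (simp add: T_def)
    have "\<rho>' (T n) \<le> \<rho>' b" for n
      by (intro conj.lorentz_norm_mono bm) (auto simp: T_def indicator_def)
    then have Tfin: "\<rho>' (T n) < top" for n using bfin le_less_trans by blast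
    have wi: "0 < w i" by (rule cube_weight_pos)
    have TH: "T n \<in> H" "NH (T n) \<le> ennreal (1 / w i) * \<rho>' (T n)" for n
    proof -
      show "T n \<in> H" by (rule H_of_finite(1)[OF Tm Ts Tfin])
      have "ennreal (1 / w i) * (ennreal (w i) * NH (T n)) \<le> ennreal (1 / w i) * \<rho>' (T n)"
        by (intro mult_left_mono H_of_finite(2)[OF Tm Ts Tfin]) auto
      then show "NH (T n) \<le> ennreal (1 / w i) * \<rho>' (T n)" using wi by (simp flip: mult.assoc ennreal_mult)
    qed
    have rest: "bump i (\<lambda>x. b x - T n x)" for n
      unfolding bump_def using bm Tm bs Ts
      by (auto simp: T_def indicator_def intro!: exI[of _ "real n"])
    have "D (\<lambda>x. b x - T n x) = 0" for n using f(3)[OF rest[of n]] by (simp add: D_def)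
    then have "D b = D (T n)" for n using D_add[OF bump_H[OF rest] TH(1), of n n] by simp
    then show "ennreal (norm (D b)) \<le> C * (ennreal (1 / w i) * \<rho>' (T n))" for n
      using D_le[OF TH(1)[of n]] mult_left_mono[OF TH(2)[of n], of C] by (simp add: order.trans)
    have "(\<lambda>n. ennreal (1 / w i) * \<rho>' (T n)) \<longlonglongrightarrow> ennreal (1 / w i) * 0"
      unfolding T_def[abs_def] by (intro ennreal_tendsto_cmult conj.lorentz_norm_truncation_tendsto bm bfin) simp
    then show "(\<lambda>n. ennreal (1 / w i) * \<rho>' (T n)) \<longlonglongrightarrow> 0" by simp
  qed
  have "D g = 0" if g: "g \<in> H" for g
  proof -
    obtain c b where rep: "blk.rep g c b" using g by (auto simp: H_iff)
    have blk: "gen_block \<rho>' e i (b i)" for i using rep by (rule gen_representation_block)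
    have bH: "b i \<in> H" for i
      using blk[of i] by (intro H_of_finite(1)[of "b i" i]) (auto simp: gen_block_def intro: le_less_trans)
    define G where "G n = {i :: int \<times> (int^'n). to_nat i < n}" for n
    have G: "finite (G n)" for n
      unfolding G_def using finite_vimageI[of "{..<n}" to_nat] by (simp add: vimage_def lessThan_def)
    show ?thesis
    proof (rule D_lim)
      show "(\<lambda>n. lseq_norm r' (\<lambda>i. if i \<in> G n then 0 else c i)) \<longlonglongrightarrow> 0"
        unfolding G_def using rep by (intro lseq_norm_tail) (simp add: gen_representation_def)
      fix n
      define s where "s x = (\<Sum>i\<in>G n. c i * b i x)" for x
      have sH: "s \<in> H" unfolding s_def[abs_def] by (intro H_sum G H_cmult bH)
      have D_s: "D (\<lambda>x. \<Sum>i\<in>J. c i * b i x) = 0" if "finite J" for J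
        using that
      proof (induction J rule: finite_induct)
        case empty
        then show ?case by (simp add: D_def L_zero)
      next
        case (insert j J)
        then show ?case
          using D_add[OF H_cmult[OF bH[of j], of "c j"] H_sum[OF insert.hyps(1), of "\<lambda>i x. c i * b i x"]]
          by (simp add: D_cmult[OF bH] D_block[OF blk] H_cmult[OF bH])
      qed
      have gs: "(\<lambda>x. g x - s x) \<in> H" by (rule H_diff[OF g sH])
      then have Dg: "D g = D (\<lambda>x. g x - s x)"
        using D_add[of "\<lambda>x. g x - s x" s] sH D_s[OF G[of n]] by (simp add: s_def[abs_def])
      have "NH (\<lambda>x. g x - s x) \<le> lseq_norm r' (\<lambda>i. if i \<in> G n then 0 else c i)"
        unfolding NH_eq s_def by (rule gen_norm_le[OF blk.rep_tail[OF rep G]])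
      from mult_left_mono[OF this, of C]
      show "ennreal (norm (D g)) \<le> C * lseq_norm r' (\<lambda>i. if i \<in> G n then 0 else c i)"
        using D_le[OF gs] unfolding Dg by simp
    qed
  qed
  then have "L g = (LINT x|lebesgue. f x * g x)" if "g \<in> H" for g using that by (simp add: D_def)
  then show ?thesis using fM NMf by blast
qed

end

end

subsection \<open>Norming functionals\<close>

text \<open>A representation in one gauge becomes one in another as soon as the blocks are
  comparable; the comparison constant moves into the coefficients.\<close>

lemma (in block_gauge) rep_change:
  assumes rep: "gen_representation \<tau> e s g c b" and C: "0 < C"
    and le: "\<And>i. \<sigma> (b i) \<le> ennreal C * ennreal (cube_weight e i)"
  shows "N g \<le> ennreal C * lseq_norm s c"
proof -
  have blk: "gen_block \<tau> e i (b i)" for i using rep by (rule gen_representation_block)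
  have bm: "b i \<in> borel_measurable lebesgue" for i using blk[of i] by (rule gen_block_measurable)
  have cC: "lseq_norm s (\<lambda>i. complex_of_real (C * norm (c i))) = ennreal C * lseq_norm s c"
    using lseq_norm_cmult[OF s_pos, of "complex_of_real C" c] C by (simp add: lseq_norm_eq norm_mult)
  have r: "rep g (\<lambda>i. complex_of_real (C * norm (c i)))
      (\<lambda>i x. complex_of_real (1 / (C * norm (c i))) * (c i * b i x))"
  proof (rule rep_family)
    show "(\<lambda>x. c i * b i x) \<in> borel_measurable lebesgue" for i
      by (intro borel_measurable_times borel_measurable_const bm)
    show "c i * b i x = 0" if "x \<notin> dyadic_cube i" for i x using blk[of i] that by (simp add: gen_block_def)
    show "c i * b i x = 0" if "C * norm (c i) = 0" for i x using that C by simp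
    have "\<sigma> (\<lambda>x. c i * b i x) \<le> ennreal (norm (c i)) * (ennreal C * ennreal (cube_weight e i))" for i
      unfolding gauge_cmult[OF bm] by (intro mult_left_mono le) simp
    then show "\<sigma> (\<lambda>x. c i * b i x) \<le> ennreal (C * norm (c i)) * ennreal (cube_weight e i)" for i
      using C by (simp add: ennreal_mult mult_ac)
  qed (use C rep cC in \<open>auto simp: gen_representation_def ennreal_mult_less_top\<close>)
  show "N g \<le> ennreal C * lseq_norm s c"
    unfolding cC[symmetric] by (rule gen_norm_le[OF r])
qed

context bml_duality
begin

text \<open>The associate (Koethe dual) norm of the Lorentz functional with exponents p and q;
  unlike the conjugate Lorentz functional it satisfies the triangle inequality with constant
  1.\<close>

definition assoc :: "(real^'n \<Rightarrow> complex) \<Rightarrow> ennreal" where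
  "assoc b = (SUP h\<in>{h \<in> borel_measurable lebesgue. \<rho> h \<le> 1}. \<integral>\<^sup>+x. ennreal (norm (b x * h x)) \<partial>lebesgue)"

lemma assoc_upper: "h \<in> borel_measurable lebesgue \<Longrightarrow> \<rho> h \<le> 1 \<Longrightarrow> (\<integral>\<^sup>+x. ennreal (norm (b x * h x)) \<partial>lebesgue) \<le> assoc b"
  unfolding assoc_def by (rule SUP_upper) auto

sublocale asc: block_gauge assoc 1 e r' r
proof
  fix f g :: "real^'n \<Rightarrow> complex" and a
  assume [measurable]: "f \<in> borel_measurable lebesgue"
  have eq: "(\<integral>\<^sup>+x. ennreal (norm (a * f x * h x)) \<partial>lebesgue) = ennreal (norm a) * (\<integral>\<^sup>+x. ennreal (norm (f x * h x)) \<partial>lebesgue)"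
    if [measurable]: "h \<in> borel_measurable lebesgue" for h
    by (subst nn_integral_cmult[symmetric]) (auto simp: norm_mult ennreal_mult mult.assoc)
  show "assoc (\<lambda>x. a * f x) = ennreal (norm a) * assoc f"
    unfolding assoc_def SUP_mult_left_ennreal by (intro SUP_cong refl eq) simp
  assume [measurable]: "g \<in> borel_measurable lebesgue"
  have "(\<integral>\<^sup>+x. ennreal (norm ((f x + g x) * h x)) \<partial>lebesgue) \<le> assoc f + assoc g"
    if h [measurable]: "h \<in> borel_measurable lebesgue" and h1: "\<rho> h \<le> 1" for h
  proof -
    have "(\<integral>\<^sup>+x. ennreal (norm ((f x + g x) * h x)) \<partial>lebesgue)
       \<le> (\<integral>\<^sup>+x. ennreal (norm (f x * h x)) + ennreal (norm (g x * h x)) \<partial>lebesgue)"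
      by (intro nn_integral_mono) (simp add: distrib_right norm_triangle_ineq ennreal_leI flip: ennreal_plus)
    also have "\<dots> = (\<integral>\<^sup>+x. ennreal (norm (f x * h x)) \<partial>lebesgue) + (\<integral>\<^sup>+x. ennreal (norm (g x * h x)) \<partial>lebesgue)"
      by (intro nn_integral_add) measurable
    also have "\<dots> \<le> assoc f + assoc g" by (intro add_mono assoc_upper h h1)
    finally show ?thesis .
  qed
  then show "assoc (\<lambda>x. f x + g x) \<le> ennreal 1 * (assoc f + assoc g)"
    unfolding assoc_def[of "\<lambda>x. f x + g x"] by (auto intro!: SUP_least)
qed (use conj_pair_sym[OF conj_pair_r] in auto)

lemma assoc_le: "b \<in> borel_measurable lebesgue \<Longrightarrow> assoc b \<le> 64 * \<rho>' b"
  unfolding assoc_def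
proof (rule SUP_least, clarify)
  fix h :: "real^'n \<Rightarrow> complex" assume b: "b \<in> borel_measurable lebesgue" and h: "h \<in> borel_measurable lebesgue" "\<rho> h \<le> 1"
  have "(\<integral>\<^sup>+x. ennreal (norm (b x * h x)) \<partial>lebesgue) \<le> 64 * (\<rho> h * \<rho>' b)"
    using lorentz_norm_Holder[OF h(1) b] by (simp add: mult.commute)
  also have "\<dots> \<le> 64 * (1 * \<rho>' b)" by (intro mult_left_mono mult_right_mono h) auto
  finally show "(\<integral>\<^sup>+x. ennreal (norm (b x * h x)) \<partial>lebesgue) \<le> 64 * \<rho>' b" by simp
qed

text \<open>The converse of Hoelder's inequality with the exponents interchanged, where the
  associate norm itself is the bound K; C depends neither on the cube nor on b.\<close>

lemma gauge_le_assoc: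
  "\<exists>C>0. \<forall>b i. b \<in> borel_measurable lebesgue \<longrightarrow> (\<forall>x. x \<notin> dyadic_cube i \<longrightarrow> b x = 0) \<longrightarrow> assoc b < top \<longrightarrow>
     \<rho>' b \<le> ennreal C * assoc b"
proof -
  interpret swp: lorentz_pair p' q' p q by (rule swapped)
  have "\<rho>' b \<le> ennreal swp.converse_const * assoc b"
    if b: "b \<in> borel_measurable lebesgue" and s: "\<forall>x. x \<notin> dyadic_cube i \<longrightarrow> b x = 0" and fin: "assoc b < top" for b i
  proof -
    have "(\<lambda>x. b x * indicator (dyadic_cube i) x) = b"
      using s by (auto simp: fun_eq_iff indicator_def)
    then show ?thesis
      using swp.lorentz_norm_converse_Holder[OF b sets_dyadic_cube[of i] emeasure_dyadic_cube_finite fin] assoc_upper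
      by simp
  qed
  then show ?thesis using swp.converse_const_pos by blast
qed

lemma NA_le: assumes "g \<in> H" shows "asc.N g \<le> 64 * NH g"
proof -
  obtain c b where "blk.rep g c b" using assms by (auto simp: H_iff)
  have le: "asc.N g \<le> 64 * lseq_norm r' c" if rep: "blk.rep g c b" for c b
  proof -
    have blk: "gen_block \<rho>' e i (b i)" for i using rep by (rule gen_representation_block)
    have "assoc (b i) \<le> ennreal 64 * ennreal (w i)" for i
    proof -
      have "assoc (b i) \<le> 64 * \<rho>' (b i)" by (rule assoc_le[OF gen_block_measurable[OF blk]])
      also have "\<dots> \<le> 64 * ennreal (w i)" using blk[of i] by (intro mult_left_mono) (auto simp: gen_block_def)
      finally show ?thesis by simp
    qed
    then show ?thesis using asc.rep_change[OF rep, of 64] by simp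
  qed
  have "asc.N g / 64 \<le> NH g"
    unfolding NH_eq
  proof (rule gen_norm_greatest)
    fix c b assume "blk.rep g c b"
    from divide_right_mono_ennreal[OF le[OF this], of 64]
    show "asc.N g / 64 \<le> lseq_norm r' c" by (simp add: mult_divide_eq_ennreal mult.commute[of 64])
  qed
  then have "64 * (asc.N g / 64) \<le> 64 * NH g" by (rule mult_left_mono) simp
  then show ?thesis by (simp add: ennreal_times_divide mult_divide_eq_ennreal mult.commute[of 64])
qed

lemma NH_le: "\<exists>C>0. \<forall>g. NH g \<le> ennreal C * asc.N g"
proof -
  obtain C where C: "0 < C" "\<And>b i. b \<in> borel_measurable lebesgue \<Longrightarrow> (\<forall>x. x \<notin> dyadic_cube i \<longrightarrow> b x = 0) \<Longrightarrow>
      assoc b < top \<Longrightarrow> \<rho>' b \<le> ennreal C * assoc b"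
    using gauge_le_assoc by blast
  have le: "NH g \<le> ennreal C * lseq_norm r' c" if rep: "asc.rep g c b" for g c b
    unfolding NH_eq
  proof (rule blk.rep_change[OF rep C(1)])
    fix i
    have blk: "gen_block assoc e i (b i)" using rep by (rule gen_representation_block)
    then have "\<rho>' (b i) \<le> ennreal C * assoc (b i)"
      by (intro C(2)[of _ i]) (auto simp: gen_block_def intro: le_less_trans)
    also have "\<dots> \<le> ennreal C * ennreal (w i)" using blk by (intro mult_left_mono) (auto simp: gen_block_def)
    finally show "\<rho>' (b i) \<le> ennreal C * ennreal (w i)" .
  qed
  have "NH g \<le> ennreal C * asc.N g" for g
  proof -
    have "ennreal (1 / C) * NH g \<le> asc.N g"
    proof (rule gen_norm_greatest)
      fix c b assume "asc.rep g c b"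
      then have "ennreal (1 / C) * NH g \<le> ennreal (1 / C) * (ennreal C * lseq_norm r' c)" by (intro mult_left_mono le) simp_all
      also have "\<dots> = lseq_norm r' c" using C by (simp flip: mult.assoc ennreal_mult)
      finally show "ennreal (1 / C) * NH g \<le> lseq_norm r' c" .
    qed
    then have "ennreal C * (ennreal (1 / C) * NH g) \<le> ennreal C * asc.N g" by (rule mult_left_mono) simp
    then show ?thesis using C by (simp flip: mult.assoc ennreal_mult)
  qed
  then show ?thesis using C by blast
qed

text \<open>Hahn-Banach is applied to the block norm built from \<open>assoc\<close>. The constant
  128 is 64 from comparing the two block norms times 2 for combining real and imaginary
  parts.\<close>

lemma norming_functional:
  assumes g0: "g0 \<in> H"
  shows "\<exists>L. (\<forall>g\<in>H. \<forall>h\<in>H. L (\<lambda>x. g x + h x) = L g + L h) \<and> (\<forall>a. \<forall>g\<in>H. L (\<lambda>x. a * g x) = a * L g) \<and>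
     (\<forall>g\<in>H. ennreal (norm (L g)) \<le> ennreal 128 * NH g) \<and> asc.N g0 \<le> ennreal (norm (L g0))"
proof -
  interpret sublinear_space H
    by unfold_locales (auto intro: H_zero H_add H_cmult)
  define n where "n g = enn2real (asc.N g)" for g
  have fin: "asc.N g < top" if "g \<in> H" for g
    using NA_le[OF that] NH_finite[OF that] by (auto simp: ennreal_mult_less_top intro: le_less_trans)
  have n: "asc.N g = ennreal (n g)" if "g \<in> H" for g
    using fin[OF that] by (simp add: n_def ennreal_enn2real_if less_top)
  have n0: "0 \<le> n g" for g by (simp add: n_def)
  have n_cmult: "n (\<lambda>x. a * g x) = norm a * n g" if "g \<in> H" for a g
    using asc.N_cmult[OF H_measurable[OF that], of a] by (simp add: n_def enn2real_mult)
  have "sublinear n"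
    unfolding sublinear_def
  proof (intro conjI ballI allI impI)
    fix g h assume g: "g \<in> H" and h: "h \<in> H"
    have "ennreal (n (\<lambda>x. g x + h x)) \<le> ennreal (n g) + ennreal (n h)"
      using asc.N_add[OF H_measurable[OF g] H_measurable[OF h]] n[OF g] n[OF h] n[OF H_add[OF g h]] by simp
    then show "n (\<lambda>x. g x + h x) \<le> n g + n h"
      using n0 by (simp add: ennreal_le_iff flip: ennreal_plus)
  qed (simp add: n_cmult)
  from linear_minorant[OF this g0] obtain l where l_add: "\<And>g h. g \<in> H \<Longrightarrow> h \<in> H \<Longrightarrow> l (\<lambda>x. g x + h x) = l g + l h"
    and l_scale: "\<And>t g. g \<in> H \<Longrightarrow> l (\<lambda>x. complex_of_real t * g x) = t * l g"
    and l_le: "\<And>g. g \<in> H \<Longrightarrow> l g \<le> n g" and l0: "n g0 \<le> l g0" by blast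
  have l_abs: "\<bar>l g\<bar> \<le> n g" if "g \<in> H" for g
  proof -
    have "- l g \<le> n g" using l_le[OF H_cmult[OF that, of "-1"]] l_scale[OF that, of "-1"] n_cmult[OF that, of "-1"] by simp
    then show ?thesis using l_le[OF that] by simp
  qed
  \<comment> \<open>The standard complexification: its real part is l, and it commutes with
    multiplication by the imaginary unit.\<close>
  define L where "L g = complex_of_real (l g) - \<i> * complex_of_real (l (\<lambda>x. \<i> * g x))" for g
  have "L (\<lambda>x. g x + h x) = L g + L h" if "g \<in> H" "h \<in> H" for g h
    using that l_add[OF that] l_add[OF H_cmult[OF that(1), of \<i>] H_cmult[OF that(2), of \<i>]]
    by (simp add: L_def algebra_simps)
  moreover have "L (\<lambda>x. a * g x) = a * L g" if g: "g \<in> H" for a g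
  proof -
    define x y where "x = Re a" and "y = Im a"
    have a: "a = complex_of_real x + complex_of_real y * \<i>" by (simp add: x_def y_def complex_eq_iff)
    have ig: "(\<lambda>x. \<i> * g x) \<in> H" by (rule H_cmult[OF g])
    have "l (\<lambda>s. a * g s) = l (\<lambda>s. complex_of_real x * g s + complex_of_real y * (\<i> * g s))"
      by (rule arg_cong[of _ _ l]) (auto simp: a algebra_simps)
    also have "\<dots> = x * l g + y * l (\<lambda>s. \<i> * g s)"
      using l_add[OF H_cmult[OF g] H_cmult[OF ig]] l_scale[OF g] l_scale[OF ig] by simp
    finally have 1: "l (\<lambda>s. a * g s) = x * l g + y * l (\<lambda>s. \<i> * g s)" .
    have "l (\<lambda>s. \<i> * (a * g s)) = l (\<lambda>s. complex_of_real x * (\<i> * g s) + complex_of_real (- y) * g s)"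
      by (rule arg_cong[of _ _ l]) (auto simp: a algebra_simps)
    also have "\<dots> = x * l (\<lambda>s. \<i> * g s) + (- y) * l g"
      by (simp only: l_add[OF H_cmult[OF ig] H_cmult[OF g]] l_scale[OF g] l_scale[OF ig])
    finally have 2: "l (\<lambda>s. \<i> * (a * g s)) = x * l (\<lambda>s. \<i> * g s) + (- y) * l g" .
    show ?thesis unfolding L_def 1 2 unfolding a by (simp add: complex_eq_iff)
  qed
  moreover have "ennreal (norm (L g)) \<le> ennreal 128 * NH g" if g: "g \<in> H" for g
  proof -
    have "norm (L g) \<le> \<bar>l g\<bar> + \<bar>l (\<lambda>x. \<i> * g x)\<bar>"
      unfolding L_def using norm_triangle_ineq4[of "complex_of_real (l g)" "\<i> * complex_of_real (l (\<lambda>x. \<i> * g x))"]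
      by (simp add: norm_mult)
    also have "\<dots> \<le> n g + n g"
      using l_abs[OF g] l_abs[OF H_cmult[OF g, of \<i>]] n_cmult[OF g, of \<i>] by simp
    finally have "ennreal (norm (L g)) \<le> 2 * asc.N g"
      using n[OF g] n0[of g] by (simp add: ennreal_leI flip: ennreal_mult' ennreal_numeral)
    also have "\<dots> \<le> 2 * (64 * NH g)" by (intro mult_left_mono NA_le g) simp
    finally show ?thesis by (simp flip: mult.assoc)
  qed
  moreover have "asc.N g0 \<le> ennreal (norm (L g0))"
  proof -
    have "n g0 \<le> Re (L g0)" using l0 by (simp add: L_def)
    also have "\<dots> \<le> norm (L g0)" by (rule complex_Re_le_cmod)
    finally show ?thesis using n[OF g0] by (simp add: ennreal_leI)
  qed
  ultimately show ?thesis by blast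
qed

subsection \<open>Duality\<close>

lemma integral_functional_dual:
  assumes f: "f \<in> M"
  shows "integral_functional H f \<in> dual_space H NH"
proof -
  have ap: "integral_functional H f g = (LINT x|lebesgue. f x * g x)" if "g \<in> H" for g
    using that by (simp add: integral_functional_def)
  have "\<exists>\<delta>>0. \<forall>h\<in>H. NH (\<lambda>x. h x - g x) < ennreal \<delta> \<longrightarrow> norm (integral_functional H f h - integral_functional H f g) < \<epsilon>"
    if g: "g \<in> H" and \<epsilon>: "0 < \<epsilon>" for g \<epsilon>
  proof -
    obtain \<nu> where \<nu>: "NM f = ennreal \<nu>" "0 \<le> \<nu>" using NM_finite[OF f] by (cases "NM f") auto
    \<comment> \<open>The summand 1 avoids division by 0 for \<nu> = 0 and makes the final
      inequality strict.\<close>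
    define \<delta> where "\<delta> = \<epsilon> / (64 * \<nu> + 1)"
    have \<delta>: "0 < \<delta>" using \<epsilon> \<nu> by (simp add: \<delta>_def)
    show ?thesis
    proof (intro exI conjI ballI impI)
      fix h assume h: "h \<in> H" and lt: "NH (\<lambda>x. h x - g x) < ennreal \<delta>"
      have hg: "(\<lambda>x. h x - g x) \<in> H" by (rule H_diff[OF h g])
      have "integral_functional H f h - integral_functional H f g = (LINT x|lebesgue. f x * (h x - g x))"
        using pairing_integrable[OF f h] pairing_integrable[OF f g] by (simp add: ap h g right_diff_distrib)
      then have "ennreal (norm (integral_functional H f h - integral_functional H f g)) \<le> 64 * NM f * NH (\<lambda>x. h x - g x)"
        using pairing_integral_le[OF f hg] by simp
      also have "\<dots> \<le> 64 * NM f * ennreal \<delta>" using lt by (intro mult_left_mono) auto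
      also have "\<dots> = ennreal (64 * \<nu> * \<delta>)" using \<nu> \<delta> by (simp add: ennreal_mult)
      finally have "norm (integral_functional H f h - integral_functional H f g) \<le> 64 * \<nu> * \<delta>"
        using \<nu> \<delta> by (simp add: ennreal_le_iff)
      also have "\<dots> < \<epsilon>" using \<epsilon> \<nu> by (simp add: \<delta>_def field_simps)
      finally show "norm (integral_functional H f h - integral_functional H f g) < \<epsilon>" .
    qed (rule \<delta>)
  qed
  moreover have "integral_functional H f (\<lambda>x. g x + h x) = integral_functional H f g + integral_functional H f h"
    if "g \<in> H" "h \<in> H" for g h
    using pairing_integrable[OF f that(1)] pairing_integrable[OF f that(2)] that H_add[OF that]
    by (simp add: ap distrib_left)
  moreover have "integral_functional H f (\<lambda>x. a * g x) = a * integral_functional H f g" if "g \<in> H" for a g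
    using that H_cmult[OF that] by (simp add: ap mult.left_commute)
  ultimately show ?thesis by (auto simp: dual_space_def integral_functional_def)
qed

lemma dual_is_integral_functional:
  assumes L: "L \<in> dual_space H NH"
  shows "\<exists>f\<in>M. L = integral_functional H f"
proof -
  obtain K where K: "0 \<le> K" "\<And>g. g \<in> H \<Longrightarrow> ennreal (norm (L g)) \<le> ennreal K * NH g"
    using dual_bounded[OF L] by blast
  have "\<exists>f\<in>M. NM f \<le> ennreal (2 * converse_const * K) \<and> (\<forall>g\<in>H. L g = (LINT x|lebesgue. f x * g x))"
    by (rule representation) (use L K in \<open>auto simp: dual_space_def\<close>)
  then obtain f where f: "f \<in> M" "\<And>g. g \<in> H \<Longrightarrow> L g = (LINT x|lebesgue. f x * g x)" by blast
  have "L = integral_functional H f"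
    unfolding integral_functional_def
    by (rule extensionalityI[of _ H]) (use L f in \<open>auto simp: dual_space_def\<close>)
  then show ?thesis using f by blast
qed

definition sphere_norm :: "(real^'n \<Rightarrow> complex) \<Rightarrow> ennreal" where
  "sphere_norm f = (SUP k\<in>{k \<in> H. NH k = 1}. ennreal (norm (LINT x|lebesgue. f x * k x)))"

lemma sphere_norm_le_dual: "sphere_norm f \<le> dual_norm H NH (integral_functional H f)"
  unfolding sphere_norm_def dual_norm_def
  by (rule SUP_mono) (auto simp: integral_functional_def intro!: bexI)

lemma dual_norm_le: "f \<in> M \<Longrightarrow> dual_norm H NH (integral_functional H f) \<le> 64 * NM f"
  unfolding dual_norm_def
proof (rule SUP_least, clarify)
  fix g assume f: "f \<in> M" and g: "g \<in> H" "NH g \<le> 1"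
  have "ennreal (norm (integral_functional H f g)) \<le> 64 * NM f * NH g"
    using pairing_integral_le[OF f g(1)] g by (simp add: integral_functional_def)
  also have "\<dots> \<le> 64 * NM f * 1" by (intro mult_left_mono g) simp
  finally show "ennreal (norm (integral_functional H f g)) \<le> 64 * NM f" by simp
qed

text \<open>Normalising g is possible only for nonzero norm; for norm 0 the pairing bound shows that
  the integral vanishes.\<close>

lemma pairing_le_sphere_norm:
  assumes f: "f \<in> M" and g: "g \<in> H"
  shows "ennreal (norm (LINT x|lebesgue. f x * g x)) \<le> sphere_norm f * NH g"
proof (cases "NH g = 0")
  case True
  then show ?thesis using pairing_integral_le[OF f g] by simp
next
  case False
  then obtain \<nu> where \<nu>: "NH g = ennreal \<nu>" "0 < \<nu>"
    using NH_finite[OF g] by (cases "NH g") (auto simp: less_le)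
  define k where "k x = complex_of_real (1 / \<nu>) * g x" for x
  have k: "k \<in> H" unfolding k_def[abs_def] by (rule H_cmult[OF g])
  have k1: "NH k = 1"
    unfolding k_def[abs_def] NH_cmult[OF g] using \<nu> by (simp add: norm_divide flip: ennreal_mult)
  have "(LINT x|lebesgue. f x * g x) = (LINT x|lebesgue. complex_of_real \<nu> * (f x * k x))"
    using \<nu> by (intro Bochner_Integration.integral_cong) (auto simp: k_def)
  then have "(LINT x|lebesgue. f x * g x) = complex_of_real \<nu> * (LINT x|lebesgue. f x * k x)" by simp
  then have "ennreal (norm (LINT x|lebesgue. f x * g x)) = ennreal (norm (LINT x|lebesgue. f x * k x)) * ennreal \<nu>"
    using \<nu> by (simp add: norm_mult mult.commute flip: ennreal_mult)
  also have "\<dots> \<le> sphere_norm f * NH g"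
    unfolding sphere_norm_def \<nu>(1) using k k1 by (intro mult_right_mono SUP_upper) auto
  finally show ?thesis .
qed

text \<open>The sphere norm is finite and bounds the pairing with all of H, so it can serve as the
  constant K in \<open>NM_le\<close>.\<close>

lemma NM_le_sphere_norm:
  assumes f: "f \<in> M"
  shows "NM f \<le> ennreal (2 * converse_const) * sphere_norm f"
proof -
  have "sphere_norm f \<le> 64 * NM f" using sphere_norm_le_dual dual_norm_le[OF f] order.trans by blast
  also have "\<dots> < top" using NM_finite[OF f] by (simp add: ennreal_mult_less_top)
  finally obtain S where S: "sphere_norm f = ennreal S" "0 \<le> S" by (cases "sphere_norm f") auto
  have "NM f \<le> ennreal (2 * converse_const * S)"
  proof (rule NM_le[OF M_measurable[OF f] S(2)])
    show "integrable lebesgue (\<lambda>x. f x * h x)" if "bump i h" for i h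
      by (rule pairing_integrable[OF f bump_H[OF that]])
    show "ennreal (norm (LINT x|lebesgue. f x * (\<Sum>i\<in>I. h i x))) \<le> ennreal S * NH (\<lambda>x. \<Sum>i\<in>I. h i x)"
      if "finite I" "\<And>i. i \<in> I \<Longrightarrow> bump i (h i)" for I h
      using pairing_le_sphere_norm[OF f H_sum[OF that(1) bump_H[OF that(2)]]] by (simp add: S)
  qed
  then show ?thesis using S converse_const_pos by (simp add: ennreal_mult)
qed

text \<open>Equal functionals give a difference of sphere norm 0, hence of space norm 0; its
  restriction to each of the countably many unit cubes then vanishes almost everywhere.\<close>

lemma integral_functional_eq_iff:
  assumes f: "f \<in> M" and g: "g \<in> M"
  shows "integral_functional H f = integral_functional H g \<longleftrightarrow> (AE x in lebesgue. f x = g x)"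
proof
  assume ae: "AE x in lebesgue. f x = g x"
  show "integral_functional H f = integral_functional H g"
    unfolding integral_functional_def
  proof (intro restrict_ext integral_cong_AE)
    fix k assume k: "k \<in> H"
    note [measurable] = M_measurable[OF f] M_measurable[OF g] H_measurable[OF k]
    show "(\<lambda>x. f x * k x) \<in> borel_measurable lebesgue" "(\<lambda>x. g x * k x) \<in> borel_measurable lebesgue" by measurable
    show "AE x in lebesgue. f x * k x = g x * k x" using ae by eventually_elim simp
  qed
next
  assume eq: "integral_functional H f = integral_functional H g"
  define h where "h x = f x + (-1) * g x" for x
  have h: "h \<in> M" unfolding h_def[abs_def] by (intro M_add M_cmult f g)
  have "(LINT x|lebesgue. h x * k x) = 0" if k: "k \<in> H" for k
  proof -
    have "(LINT x|lebesgue. f x * k x) = (LINT x|lebesgue. g x * k x)"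
      using fun_cong[OF eq, of k] k by (simp add: integral_functional_def)
    then show ?thesis
      using pairing_integrable[OF f k] pairing_integrable[OF g k] by (simp add: h_def left_diff_distrib)
  qed
  then have "sphere_norm h \<le> 0" unfolding sphere_norm_def by (intro SUP_least) auto
  then have "NM h = 0" using NM_le_sphere_norm[OF h] by simp
  have "AE x in lebesgue. loc h (0, m) x = 0" for m
  proof (rule AE_zero_of_rearrangement)
    show "loc h (0, m) \<in> borel_measurable lebesgue" using M_measurable[OF h] by measurable
    fix k :: int
    have "ennreal (w (0, m)) * \<rho> (loc h (0, m)) \<le> NM h" unfolding NM_eq by (rule le_seq_norm[OF r_pos(1)])
    then have "\<rho> (loc h (0, m)) = 0"
      using \<open>NM h = 0\<close> cube_weight_pos[of e "(0, m)"] by (auto simp: ennreal_eq_0_iff)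
    then have "dyadic_norm P q (loc h (0, m)) = 0" using dyadic_norm_le_lorentz[of "loc h (0, m)"] by simp
    then have "ennreal (2 powr (P * k)) * rearrangement (loc h (0, m)) (2 powr k) = 0"
      using le_seq_norm[OF q_pos, of "\<lambda>k. ennreal (2 powr (P * real_of_int k)) * rearrangement (loc h (0, m)) (2 powr real_of_int k)" k]
      by (simp add: dyadic_norm_def)
    then show "rearrangement (loc h (0, m)) (2 powr k) = 0" by (simp add: ennreal_eq_0_iff)
  qed
  then have "AE x in lebesgue. \<forall>m. loc h (0, m) x = 0" by (subst AE_all_countable) simp
  then show "AE x in lebesgue. f x = g x"
  proof eventually_elim
    case (elim x)
    have "x \<in> dyadic_cube (0, \<chi> k. \<lfloor>x $ k\<rfloor>)" using dyadic_cube_cover[of x 0] by simp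
    then have "h x = 0" using elim[rule_format, of "\<chi> k. \<lfloor>x $ k\<rfloor>"] by (simp add: loc_def)
    then show ?case by (simp add: h_def)
  qed
qed

text \<open>A functional norming g is represented by some f in M whose norm is bounded independently
  of g; after normalisation f is a competitor in the supremum.\<close>

lemma NH_le_sphere_norm:
  "\<exists>C>0. \<forall>g\<in>H. NH g \<le> ennreal C * (SUP k\<in>{k \<in> M. NM k = 1}. ennreal (norm (LINT x|lebesgue. g x * k x)))"
proof -
  obtain C where C: "0 < C" "\<And>g. NH g \<le> ennreal C * asc.N g" using NH_le by blast
  define C3 where "C3 = 2 * converse_const * 128"
  have C3: "0 < C3" using converse_const_pos by (simp add: C3_def)
  have "NH g \<le> ennreal (C * C3) * (SUP k\<in>{k \<in> M. NM k = 1}. ennreal (norm (LINT x|lebesgue. g x * k x)))"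
    (is "_ \<le> _ * ?S") if g: "g \<in> H" for g
  proof -
    obtain L where L: "\<And>g h. g \<in> H \<Longrightarrow> h \<in> H \<Longrightarrow> L (\<lambda>x. g x + h x) = L g + L h"
      "\<And>a g. g \<in> H \<Longrightarrow> L (\<lambda>x. a * g x) = a * L g"
      "\<And>g. g \<in> H \<Longrightarrow> ennreal (norm (L g)) \<le> ennreal 128 * NH g" "asc.N g \<le> ennreal (norm (L g))"
      using norming_functional[OF g] by blast
    obtain f where f: "f \<in> M" "NM f \<le> ennreal C3" "L g = (LINT x|lebesgue. f x * g x)"
    proof -
      have "\<exists>f\<in>M. NM f \<le> ennreal (2 * converse_const * 128) \<and> (\<forall>g\<in>H. L g = (LINT x|lebesgue. f x * g x))"
        by (rule representation[OF L(1,2) _ L(3)]) simp_all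
      then show ?thesis using that g unfolding C3_def by blast
    qed
    have "ennreal (norm (L g)) \<le> ennreal C3 * ?S"
    proof (cases "NM f = 0")
      case True
      then show ?thesis using pairing_integral_le[OF f(1) g] f(3) by simp
    next
      case False
      then obtain \<nu> where \<nu>: "NM f = ennreal \<nu>" "0 < \<nu>"
        using NM_finite[OF f(1)] by (cases "NM f") (auto simp: less_le)
      define k where "k x = complex_of_real (1 / \<nu>) * f x" for x
      have k: "k \<in> M" unfolding k_def[abs_def] by (rule M_cmult[OF f(1)])
      have k1: "NM k = 1"
        unfolding k_def[abs_def] NM_cmult[OF M_measurable[OF f(1)]] using \<nu>
        by (simp add: norm_divide flip: ennreal_mult)
      have "(LINT x|lebesgue. f x * g x) = (LINT x|lebesgue. complex_of_real \<nu> * (g x * k x))"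
        using \<nu> by (intro Bochner_Integration.integral_cong) (auto simp: k_def)
      then have "L g = complex_of_real \<nu> * (LINT x|lebesgue. g x * k x)" by (simp add: f(3))
      then have "ennreal (norm (L g)) = ennreal \<nu> * ennreal (norm (LINT x|lebesgue. g x * k x))"
        using \<nu> by (simp add: norm_mult flip: ennreal_mult)
      also have "\<dots> \<le> ennreal C3 * ?S"
        using f(2) k k1 unfolding \<nu>(1) by (intro mult_mono SUP_upper) auto
      finally show ?thesis .
    qed
    then have "ennreal C * asc.N g \<le> ennreal C * (ennreal C3 * ?S)"
      using L(4) by (intro mult_left_mono) (auto intro: order.trans)
    then show ?thesis using C(2)[of g] C(1) C3 by (simp add: ennreal_mult mult.assoc)
  qed
  then show ?thesis using C(1) C3 by (intro exI[of _ "C * C3"]) auto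
qed

end

theorem theorem3p5:
  fixes p q t r p' q' t' r' :: ennreal
    and M H :: "(real^'n \<Rightarrow> complex) set"
  assumes "1 < q" "q < \<infinity>"
    and "(1 < p \<and> p < t \<and> t < r \<and> r < \<infinity>) \<or> (1 < p \<and> p \<le> t \<and> t < r \<and> r = \<infinity>)"
    and "p' = conj_exponent p" "q' = conj_exponent q"
        "t' = conj_exponent t" "r' = conj_exponent r"
    and "M = bml_space p q t r" "H = block_space p' q' t' r'"
  shows
    "(\<forall>f\<in>M. (\<forall>g\<in>H. integrable lebesgue (\<lambda>x. f x * g x)) \<and>
        integral_functional H f \<in> dual_space H (block_norm p' q' t' r')) \<and>
     (\<forall>L\<in>dual_space H (block_norm p' q' t' r'). \<exists>f\<in>M. L = integral_functional H f) \<and>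
     isomorphism_onto_dual M (bml_norm p q t r) H (block_norm p' q' t' r')
        (integral_functional H) \<and>
     equivalent_on M (bml_norm p q t r)
        (\<lambda>f. SUP k\<in>{k \<in> H. block_norm p' q' t' r' k = 1}.
               ennreal (norm (LINT x|lebesgue. f x * k x))) \<and>
     equivalent_on H (block_norm p' q' t' r')
        (\<lambda>g. SUP k\<in>{k \<in> M. bml_norm p q t r k = 1}.
               ennreal (norm (LINT x|lebesgue. g x * k x)))"
proof -
  have p: "1 < p" "p < top" and t: "1 < t" "t < top" and r: "1 < r"
    using assms(3) by (auto simp: less_top[symmetric] top_unique)
  have "conj_pair p p'" "conj_pair q q'" "conj_pair t t'" "conj_pair r r'"
    using p t r assms by (auto intro: conj_pair_conj_exponent)
  moreover have "1 < p'" "p' < top" "1 < q'" "q' < top"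
    using calculation p assms(1,2) by (auto simp: conj_pair_def)
  ultimately interpret D: bml_duality p q p' q' t t' r r' "TYPE('n)"
    using p t r assms(1,2) by unfold_locales auto
  have M: "M = D.M" and H: "H = D.H" using assms by auto
  \<comment> \<open>\<open>equivalent_on\<close> asks for one constant in both directions, so the
    two one-sided constants are added.\<close>
  let ?c = "64 + 2 * D.converse_const"
  have c: "0 < ?c" "64 \<le> ennreal ?c" "ennreal (2 * D.converse_const) \<le> ennreal ?c"
    using D.converse_const_pos ennreal_leI[of 64 ?c] by (auto intro!: ennreal_leI)
  have up: "D.NM f \<le> ennreal ?c * D.sphere_norm f" if "f \<in> M" for f
    by (rule order.trans[OF D.NM_le_sphere_norm mult_right_mono[OF c(3)]]) (use that M in auto)
  have low: "dual_norm D.H D.NH (integral_functional D.H f) \<le> ennreal ?c * D.NM f" if "f \<in> M" for f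
    by (rule order.trans[OF D.dual_norm_le mult_right_mono[OF c(2)]]) (use that M in auto)
  have low': "D.sphere_norm f \<le> ennreal ?c * D.NM f" if "f \<in> M" for f
    by (rule order.trans[OF D.sphere_norm_le_dual low[OF that]])
  have up': "D.NM f \<le> ennreal ?c * dual_norm D.H D.NH (integral_functional D.H f)" if "f \<in> M" for f
    by (rule order.trans[OF up[OF that]], rule mult_left_mono[OF D.sphere_norm_le_dual]) simp
  have eq1: "equivalent_on M D.NM D.sphere_norm"
    unfolding equivalent_on_def by (intro exI[of _ ?c] conjI ballI c(1) up low')
  have eq2: "equivalent_on M D.NM (\<lambda>f. dual_norm D.H D.NH (integral_functional D.H f))"
    unfolding equivalent_on_def by (intro exI[of _ ?c] conjI ballI c(1) up' low)
  obtain C where C: "0 < C" "\<And>g. g \<in> D.H \<Longrightarrow>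
      D.NH g \<le> ennreal C * (SUP k\<in>{k \<in> D.M. D.NM k = 1}. ennreal (norm (LINT x|lebesgue. g x * k x)))"
    using D.NH_le_sphere_norm by blast
  have "(SUP k\<in>{k \<in> D.M. D.NM k = 1}. ennreal (norm (LINT x|lebesgue. g x * k x))) \<le> 64 * D.NH g"
    if g: "g \<in> D.H" for g
  proof (rule SUP_least, clarify)
    fix k assume k: "k \<in> D.M" "D.NM k = 1"
    show "ennreal (norm (LINT x|lebesgue. g x * k x)) \<le> 64 * D.NH g"
      using D.pairing_integral_le[OF k(1) g] k(2) by (simp add: mult.commute)
  qed
  then have low2: "(SUP k\<in>{k \<in> D.M. D.NM k = 1}. ennreal (norm (LINT x|lebesgue. g x * k x))) \<le> ennreal (64 + C) * D.NH g"
    if "g \<in> D.H" for g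
    using that C(1) by (intro order.trans[OF _ mult_right_mono[of 64 "ennreal (64 + C)"]]) (auto simp: ennreal_leI simp flip: ennreal_numeral)
  have up2: "D.NH g \<le> ennreal (64 + C) * (SUP k\<in>{k \<in> D.M. D.NM k = 1}. ennreal (norm (LINT x|lebesgue. g x * k x)))"
    if "g \<in> D.H" for g
    by (rule order.trans[OF C(2)[OF that]], rule mult_right_mono) (auto intro: ennreal_leI)
  have eq3: "equivalent_on H D.NH (\<lambda>g. SUP k\<in>{k \<in> D.M. D.NM k = 1}. ennreal (norm (LINT x|lebesgue. g x * k x)))"
    unfolding equivalent_on_def H using C(1) low2 up2 by (intro exI[of _ "64 + C"]) auto
  have ap: "integral_functional D.H f k = (LINT x|lebesgue. f x * k x)" if "k \<in> D.H" for f k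
    using that by (simp add: integral_functional_def)
  have "isomorphism_onto_dual M D.NM H D.NH (integral_functional H)"
    unfolding isomorphism_onto_dual_def
  proof (intro conjI)
    show "complex_function_space M" "complex_function_space H"
      unfolding complex_function_space_def M H
      using D.M_zero D.M_add D.M_cmult D.H_zero D.H_add D.H_cmult by blast+
    show "integral_functional H ` M = dual_space H D.NH"
      using D.integral_functional_dual D.dual_is_integral_functional unfolding M H by blast
    show "\<forall>f\<in>M. \<forall>g\<in>M. integral_functional H f = integral_functional H g \<longleftrightarrow> (AE x in lebesgue. f x = g x)"
      using D.integral_functional_eq_iff unfolding M H by blast
    show "\<forall>f\<in>M. \<forall>g\<in>M. \<forall>k\<in>H. integral_functional H (\<lambda>x. f x + g x) k = integral_functional H f k + integral_functional H g k"
      unfolding M H by (auto simp: ap distrib_right D.pairing_integrable)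
    show "\<forall>a. \<forall>f\<in>M. \<forall>k\<in>H. integral_functional H (\<lambda>x. a * f x) k = a * integral_functional H f k"
      unfolding M H by (auto simp: ap mult.assoc)
  qed (use eq2 H in simp)
  then show ?thesis
    using eq1 eq3 D.pairing_integrable D.integral_functional_dual D.dual_is_integral_functional
    unfolding M H D.sphere_norm_def[abs_def] by blast
qed

end
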